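(* Let $a,q,\alpha_1,\alpha_2,\beta_1,\gamma_1,\mu_1$ satisfy assumptions $(A1)$, $(A2)$, $(A3)$ of the context. Then there exist two positive constants $M$ and $\nu$ such that for every initial condition $(u_0,u_1,\eta_{1,0},\eta_{2,0},\zeta_{1,0})\in H^1(0,1)\times L^2(0,1)\times\mathbb{R}^3$, the corresponding unique weak solution $(u,\eta_1,\eta_2,\zeta_1)$ of system (S) of the context satisfies, for every $t\ge 0$, $$E(t)\le M\,E(0)\,e^{-\nu t}$$ and $$\max_{x\in[0,1]}|u(t,x)-u_*|^2\le M\,E(0)\,e^{-\nu t},$$ where $u_*=u_0(1)-\eta_{2,0}$ and $$E(t)=\frac12\int_0^1\big(u_t(t,x)^2+a(x)u_x(t,x)^2\big)\,dx+\frac{a(1)}{2\beta_1}\eta_1(t)^2+\frac{a(1)\alpha_2}{2\beta_1}\eta_2(t)^2+\frac{a(0)}{2\mu_1}\zeta_1(t)^2 .$$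
   Context: Assumptions. $(A1)$: $a\in W^{1,\infty}(0,1)$ and there are constants $\underline a,\overline a>0$ with $\underline a\le a\le\overline a$ on $[0,1]$. $(A2)$: $q\in L^\infty(0,1)$, $q\ge 0$ a.e. in $(0,1)$, and there are a nonempty open interval $\omega\subset(0,1)$ and constants $\underline q,\overline q>0$ with $\underline q\le q\le\overline q$ a.e. in $\omega$. $(A3)$: $\alpha_1,\alpha_2,\beta_1,\gamma_1,\mu_1$ are constants with $\alpha_1,\alpha_2,\beta_1,\gamma_1,\mu_1>0$. System (S) for $(u,\eta_1,\eta_2,\zeta_1)$: $u_{tt}-(a u_x)_x=-q u_t$ on $\mathbb{R}_+\times(0,1)$; $u_t(t,1)=\eta_1(t)$, $u_t(t,0)=\zeta_1(t)$; $\dot\eta_1(t)=-\alpha_1\eta_1(t)-\alpha_2\eta_2(t)-\beta_1u_x(t,1)$, $\dot\eta_2(t)=\eta_1(t)$, $\dot\zeta_1(t)=-\gamma_1\zeta_1(t)+\mu_1u_x(t,0)$, for $t\ge0$; $u(0,\cdot)=u_0$, $u_t(0,\cdot)=u_1$, $\eta_1(0)=\eta_{1,0}$, $\eta_2(0)=\eta_{2,0}$, $\zeta_1(0)=\zeta_{1,0}$. Weak solutions are understood in the sense of strongly continuous semigroups. The quantity $u(t,1)-\eta_2(t)$ is conserved and equal to $u_*=u_0(1)-\eta_{2,0}$, and adding a constant to $u$ preserves the equations. Let $\mathcal H_0=\{(\mathbf u,\mathbf v,\boldsymbol\eta_1,\boldsymbol\eta_2,\boldsymbol\zeta_1)\in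 H^1\times L^2\times\mathbb{C}^3:\mathbf u(1)=\boldsymbol\eta_2\}$ and let $\mathcal A(\mathbf u,\mathbf v,\boldsymbol\eta_1,\boldsymbol\eta_2,\boldsymbol\zeta_1)=(\mathbf v,(a\mathbf u_x)_x-q\mathbf v,-\alpha_1\boldsymbol\eta_1-\alpha_2\boldsymbol\eta_2-\beta_1\mathbf u_x(1),\boldsymbol\eta_1,-\gamma_1\boldsymbol\zeta_1+\mu_1\mathbf u_x(0))$ with domain the elements of $\mathcal H_0$ such that $\mathbf u\in H^2(0,1)$, $\mathbf v\in H^1(0,1)$, $\mathbf v(1)=\boldsymbol\eta_1$, $\mathbf v(0)=\boldsymbol\zeta_1$. $\mathcal A$ generates a strongly continuous semigroup $(S(t))_{t\ge0}$ on $\mathcal H_0$. The weak solution of (S) is $(u,\eta_1,\eta_2,\zeta_1)$ with $(u(t)-u_*,u_t(t),\eta_1(t),\eta_2(t),\zeta_1(t))=S(t)(u_0-u_*,u_1,\eta_{1,0},\eta_{2,0},\zeta_{1,0})$; it satisfies $u\in C^0([0,\infty);H^1(0,1))\cap C^1([0,\infty);L^2(0,1))$ and $\eta_1,\eta_2,\zeta_1\in C([0,\infty);\mathbb{R})$. *)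

theory Defs
  imports "HOL-Analysis.Analysis" "HOL-Library.Function_Algebras"
begin

section \<open>Lebesgue and Sobolev spaces on the unit interval\<close>

text \<open>
  Elements of \<open>L\<^sup>2\<close>, \<open>H\<^sup>1\<close>, etc. are represented by functions on the real line; only their
  restriction to the open unit interval matters, and only up to null sets. All predicates below
  are invariant under this identification. Point values of an element of a Sobolev
  space are those of its continuous representative on the closed interval.
\<close>

abbreviation I01 :: "real measure" where
  "I01 \<equiv> lebesgue_on {0<..<1}"

definition L2 :: "(real \<Rightarrow> 'a::{banach,second_countable_topology}) \<Rightarrow> bool" where
  "L2 f \<longleftrightarrow> f \<in> borel_measurable I01 \<and> integrable I01 (\<lambda>x. (norm (f x))\<^sup>2)"

definition Linf :: "(real \<Rightarrow> 'a::{banach,second_countable_topology}) \<Rightarrow> bool" where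
  "Linf f \<longleftrightarrow> f \<in> borel_measurable I01 \<and> (\<exists>C. AE x in I01. norm (f x) \<le> C)"

definition L2_norm :: "(real \<Rightarrow> 'a::{banach,second_countable_topology}) \<Rightarrow> real" where
  "L2_norm f = sqrt (\<integral>x. (norm (f x))\<^sup>2 \<partial>I01)"

text \<open>Test functions are the compactly supported \<open>C\<^sup>1\<close> functions.\<close>

definition test_fun :: "(real \<Rightarrow> real) \<Rightarrow> bool" where
  "test_fun \<phi> \<longleftrightarrow> \<phi> C1_differentiable_on UNIV \<and>
     (\<exists>K. compact K \<and> K \<subseteq> {0<..<1} \<and> (\<forall>x. x \<notin> K \<longrightarrow> \<phi> x = 0))"

definition weak_deriv ::
  "(real \<Rightarrow> 'a::{banach,second_countable_topology}) \<Rightarrow> (real \<Rightarrow> 'a) \<Rightarrow> bool" where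
  "weak_deriv f g \<longleftrightarrow> (\<forall>\<phi>. test_fun \<phi> \<longrightarrow>
     (\<integral>x. deriv \<phi> x *\<^sub>R f x \<partial>I01) = - (\<integral>x. \<phi> x *\<^sub>R g x \<partial>I01))"

definition H1 :: "(real \<Rightarrow> 'a::{banach,second_countable_topology}) \<Rightarrow> bool" where
  "H1 f \<longleftrightarrow> L2 f \<and> (\<exists>g. L2 g \<and> weak_deriv f g)"

definition W1inf :: "(real \<Rightarrow> 'a::{banach,second_countable_topology}) \<Rightarrow> bool" where
  "W1inf f \<longleftrightarrow> Linf f \<and> (\<exists>g. Linf g \<and> weak_deriv f g)"

text \<open>The weak derivative of an element of \<open>H\<^sup>1\<close>, unique up to null sets.\<close>

definition wderiv ::
  "(real \<Rightarrow> 'a::{banach,second_countable_topology}) \<Rightarrow> real \<Rightarrow> 'a" where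
  "wderiv f = (SOME g. L2 g \<and> weak_deriv f g)"

definition H2 :: "(real \<Rightarrow> 'a::{banach,second_countable_topology}) \<Rightarrow> bool" where
  "H2 f \<longleftrightarrow> H1 f \<and> H1 (wderiv f)"

text \<open>The continuous representative, unique on the closed unit interval.\<close>

definition cont_rep ::
  "(real \<Rightarrow> 'a::{banach,second_countable_topology}) \<Rightarrow> real \<Rightarrow> 'a" where
  "cont_rep f = (SOME g. continuous_on {0..1} g \<and> (AE x in I01. g x = f x))"

section \<open>Strongly continuous semigroups\<close>

text \<open>
  Semigroups on the space \<open>H\<close> with seminorm \<open>N\<close> and complex scalar multiplication \<open>scl\<close>, whose
  elements are identified when their difference has seminorm zero. Linearity and boundedness
  make each \<open>S t\<close> compatible with this identification.
\<close>

definition c0_semigroup ::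
  "(complex \<Rightarrow> 'x::ab_group_add \<Rightarrow> 'x) \<Rightarrow> 'x set \<Rightarrow> ('x \<Rightarrow> real) \<Rightarrow> (real \<Rightarrow> 'x \<Rightarrow> 'x) \<Rightarrow> bool" where
  "c0_semigroup scl H N S \<longleftrightarrow>
     (\<forall>t\<ge>0. \<forall>X\<in>H. S t X \<in> H) \<and>
     (\<forall>t\<ge>0. \<forall>X\<in>H. \<forall>Y\<in>H. N (S t (X + Y) - (S t X + S t Y)) = 0) \<and>
     (\<forall>t\<ge>0. \<forall>c. \<forall>X\<in>H. N (S t (scl c X) - scl c (S t X)) = 0) \<and>
     (\<forall>t\<ge>0. \<exists>C. \<forall>X\<in>H. N (S t X) \<le> C * N X) \<and>
     (\<forall>X\<in>H. N (S 0 X - X) = 0) \<and>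
     (\<forall>s\<ge>0. \<forall>t\<ge>0. \<forall>X\<in>H. N (S (s + t) X - S s (S t X)) = 0) \<and>
     (\<forall>X\<in>H. ((\<lambda>t. N (S t X - X)) \<longlongrightarrow> 0) (at_right 0))"

definition diff_quot_tendsto ::
  "(complex \<Rightarrow> 'x::ab_group_add \<Rightarrow> 'x) \<Rightarrow> ('x \<Rightarrow> real) \<Rightarrow> (real \<Rightarrow> 'x \<Rightarrow> 'x) \<Rightarrow> 'x \<Rightarrow> 'x \<Rightarrow> bool" where
  "diff_quot_tendsto scl N S X Y \<longleftrightarrow>
     ((\<lambda>h. N (scl (complex_of_real (1 / h)) (S h X - X) - Y)) \<longlongrightarrow> 0) (at_right 0)"

definition is_generator ::
  "(complex \<Rightarrow> 'x::ab_group_add \<Rightarrow> 'x) \<Rightarrow> 'x set \<Rightarrow> ('x \<Rightarrow> real) \<Rightarrow> 'x set \<Rightarrow> ('x \<Rightarrow> 'x)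
     \<Rightarrow> (real \<Rightarrow> 'x \<Rightarrow> 'x) \<Rightarrow> bool" where
  "is_generator scl H N D A S \<longleftrightarrow>
     D = {X \<in> H. \<exists>Y\<in>H. diff_quot_tendsto scl N S X Y} \<and>
     (\<forall>X\<in>D. A X \<in> H \<and> diff_quot_tendsto scl N S X (A X))"

section \<open>The damped wave equation with dynamic boundary conditions\<close>

definition A1 :: "(real \<Rightarrow> real) \<Rightarrow> bool" where
  "A1 a \<longleftrightarrow> W1inf a \<and>
     (\<exists>alo ahi. 0 < alo \<and> 0 < ahi \<and> (\<forall>x\<in>{0..1}. alo \<le> cont_rep a x \<and> cont_rep a x \<le> ahi))"

definition A2 :: "(real \<Rightarrow> real) \<Rightarrow> bool" where
  "A2 q \<longleftrightarrow> Linf q \<and> (AE x in I01. 0 \<le> q x) \<and>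
     (\<exists>c d qlo qhi. c < d \<and> {c<..<d} \<subseteq> {0<..<1} \<and> 0 < qlo \<and> 0 < qhi \<and>
        (AE x in I01. x \<in> {c<..<d} \<longrightarrow> qlo \<le> q x \<and> q x \<le> qhi))"

definition A3 :: "real \<Rightarrow> real \<Rightarrow> real \<Rightarrow> real \<Rightarrow> real \<Rightarrow> bool" where
  "A3 \<alpha>1 \<alpha>2 \<beta>1 \<gamma>1 \<mu>1 \<longleftrightarrow> 0 < \<alpha>1 \<and> 0 < \<alpha>2 \<and> 0 < \<beta>1 \<and> 0 < \<gamma>1 \<and> 0 < \<mu>1"

type_synonym state = "(real \<Rightarrow> complex) \<times> (real \<Rightarrow> complex) \<times> complex \<times> complex \<times> complex"

fun state_scale :: "complex \<Rightarrow> state \<Rightarrow> state" where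
  "state_scale c (u, v, e1, e2, z1) = ((\<lambda>x. c * u x), (\<lambda>x. c * v x), c * e1, c * e2, c * z1)"

fun state_norm :: "state \<Rightarrow> real" where
  "state_norm (u, v, e1, e2, z1) =
     sqrt ((L2_norm u)\<^sup>2 + (L2_norm (wderiv u))\<^sup>2 + (L2_norm v)\<^sup>2
           + (cmod e1)\<^sup>2 + (cmod e2)\<^sup>2 + (cmod z1)\<^sup>2)"

definition state_space :: "state set" where
  "state_space = {(u, v, e1, e2, z1). H1 u \<and> L2 v \<and> cont_rep u 1 = e2}"

definition dom_A :: "state set" where
  "dom_A = {(u, v, e1, e2, z1). (u, v, e1, e2, z1) \<in> state_space \<and>
     H2 u \<and> H1 v \<and> cont_rep v 1 = e1 \<and> cont_rep v 0 = z1}"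

fun op_A ::
  "(real \<Rightarrow> real) \<Rightarrow> (real \<Rightarrow> real) \<Rightarrow> real \<Rightarrow> real \<Rightarrow> real \<Rightarrow> real \<Rightarrow> real \<Rightarrow> state \<Rightarrow> state" where
  "op_A a q \<alpha>1 \<alpha>2 \<beta>1 \<gamma>1 \<mu>1 (u, v, e1, e2, z1) =
     (v,
      (\<lambda>x. wderiv (\<lambda>y. of_real (a y) * wderiv u y) x - of_real (q x) * v x),
      - of_real \<alpha>1 * e1 - of_real \<alpha>2 * e2 - of_real \<beta>1 * cont_rep (wderiv u) 1,
      e1,
      - of_real \<gamma>1 * z1 + of_real \<mu>1 * cont_rep (wderiv u) 0)"

fun real_state :: "(real \<Rightarrow> real) \<times> (real \<Rightarrow> real) \<times> real \<times> real \<times> real \<Rightarrow> state" where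
  "real_state (u, v, e1, e2, z1) =
     ((\<lambda>x. of_real (u x)), (\<lambda>x. of_real (v x)), of_real e1, of_real e2, of_real z1)"

text \<open>\<open>ut\<close> is the derivative of \<open>u\<close> as a map from the half-line \<open>t \<ge> 0\<close> to \<open>L\<^sup>2\<close>.\<close>

definition L2_time_deriv :: "(real \<Rightarrow> real \<Rightarrow> real) \<Rightarrow> (real \<Rightarrow> real \<Rightarrow> real) \<Rightarrow> bool" where
  "L2_time_deriv u ut \<longleftrightarrow> (\<forall>t\<ge>0. L2 (u t) \<and> L2 (ut t) \<and>
     ((\<lambda>s. L2_norm (\<lambda>x. (u s x - u t x) / (s - t) - ut t x)) \<longlongrightarrow> 0) (at t within {0..}))"

definition u_star :: "(real \<Rightarrow> real) \<Rightarrow> real \<Rightarrow> real" where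
  "u_star u0 \<eta>20 = cont_rep u0 1 - \<eta>20"

text \<open>
  The weak solution \<open>(u, \<eta>\<^sub>1, \<eta>\<^sub>2, \<zeta>\<^sub>1)\<close>, together with its velocity \<open>ut\<close>, for the initial
  condition \<open>(u0, u1, \<eta>10, \<eta>20, \<zeta>10)\<close>. The generator determines the semigroup up to the
  identification of elements of the state space.
\<close>

definition weak_solution ::
  "(real \<Rightarrow> real) \<Rightarrow> (real \<Rightarrow> real) \<Rightarrow> real \<Rightarrow> real \<Rightarrow> real \<Rightarrow> real \<Rightarrow> real
   \<Rightarrow> (real \<Rightarrow> real) \<Rightarrow> (real \<Rightarrow> real) \<Rightarrow> real \<Rightarrow> real \<Rightarrow> real
   \<Rightarrow> (real \<Rightarrow> real \<Rightarrow> real) \<Rightarrow> (real \<Rightarrow> real \<Rightarrow> real) \<Rightarrow> (real \<Rightarrow> real) \<Rightarrow> (real \<Rightarrow> real)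
   \<Rightarrow> (real \<Rightarrow> real) \<Rightarrow> bool" where
  "weak_solution a q \<alpha>1 \<alpha>2 \<beta>1 \<gamma>1 \<mu>1 u0 u1 \<eta>10 \<eta>20 \<zeta>10 u ut \<eta>1 \<eta>2 \<zeta>1 \<longleftrightarrow>
     L2_time_deriv u ut \<and>
     (\<exists>S. c0_semigroup state_scale state_space state_norm S \<and>
        is_generator state_scale state_space state_norm dom_A (op_A a q \<alpha>1 \<alpha>2 \<beta>1 \<gamma>1 \<mu>1) S \<and>
        (\<forall>t\<ge>0.
           real_state (\<lambda>x. u t x - u_star u0 \<eta>20, ut t, \<eta>1 t, \<eta>2 t, \<zeta>1 t) \<in> state_space \<and>
           state_norm (real_state (\<lambda>x. u t x - u_star u0 \<eta>20, ut t, \<eta>1 t, \<eta>2 t, \<zeta>1 t)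
             - S t (real_state (\<lambda>x. u0 x - u_star u0 \<eta>20, u1, \<eta>10, \<eta>20, \<zeta>10))) = 0))"

definition energy ::
  "(real \<Rightarrow> real) \<Rightarrow> real \<Rightarrow> real \<Rightarrow> real
   \<Rightarrow> (real \<Rightarrow> real \<Rightarrow> real) \<Rightarrow> (real \<Rightarrow> real \<Rightarrow> real) \<Rightarrow> (real \<Rightarrow> real) \<Rightarrow> (real \<Rightarrow> real)
   \<Rightarrow> (real \<Rightarrow> real) \<Rightarrow> real \<Rightarrow> real" where
  "energy a \<alpha>2 \<beta>1 \<mu>1 u ut \<eta>1 \<eta>2 \<zeta>1 t =
     1 / 2 * (\<integral>x. ((ut t x)\<^sup>2 + a x * (wderiv (u t) x)\<^sup>2) \<partial>I01)
     + cont_rep a 1 / (2 * \<beta>1) * (\<eta>1 t)\<^sup>2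
     + cont_rep a 1 * \<alpha>2 / (2 * \<beta>1) * (\<eta>2 t)\<^sup>2
     + cont_rep a 0 / (2 * \<mu>1) * (\<zeta>1 t)\<^sup>2"

end

theory Submission
  imports Defs
begin

text \<open>
  Twice the energy is a quadratic form \<open>e\<close> with \<open>e(X, A X) = - D(X)\<close>, where \<open>D\<close> collects
  \<open>\<integral> q u\<^sub>t\<^sup>2\<close> and the squares of \<open>\<eta>\<^sub>1\<close> and \<open>\<zeta>\<^sub>1\<close>. It is perturbed by a small multiple of
  \<open>\<integral> p u\<^sub>x u\<^sub>t + \<integral> m u\<^sub>t\<close> plus boundary terms, where \<open>p\<close> vanishes at both ends and is steep
  outside the damped interval, and \<open>m(x) = \<theta> u(1) - \<integral>\<^sub>x\<^sup>1 g u\<^sub>x\<close>. Since \<open>m\<^sub>x = g u\<^sub>x\<close>, the second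
  multiplier yields the potential energy weighted by \<open>g\<close> without lower order terms, and
  \<open>m\<^sub>t = g u\<^sub>t + \<integral>\<^sub>x\<^sup>1 g' u\<^sub>t\<close> is controlled by the damping up to the constant part \<open>\<theta>\<close> of \<open>g\<close>. Along
  the equation the perturbation decreases at the rate \<open>\<theta> e\<close> up to multiples of \<open>D\<close> and of the
  square root of \<open>e D\<close>, so that the perturbed form \<open>b\<close> satisfies \<open>b(X, A X) \<le> - \<nu> b(X, X)\<close> on the
  domain of \<open>A\<close>. Orbits that start in the domain, which is dense, are differentiable for \<open>b\<close> by the
  uniform boundedness principle, and hence decay exponentially.
\<close>

section \<open>Square integrable functions and primitives\<close>

text \<open>\<open>D\<close> controls neither \<open>u_x\<close> nor \<eta>2, so the decay of
  \<open>e\<close> cannot be read off from \<open>D\<close> alone. The multipliers are shaped by the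
  traces \<open>u_x(0)\<close> and \<open>u_x(1)\<close>, which no multiple of \<open>e\<close> or
  \<open>D\<close> bounds. As \<open>p\<close> vanishes at both ends, the first multiplier never
  meets them; but then \<open>p'\<close> cannot be positive throughout, and its negative part has to
  sit where the velocity is damped. The potential energy lost there is recovered by the second
  multiplier. The familiar choice \<open>g u\<close> would leave a term \<open>g' u u_x\<close> that
  is as large as \<open>e\<close> itself, hence the integral in \<open>m\<close>. The traces that
  \<open>m\<close> does produce cancel exactly against the boundary terms of the perturbation, by
  the equations for \<eta>1 and \<zeta>1; the same computation yields a negative square of \<eta>2,
  which has no damping of its own. On the side of semigroups, every \<open>S t\<close> is bounded,
  but no uniformity in \<open>t\<close> is assumed. Left difference quotients of an orbit involve
  \<open>S (t - h)\<close> for all small \<open>h\<close>, and this is where uniform boundedness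
  enters. States are functions rather than classes, so the laws of the semigroup hold modulo null
  vectors of a seminorm.\<close>

lemma finite_measure_I01: "finite_measure I01"
  by (rule finite_measure_lebesgue_on) auto

interpretation I01: finite_measure I01
  by (rule finite_measure_I01)

interpretation I01_pair: pair_sigma_finite I01 I01 ..

lemma L2_measurable: "L2 f \<Longrightarrow> f \<in> borel_measurable I01"
  by (simp add: L2_def)

lemma L2_bound:
  fixes f :: "real \<Rightarrow> 'a::{banach,second_countable_topology}"
    and g :: "real \<Rightarrow> 'b::{banach,second_countable_topology}"
  assumes f: "L2 f" and g: "g \<in> borel_measurable I01" and le: "AE x in I01. norm (g x) \<le> C * norm (f x)"
  shows "L2 g"
  unfolding L2_def
proof (intro conjI g)
  have "integrable I01 (\<lambda>x. C\<^sup>2 * (norm (f x))\<^sup>2)"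
    using f by (simp add: L2_def)
  then show "integrable I01 (\<lambda>x. (norm (g x))\<^sup>2)"
  proof (rule Bochner_Integration.integrable_bound)
    show "(\<lambda>x. (norm (g x))\<^sup>2) \<in> borel_measurable I01"
      using g by measurable
    show "AE x in I01. norm ((norm (g x))\<^sup>2) \<le> norm (C\<^sup>2 * (norm (f x))\<^sup>2)"
      using le
    proof eventually_elim
      case (elim x)
      then have "(norm (g x))\<^sup>2 \<le> (C * norm (f x))\<^sup>2"
        by (intro power_mono) auto
      then show ?case by (simp add: power_mult_distrib)
    qed
  qed
qed

lemma L2_AE_cong:
  assumes "L2 f" "g \<in> borel_measurable I01" "AE x in I01. g x = f x"
  shows "L2 g"
  by (rule L2_bound[OF assms(1,2), of 1]) (use assms(3) in auto)

lemma L2_add: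
  assumes f: "L2 f" and g: "L2 g" shows "L2 (\<lambda>x. f x + g x)"
  unfolding L2_def
proof
  show m: "(\<lambda>x. f x + g x) \<in> borel_measurable I01"
    using f g by (auto simp: L2_def)
  have "integrable I01 (\<lambda>x. 2 * (norm (f x))\<^sup>2 + 2 * (norm (g x))\<^sup>2)"
    using f g by (simp add: L2_def)
  then show "integrable I01 (\<lambda>x. (norm (f x + g x))\<^sup>2)"
  proof (rule Bochner_Integration.integrable_bound)
    show "(\<lambda>x. (norm (f x + g x))\<^sup>2) \<in> borel_measurable I01"
      using m by measurable
    have "(norm (f x + g x))\<^sup>2 \<le> 2 * (norm (f x))\<^sup>2 + 2 * (norm (g x))\<^sup>2" for x
    proof -
      have "(norm (f x + g x))\<^sup>2 \<le> (norm (f x) + norm (g x))\<^sup>2"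
        by (intro power_mono norm_triangle_ineq) auto
      also have "\<dots> \<le> 2 * (norm (f x))\<^sup>2 + 2 * (norm (g x))\<^sup>2"
        using zero_le_power2[of "norm (f x) - norm (g x)"] by (simp add: power2_eq_square algebra_simps)
      finally show ?thesis .
    qed
    then show "AE x in I01. norm ((norm (f x + g x))\<^sup>2) \<le> norm (2 * (norm (f x))\<^sup>2 + 2 * (norm (g x))\<^sup>2)"
      by (intro AE_I2) (smt (verit) real_norm_def zero_le_power2)
  qed
qed

text \<open>Three products occur below: a real weight times a function, the real inner product, and
  complex multiplication. An arbitrary bounded bilinear map covers all of them.\<close>

lemma borel_measurable_bilinear:
  fixes p :: "'a::{banach,second_countable_topology} \<Rightarrow> 'b::{banach,second_countable_topology}
    \<Rightarrow> 'c::{banach,second_countable_topology}"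
  assumes p: "bounded_bilinear p" and f: "f \<in> borel_measurable M" and g: "g \<in> borel_measurable M"
  shows "(\<lambda>x. p (f x) (g x)) \<in> borel_measurable M"
  by (rule borel_measurable_continuous_Pair[OF f g])
     (intro bounded_bilinear.continuous_on[OF p] continuous_intros)

lemma Linf_mult_L2:
  fixes p :: "'a::{banach,second_countable_topology} \<Rightarrow> 'b::{banach,second_countable_topology}
    \<Rightarrow> 'c::{banach,second_countable_topology}"
  assumes p: "bounded_bilinear p" and f: "Linf f" and g: "L2 g"
  shows "L2 (\<lambda>x. p (f x) (g x))"
proof -
  obtain C where C: "AE x in I01. norm (f x) \<le> C" using f by (auto simp: Linf_def)
  obtain K where K: "0 \<le> K" "\<And>a b. norm (p a b) \<le> norm a * norm b * K"
    using bounded_bilinear.nonneg_bounded[OF p] by blast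
  show ?thesis
  proof (rule L2_bound[OF g, of _ "C * K"])
    show "(\<lambda>x. p (f x) (g x)) \<in> borel_measurable I01"
      using f g by (intro borel_measurable_bilinear[OF p]) (auto simp: L2_def Linf_def)
    show "AE x in I01. norm (p (f x) (g x)) \<le> C * K * norm (g x)"
      using C
    proof eventually_elim
      case (elim x)
      have "norm (p (f x) (g x)) \<le> norm (f x) * norm (g x) * K" by (rule K)
      also have "\<dots> \<le> C * norm (g x) * K"
        using elim K(1) by (intro mult_right_mono) auto
      finally show ?case by (simp add: ac_simps)
    qed
  qed
qed

lemma L2_const [simp]: "L2 (\<lambda>x. c)"
  by (auto simp: L2_def)

lemma Linf_const [simp]: "Linf (\<lambda>x. c)"
  by (auto simp: Linf_def)

lemma Linf_imp_L2:
  assumes "Linf f" shows "L2 f"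
  using Linf_mult_L2[OF bounded_bilinear.flip[OF bounded_bilinear_scaleR] assms L2_const[of 1]] by simp

lemma L2_scaleR: "L2 f \<Longrightarrow> L2 (\<lambda>x. c *\<^sub>R f x)"
  by (rule Linf_mult_L2[OF bounded_bilinear_scaleR]) auto

lemma L2_mult:
  fixes f :: "real \<Rightarrow> 'a::{banach,second_countable_topology,real_normed_algebra}"
  shows "L2 f \<Longrightarrow> L2 (\<lambda>x. c * f x)"
  by (rule Linf_mult_L2[OF bounded_bilinear_mult]) auto

lemma L2_minus: "L2 f \<Longrightarrow> L2 (\<lambda>x. - f x)"
  using L2_scaleR[of f "-1"] by simp

lemma L2_diff: "L2 f \<Longrightarrow> L2 g \<Longrightarrow> L2 (\<lambda>x. f x - g x)"
  using L2_add[OF _ L2_minus, of f g] by simp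

lemma L2_bilinear_integrable:
  fixes p :: "'a::{banach,second_countable_topology} \<Rightarrow> 'b::{banach,second_countable_topology}
    \<Rightarrow> 'c::{banach,second_countable_topology}"
  assumes p: "bounded_bilinear p" and f: "L2 f" and g: "L2 g"
  shows "integrable I01 (\<lambda>x. p (f x) (g x))"
proof -
  obtain K where K: "0 \<le> K" "\<And>a b. norm (p a b) \<le> norm a * norm b * K"
    using bounded_bilinear.nonneg_bounded[OF p] by blast
  have "integrable I01 (\<lambda>x. K * ((norm (f x))\<^sup>2 + (norm (g x))\<^sup>2))"
    using f g by (simp add: L2_def)
  then show ?thesis
  proof (rule Bochner_Integration.integrable_bound)
    show "(\<lambda>x. p (f x) (g x)) \<in> borel_measurable I01"
      using f g by (intro borel_measurable_bilinear[OF p]) (auto simp: L2_def)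
    have "norm (p (f x) (g x)) \<le> K * ((norm (f x))\<^sup>2 + (norm (g x))\<^sup>2)" for x
    proof -
      have "norm (f x) * norm (g x) \<le> (norm (f x))\<^sup>2 + (norm (g x))\<^sup>2"
        using sum_squares_bound[of "norm (f x)" "norm (g x)"]
          mult_nonneg_nonneg[OF norm_ge_zero norm_ge_zero, of "f x" "g x"] by linarith
      then have "norm (f x) * norm (g x) * K \<le> K * ((norm (f x))\<^sup>2 + (norm (g x))\<^sup>2)"
        using K(1) by (simp add: mult.commute mult_left_mono)
      then show ?thesis using K(2)[of "f x" "g x"] by linarith
    qed
    then show "AE x in I01. norm (p (f x) (g x)) \<le> norm (K * ((norm (f x))\<^sup>2 + (norm (g x))\<^sup>2))"
      by (intro AE_I2) (smt (verit) real_norm_def)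
  qed
qed

lemma L2_integrable:
  assumes "L2 f" shows "integrable I01 f"
  using L2_bilinear_integrable[OF bounded_bilinear_scaleR L2_const[of 1] assms] by simp

lemma continuous_on_measurable_I01:
  assumes "continuous_on {0..1} f"
  shows "f \<in> borel_measurable I01"
  by (rule continuous_imp_measurable_on_sets_lebesgue) (auto intro: continuous_on_subset[OF assms])

lemma continuous_on_Linf:
  fixes f :: "real \<Rightarrow> 'a::{banach,second_countable_topology}"
  assumes "continuous_on {0..1} f"
  shows "Linf f"
proof -
  have "bounded (f ` {0..1})"
    using assms by (intro compact_imp_bounded compact_continuous_image) auto
  then obtain C where "\<forall>x\<in>{0..1}. norm (f x) \<le> C"
    by (auto simp: bounded_iff)
  then have "AE x in I01. norm (f x) \<le> C"
    by (intro AE_I2) auto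
  then show ?thesis using continuous_on_measurable_I01[OF assms] by (auto simp: Linf_def)
qed

section \<open>Primitives, integration by parts and absolutely continuous functions\<close>

definition prim :: "(real \<Rightarrow> 'a::{banach,second_countable_topology}) \<Rightarrow> real \<Rightarrow> 'a" where
  "prim f x = (\<integral>t. indicator {..<x} t *\<^sub>R f t \<partial>I01)"

lemma indicator_measurable_I01 [measurable]: "A \<in> sets borel \<Longrightarrow> indicator A \<in> borel_measurable I01"
  by (intro measurable_restrict_space1 borel_measurable_indicator) auto

lemma prim_integrable:
  fixes f :: "real \<Rightarrow> 'a::{banach,second_countable_topology}"
  assumes "integrable I01 f" "A \<in> sets borel"
  shows "integrable I01 (\<lambda>t. indicator A t *\<^sub>R f t)"
proof (rule Bochner_Integration.integrable_bound[OF assms(1)])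
  show "(\<lambda>t. indicator A t *\<^sub>R f t) \<in> borel_measurable I01"
    using assms by measurable
qed (auto simp: indicator_def)

lemma prim_0 [simp]: "prim f 0 = 0"
proof -
  have "prim f 0 = (\<integral>t. 0 \<partial>I01)"
    unfolding prim_def by (rule Bochner_Integration.integral_cong) (auto simp: indicator_def)
  then show ?thesis by simp
qed

lemma prim_1: "prim f 1 = (\<integral>t. f t \<partial>I01)"
  unfolding prim_def by (rule Bochner_Integration.integral_cong) (auto simp: indicator_def)

lemma prim_cong_AE:
  assumes "f \<in> borel_measurable I01" "g \<in> borel_measurable I01" "AE x in I01. f x = g x"
  shows "prim f x = prim g x"
  unfolding prim_def
  by (rule integral_cong_AE) (use assms in \<open>auto intro!: measurable\<close>)

lemma prim_cong:
  assumes "\<And>x. 0 < x \<Longrightarrow> x < 1 \<Longrightarrow> f x = g x"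
  shows "prim f x = prim g x"
  unfolding prim_def
  by (rule Bochner_Integration.integral_cong) (use assms in auto)

lemma prim_add:
  assumes "integrable I01 f" "integrable I01 g"
  shows "prim (\<lambda>x. f x + g x) x = prim f x + prim g x"
  unfolding prim_def by (simp add: scaleR_add_right prim_integrable assms)

lemma prim_bounded_linear:
  assumes "bounded_linear T" "integrable I01 f"
  shows "prim (\<lambda>x. T (f x)) x = T (prim f x)"
  unfolding prim_def
  by (subst integral_bounded_linear[OF assms(1), symmetric])
     (auto simp: prim_integrable assms linear_simps[OF assms(1)])

text \<open>Holds for every real \<open>x\<close>, because \<open>prim\<close> integrates over a
  half-line against a measure carried by the unit interval.\<close>

lemma norm_prim_le:
  assumes "integrable I01 f"
  shows "norm (prim f x) \<le> (\<integral>t. norm (f t) \<partial>I01)"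
  unfolding prim_def
  by (rule order_trans[OF integral_norm_bound], rule integral_mono)
     (simp_all add: prim_integrable assms integrable_norm del: norm_scaleR, simp add: indicator_def)

lemma AE_I01_neq: "AE t in I01. t \<noteq> (x::real)"
proof -
  have "{x} \<in> null_sets lebesgue" by (simp add: null_sets_completionI)
  then have "AE t in lebesgue. t \<noteq> x" by (rule AE_I') auto
  then show ?thesis by (auto simp: AE_restrict_space_iff)
qed

text \<open>Along a sequence tending to \<open>x\<close> the indicators of the half-lines converge
  off the single point \<open>x\<close>, a null set, and \<open>norm (f t)\<close>
  dominates.\<close>

lemma continuous_prim:
  fixes f :: "real \<Rightarrow> 'a::{banach,second_countable_topology}"
  assumes f: "integrable I01 f"
  shows "continuous_on S (prim f)"
proof -
  have "isCont (prim f) x" for x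
    unfolding continuous_at_sequentially o_def
  proof safe
    fix s assume s: "s \<longlonglongrightarrow> x"
    show "(\<lambda>n. prim f (s n)) \<longlonglongrightarrow> prim f x"
      unfolding prim_def
    proof (rule integral_dominated_convergence[where w="\<lambda>t. norm (f t)"])
      show "AE t in I01. (\<lambda>n. indicator {..<s n} t *\<^sub>R f t) \<longlonglongrightarrow> indicator {..<x} t *\<^sub>R f t"
        using AE_I01_neq[of x]
      proof eventually_elim
        case (elim t)
        have "eventually (\<lambda>n. indicator {..<s n} t = (indicator {..<x} t :: real)) sequentially"
        proof (cases "t < x")
          case True
          then show ?thesis using order_tendstoD(1)[OF s, of t]
            by (auto elim!: eventually_mono simp: indicator_def)
        next
          case False
          then show ?thesis using order_tendstoD(2)[OF s, of t] elim
            by (auto elim!: eventually_mono simp: indicator_def)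
        qed
        then have "eventually (\<lambda>n. indicator {..<s n} t *\<^sub>R f t = indicator {..<x} t *\<^sub>R f t) sequentially"
          by eventually_elim simp
        then show ?case by (rule tendsto_eventually)
      qed
          show "(\<lambda>t. indicator {..<x} t *\<^sub>R f t) \<in> borel_measurable I01"
        "(\<lambda>t. indicator {..<s n} t *\<^sub>R f t) \<in> borel_measurable I01" for n
        by (intro borel_measurable_integrable prim_integrable f; simp)+
    qed (use f in \<open>auto simp: indicator_def\<close>)
  qed
  then show ?thesis by (simp add: continuous_at_imp_continuous_on)
qed

lemma integrable_bilinear_bounded:
  fixes p :: "'a::{banach,second_countable_topology} \<Rightarrow> 'b::{banach,second_countable_topology}
    \<Rightarrow> 'c::{banach,second_countable_topology}"
  assumes p: "bounded_bilinear p" and f: "integrable M f" and g: "g \<in> borel_measurable M"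
    and C: "\<And>x. norm (g x) \<le> C"
  shows "integrable M (\<lambda>x. p (f x) (g x))"
proof -
  obtain K where K: "0 \<le> K" "\<And>a b. norm (p a b) \<le> norm a * norm b * K"
    using bounded_bilinear.nonneg_bounded[OF p] by blast
  have "integrable M (\<lambda>x. norm (f x) * C * K)" using f by simp
  then show ?thesis
  proof (rule Bochner_Integration.integrable_bound)
    show "(\<lambda>x. p (f x) (g x)) \<in> borel_measurable M"
      using f g by (intro borel_measurable_bilinear[OF p]) auto
    have "norm (p (f x) (g x)) \<le> norm (norm (f x) * C * K)" for x
    proof -
      have "norm (p (f x) (g x)) \<le> norm (f x) * norm (g x) * K" by (rule K)
      also have "\<dots> \<le> norm (f x) * C * K"
        using C K(1) by (intro mult_right_mono mult_left_mono) auto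
      finally show ?thesis by simp
    qed
    then show "AE x in M. norm (p (f x) (g x)) \<le> norm (norm (f x) * C * K)" by simp
  qed
qed

text \<open>Integration by parts without pointwise derivatives. The left side is a double integral
  over the square \<open>s, t < x\<close>, which the diagonal cuts into \<open>t < s\<close> and
  \<open>s < t\<close>. Integrating each part first in its smaller variable gives one of the two
  summands.\<close>

lemma prim_product:
  fixes p :: "'a::{banach,second_countable_topology} \<Rightarrow> 'b::{banach,second_countable_topology}
    \<Rightarrow> 'c::{banach,second_countable_topology}"
  assumes p: "bounded_bilinear p" and f: "integrable I01 f" and g: "integrable I01 g"
  shows "p (prim f x) (prim g x) = prim (\<lambda>t. p (f t) (prim g t) + p (prim f t) (g t)) x"
proof -
  note [measurable] = borel_measurable_integrable[OF f] borel_measurable_integrable[OF g]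
  obtain K where K: "0 \<le> K" "\<And>a b. norm (p a b) \<le> norm a * norm b * K"
    using bounded_bilinear.nonneg_bounded[OF p] by blast
  note lin = bounded_bilinear.bounded_linear_left[OF p] bounded_bilinear.bounded_linear_right[OF p]
  have ig: "integrable I01 (\<lambda>t. p (f s) (g t))" for s
    by (rule integrable_bounded_linear[OF lin(2) g])
  have meas [measurable]: "(\<lambda>z. p (f (fst z)) (g (snd z))) \<in> borel_measurable (I01 \<Otimes>\<^sub>M I01)"
    by (rule borel_measurable_bilinear[OF p]) measurable
  have prod: "integrable (I01 \<Otimes>\<^sub>M I01) (\<lambda>z. p (f (fst z)) (g (snd z)))"
  proof (rule I01_pair.Fubini_integrable)
    show "integrable I01 (\<lambda>s. \<integral>t. norm (p (f (fst (s, t))) (g (snd (s, t)))) \<partial>I01)"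
    proof (rule Bochner_Integration.integrable_bound)
      show "integrable I01 (\<lambda>s. norm (f s) * (K * (\<integral>t. norm (g t) \<partial>I01)))"
        using f by simp
      show "(\<lambda>s. \<integral>t. norm (p (f (fst (s, t))) (g (snd (s, t)))) \<partial>I01) \<in> borel_measurable I01"
        by (rule I01.borel_measurable_lebesgue_integral) (use meas in \<open>simp add: split_def\<close>)
      have "norm (\<integral>t. norm (p (f s) (g t)) \<partial>I01) \<le> norm (f s) * (K * (\<integral>t. norm (g t) \<partial>I01))" for s
      proof -
        have "(\<integral>t. norm (p (f s) (g t)) \<partial>I01) \<le> (\<integral>t. norm (f s) * K * norm (g t) \<partial>I01)"
        proof (rule integral_mono)
          show "norm (p (f s) (g t)) \<le> norm (f s) * K * norm (g t)" for t
            using K(2)[of "f s" "g t"] by (simp only: ac_simps)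
        qed (use g ig in \<open>auto intro!: integrable_norm\<close>)
        then show ?thesis by (simp add: ac_simps)
      qed
      then show "AE s in I01. norm (\<integral>t. norm (p (f (fst (s, t))) (g (snd (s, t)))) \<partial>I01)
          \<le> norm (norm (f s) * (K * (\<integral>t. norm (g t) \<partial>I01)))"
        by (intro AE_I2) (simp add: K(1) abs_mult)
    qed
  qed (use ig in simp_all)
  have int1: "integrable I01 (\<lambda>s. p (f s) (prim g s))"
    by (rule integrable_bilinear_bounded[OF p f _ norm_prim_le[OF g]])
       (intro continuous_on_measurable_I01 continuous_prim g)
  have int2: "integrable I01 (\<lambda>s. p (prim f s) (g s))"
    by (rule integrable_bilinear_bounded[OF bounded_bilinear.flip[OF p] g _ norm_prim_le[OF f]])
       (intro continuous_on_measurable_I01 continuous_prim f)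
  \<comment> \<open>The part \<open>s < t < x\<close> of the square. The other part is already in
    the right order of integration; this one needs Fubini.\<close>
  define R where "R = (\<lambda>s t. (indicator {..<t} s * indicator {..<x} t) *\<^sub>R p (f s) (g t))"
  have mind: "{z \<in> space (I01 \<Otimes>\<^sub>M I01). fst z < snd z} \<in> sets (I01 \<Otimes>\<^sub>M I01)"
    "{z \<in> space (I01 \<Otimes>\<^sub>M I01). snd z < x} \<in> sets (I01 \<Otimes>\<^sub>M I01)"
  proof -
    have id: "(\<lambda>x. x) \<in> borel_measurable I01"
      by (intro continuous_on_measurable_I01 continuous_intros)
    have fst: "fst \<in> borel_measurable (I01 \<Otimes>\<^sub>M I01)" and snd: "snd \<in> borel_measurable (I01 \<Otimes>\<^sub>M I01)"
      using measurable_compose[OF measurable_fst id] measurable_compose[OF measurable_snd id] by auto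
    show "{z \<in> space (I01 \<Otimes>\<^sub>M I01). fst z < snd z} \<in> sets (I01 \<Otimes>\<^sub>M I01)"
      by (rule borel_measurable_less[OF fst snd])
    show "{z \<in> space (I01 \<Otimes>\<^sub>M I01). snd z < x} \<in> sets (I01 \<Otimes>\<^sub>M I01)"
      by (rule borel_measurable_less[OF snd borel_measurable_const])
  qed
  have R: "integrable (I01 \<Otimes>\<^sub>M I01) (case_prod R)"
  proof (rule Bochner_Integration.integrable_bound[OF prod])
    have "case_prod R = (\<lambda>z. (indicator {z. fst z < snd z} z * indicator {z. snd z < x} z) *\<^sub>R p (f (fst z)) (g (snd z)))"
      by (auto simp: R_def fun_eq_iff indicator_def)
    then show "case_prod R \<in> borel_measurable (I01 \<Otimes>\<^sub>M I01)"
      using meas mind by (auto intro!: borel_measurable_scaleR borel_measurable_times borel_measurable_indicator')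
  qed (auto simp: R_def indicator_def)
  have "p (prim f x) (prim g x) = (\<integral>s. \<integral>t. (indicator {..<x} s * indicator {..<x} t) *\<^sub>R p (f s) (g t) \<partial>I01 \<partial>I01)"
    unfolding prim_def
    apply (subst integral_bounded_linear[OF lin(1), symmetric])
     apply (simp add: prim_integrable f)
    apply (subst integral_bounded_linear[OF lin(2), symmetric])
     apply (simp add: prim_integrable g)
    apply (simp add: linear_simps[OF lin(1)] linear_simps[OF lin(2)] mult.commute)
    done
  also have "\<dots> = (\<integral>s. indicator {..<x} s *\<^sub>R p (f s) (prim g s) + (\<integral>t. R s t \<partial>I01) \<partial>I01)"
  proof (rule Bochner_Integration.integral_cong[OF refl])
    fix s assume "s \<in> space I01"
    have "R s = (\<lambda>t. indicator ({s<..} \<inter> {..<x}) t *\<^sub>R p (f s) (g t))"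
      by (auto simp: R_def indicator_def fun_eq_iff)
    then have iR: "integrable I01 (R s)"
      by (simp only:) (rule prim_integrable[OF ig], simp)
    have i2: "integrable I01 (\<lambda>t. (indicator {..<x} s * indicator {..<s} t) *\<^sub>R p (f s) (g t))"
      by (simp flip: scaleR_scaleR add: prim_integrable ig)
    have "(\<integral>t. (indicator {..<x} s * indicator {..<x} t) *\<^sub>R p (f s) (g t) \<partial>I01)
      = (\<integral>t. (indicator {..<x} s * indicator {..<s} t) *\<^sub>R p (f s) (g t) + R s t \<partial>I01)"
    proof (rule integral_cong_AE)
      \<comment> \<open>The diagonal \<open>t = s\<close> belongs to neither part and is null for
        each fixed \<open>s\<close>.\<close>
      show "AE t in I01. (indicator {..<x} s * indicator {..<x} t) *\<^sub>R p (f s) (g t)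
        = (indicator {..<x} s * indicator {..<s} t) *\<^sub>R p (f s) (g t) + R s t"
        using AE_I01_neq[of s] by eventually_elim (auto simp: R_def indicator_def)
    qed (use ig[of s] in \<open>auto intro!: borel_measurable_integrable Bochner_Integration.integrable_add i2 iR
         simp flip: scaleR_scaleR simp: prim_integrable\<close>)
    also have "\<dots> = indicator {..<x} s *\<^sub>R (\<integral>t. indicator {..<s} t *\<^sub>R p (f s) (g t) \<partial>I01) + (\<integral>t. R s t \<partial>I01)"
      by (subst Bochner_Integration.integral_add[OF i2 iR]) (simp flip: scaleR_scaleR)
    also have "(\<integral>t. indicator {..<s} t *\<^sub>R p (f s) (g t) \<partial>I01) = p (f s) (prim g s)"
      using prim_bounded_linear[OF lin(2) g] by (simp add: prim_def)
    finally show "(\<integral>t. (indicator {..<x} s * indicator {..<x} t) *\<^sub>R p (f s) (g t) \<partial>I01)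
      = indicator {..<x} s *\<^sub>R p (f s) (prim g s) + (\<integral>t. R s t \<partial>I01)" .
  qed
  also have "\<dots> = (\<integral>s. indicator {..<x} s *\<^sub>R p (f s) (prim g s) \<partial>I01) + (\<integral>s. \<integral>t. R s t \<partial>I01 \<partial>I01)"
  proof (rule Bochner_Integration.integral_add)
    show "integrable I01 (\<lambda>s. \<integral>t. R s t \<partial>I01)"
      using I01_pair.integrable_fst[OF R] by simp
    show "integrable I01 (\<lambda>s. indicator {..<x} s *\<^sub>R p (f s) (prim g s))"
      by (intro prim_integrable int1) auto
  qed
  also have "(\<integral>s. \<integral>t. R s t \<partial>I01 \<partial>I01) = (\<integral>t. \<integral>s. R s t \<partial>I01 \<partial>I01)"
    using I01_pair.Fubini_integral[OF R] by simp
  also have "\<dots> = (\<integral>t. indicator {..<x} t *\<^sub>R p (prim f t) (g t) \<partial>I01)"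
  proof (rule Bochner_Integration.integral_cong[OF refl])
    fix t
    have "(\<integral>s. R s t \<partial>I01) = indicator {..<x} t *\<^sub>R (\<integral>s. indicator {..<t} s *\<^sub>R p (f s) (g t) \<partial>I01)"
      unfolding R_def mult.commute[of "indicator {..<t} _"] by (simp flip: scaleR_scaleR)
    also have "(\<integral>s. indicator {..<t} s *\<^sub>R p (f s) (g t) \<partial>I01) = p (prim f t) (g t)"
      using prim_bounded_linear[OF lin(1) f] by (simp add: prim_def)
    finally show "(\<integral>s. R s t \<partial>I01) = indicator {..<x} t *\<^sub>R p (prim f t) (g t)" .
  qed
  finally show ?thesis
    using int1 int2 by (simp add: prim_add) (simp add: prim_def)
qed


text \<open>The continuous representatives of elements of \<open>H\<^sup>1\<close>: \<open>f'\<close> is the weak derivative.\<close>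

definition ac :: "(real \<Rightarrow> 'a::{banach,second_countable_topology}) \<Rightarrow> (real \<Rightarrow> 'a) \<Rightarrow> bool" where
  "ac f f' \<longleftrightarrow> L2 f' \<and> (\<forall>x\<in>{0..1}. f x = f 0 + prim f' x)"

lemma ac_L2: "ac f f' \<Longrightarrow> L2 f'"
  by (simp add: ac_def)

lemma ac_eq_prim: "ac f f' \<Longrightarrow> x \<in> {0..1} \<Longrightarrow> f x = f 0 + prim f' x"
  unfolding ac_def by blast

lemma ac_continuous:
  assumes "ac f f'" shows "continuous_on {0..1} f"
proof -
  have "continuous_on {0..1} (\<lambda>x. f 0 + prim f' x)"
    using assms by (intro continuous_intros continuous_prim L2_integrable ac_L2)
  then show ?thesis
    by (rule continuous_on_eq) (rule ac_eq_prim[OF assms, symmetric])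
qed

lemma ac_Linf: "ac f f' \<Longrightarrow> Linf f"
  by (intro continuous_on_Linf ac_continuous)

lemma ac_L2_self: "ac f f' \<Longrightarrow> L2 f"
  by (intro Linf_imp_L2 ac_Linf)

lemma ac_integral:
  assumes "ac f f'" shows "(\<integral>x. f' x \<partial>I01) = f 1 - f 0"
proof -
  have "f 1 = f 0 + prim f' 1" using assms unfolding ac_def by (elim conjE bspec) auto
  then show ?thesis by (simp add: prim_1)
qed

text \<open>Splitting off the constants \<open>f 0\<close> and \<open>g 0\<close> leaves linear
  terms and a product of two primitives, which is \<open>prim_product\<close>.\<close>

lemma ac_bilinear:
  fixes p :: "'a::{banach,second_countable_topology} \<Rightarrow> 'b::{banach,second_countable_topology}
    \<Rightarrow> 'c::{banach,second_countable_topology}"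
  assumes p: "bounded_bilinear p" and f: "ac f f'" and g: "ac g g'"
  shows "ac (\<lambda>x. p (f x) (g x)) (\<lambda>x. p (f' x) (g x) + p (f x) (g' x))"
  unfolding ac_def
proof (intro conjI ballI)
  show "L2 (\<lambda>x. p (f' x) (g x) + p (f x) (g' x))"
    using f g by (intro L2_add Linf_mult_L2[OF p] Linf_mult_L2[OF bounded_bilinear.flip[OF p]] ac_Linf ac_L2)
  fix x :: real assume x: "x \<in> {0..1}"
  note if' = L2_integrable[OF ac_L2[OF f]] and ig' = L2_integrable[OF ac_L2[OF g]]
  note lin = bounded_bilinear.bounded_linear_left[OF p] bounded_bilinear.bounded_linear_right[OF p]
  note li = linear_simps[OF lin(1)] linear_simps[OF lin(2)]
  have fe: "f t = f 0 + prim f' t" if "t \<in> {0..1}" for t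
    using f that unfolding ac_def by blast
  have ge: "g t = g 0 + prim g' t" if "t \<in> {0..1}" for t
    using g that unfolding ac_def by blast
  have int1: "integrable I01 (\<lambda>s. p (f' s) (prim g' s))"
    by (rule integrable_bilinear_bounded[OF p if' _ norm_prim_le[OF ig']])
       (intro continuous_on_measurable_I01 continuous_prim ig')
  have int2: "integrable I01 (\<lambda>s. p (prim f' s) (g' s))"
    by (rule integrable_bilinear_bounded[OF bounded_bilinear.flip[OF p] ig' _ norm_prim_le[OF if']])
       (intro continuous_on_measurable_I01 continuous_prim if')
  have int3: "integrable I01 (\<lambda>t. p (f' t) (g 0))" "integrable I01 (\<lambda>t. p (f 0) (g' t))"
    by (rule integrable_bounded_linear[OF lin(1) if'], rule integrable_bounded_linear[OF lin(2) ig'])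
  have "prim (\<lambda>t. p (f' t) (g t) + p (f t) (g' t)) x =
     prim (\<lambda>t. (p (f' t) (g 0) + p (f 0) (g' t)) + (p (f' t) (prim g' t) + p (prim f' t) (g' t))) x"
  proof (rule prim_cong)
    fix t :: real assume "0 < t" "t < 1"
    then have "f t = f 0 + prim f' t" "g t = g 0 + prim g' t" by (auto intro: fe ge)
    then show "p (f' t) (g t) + p (f t) (g' t) =
      (p (f' t) (g 0) + p (f 0) (g' t)) + (p (f' t) (prim g' t) + p (prim f' t) (g' t))"
      by (simp only: li) (simp add: algebra_simps)
  qed
  also have "\<dots> = p (prim f' x) (g 0) + p (f 0) (prim g' x) + p (prim f' x) (prim g' x)"
    using int1 int2 int3
    by (simp add: prim_add prim_product[OF p if' ig'] prim_bounded_linear[OF lin(1) if']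
        prim_bounded_linear[OF lin(2) ig'])
  finally show "p (f x) (g x) = p (f 0) (g 0) + prim (\<lambda>t. p (f' t) (g t) + p (f t) (g' t)) x"
    by (subst fe[OF x], subst ge[OF x]) (simp only: li, simp add: algebra_simps)
qed

lemmas ac_scaleR = ac_bilinear[OF bounded_bilinear_scaleR]
  and ac_inner = ac_bilinear[OF bounded_bilinear_inner]

lemma ac_add:
  assumes "ac f f'" "ac g g'" shows "ac (\<lambda>x. f x + g x) (\<lambda>x. f' x + g' x)"
  unfolding ac_def
proof (intro conjI ballI)
  fix x :: real assume "x \<in> {0..1}"
  then have "f x = f 0 + prim f' x" "g x = g 0 + prim g' x"
    using assms unfolding ac_def by blast+
  then show "f x + g x = f 0 + g 0 + prim (\<lambda>x. f' x + g' x) x"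
    using assms by (simp add: prim_add ac_L2 L2_integrable)
qed (use assms in \<open>auto intro: L2_add simp: ac_def\<close>)

lemma ac_const: "ac (\<lambda>x. c) (\<lambda>x. 0)"
  by (simp add: ac_def prim_def)

lemma L2_bounded_linear:
  assumes "bounded_linear T" "L2 f" shows "L2 (\<lambda>x. T (f x))"
proof -
  obtain K where K: "\<And>x. norm (T x) \<le> norm x * K"
    using bounded_linear.bounded[OF assms(1)] by blast
  show ?thesis
  proof (rule L2_bound[OF assms(2), of _ K])
    show "(\<lambda>x. T (f x)) \<in> borel_measurable I01"
      using L2_measurable[OF assms(2)] bounded_linear.continuous_on[OF assms(1) continuous_on_id]
      by (rule borel_measurable_continuous_on[rotated])
  qed (use K in \<open>auto simp: mult.commute\<close>)
qed

lemma ac_bounded_linear: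
  assumes T: "bounded_linear T" and f: "ac f f'" shows "ac (\<lambda>x. T (f x)) (\<lambda>x. T (f' x))"
  unfolding ac_def
proof (intro conjI ballI)
  fix x :: real assume "x \<in> {0..1}"
  then have "f x = f 0 + prim f' x" using f unfolding ac_def by blast
  then show "T (f x) = T (f 0) + prim (\<lambda>x. T (f' x)) x"
    using prim_bounded_linear[OF T L2_integrable[OF ac_L2[OF f]]] by (simp add: linear_simps[OF T])
qed (use assms in \<open>auto intro: L2_bounded_linear simp: ac_def\<close>)

lemma ac_cong:
  assumes f: "ac f f'" and eq: "\<And>x. x \<in> {0..1} \<Longrightarrow> g x = f x"
  shows "ac g f'"
proof -
  have "g x = g 0 + prim f' x" if "x \<in> {0..1}" for x
    using ac_eq_prim[OF f that] eq[OF that] eq[of 0] by simp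
  then show ?thesis using ac_L2[OF f] unfolding ac_def by blast
qed

text \<open>Bridge to the gauge integral, whose fundamental theorem of calculus then makes C1
  functions instances of \<open>ac\<close>.\<close>

lemma prim_eq_integral:
  fixes f :: "real \<Rightarrow> 'a::euclidean_space"
  assumes f: "continuous_on {0..1} f" and x: "x \<in> {0..1}"
  shows "prim f x = integral {0..x} f"
proof -
  have "prim f x = integral {0<..<1} (\<lambda>t. indicator {..<x} t *\<^sub>R f t)"
    unfolding prim_def using continuous_on_Linf[OF f]
    by (intro lebesgue_integral_eq_integral prim_integrable L2_integrable Linf_imp_L2) auto
  also have "(\<lambda>t. indicator {..<x} t *\<^sub>R f t) = (\<lambda>t. if t \<in> {..<x} then f t else 0)"
    by (auto simp: indicator_def)
  also have "integral {0<..<1} \<dots> = integral {0<..<x} f"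
    unfolding Henstock_Kurzweil_Integration.integral_restrict_Int
    using x by (intro arg_cong2[where f=integral]) auto
  finally show ?thesis by (simp add: integral_open_interval_real)
qed

lemma ac_C1:
  fixes f :: "real \<Rightarrow> 'a::euclidean_space"
  assumes f: "\<And>x. x \<in> {0..1} \<Longrightarrow> (f has_vector_derivative f' x) (at x within {0..1})"
    and f': "continuous_on {0..1} f'"
  shows "ac f f'"
  unfolding ac_def
proof (intro conjI ballI)
  show "L2 f'" by (intro Linf_imp_L2 continuous_on_Linf f')
  fix x :: real assume x: "x \<in> {0..1}"
  have "(f' has_integral (f x - f 0)) {0..x}"
    using x by (intro fundamental_theorem_of_calculus has_vector_derivative_within_subset[OF f]) auto
  then show "f x = f 0 + prim f' x"
    by (simp add: prim_eq_integral[OF f' x] integral_unique)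
qed

lemma ac_polynomial:
  fixes f :: "real \<Rightarrow> 'a::euclidean_space"
  assumes "polynomial_function f" shows "\<exists>f'. ac f f'"
proof -
  obtain f' where f': "polynomial_function f'" "\<And>x. (f has_vector_derivative f' x) (at x)"
    using has_vector_derivative_polynomial_function[OF assms] by blast
  have "continuous_on {0..1} f'" using f'(1) by (rule continuous_on_polymonial_function)
  with f'(2) show ?thesis by (blast intro: ac_C1 has_vector_derivative_at_within)
qed

section \<open>Weak derivatives\<close>

text \<open>The candidates for derivatives of test functions. Asking for a compact interval around
  the support makes linear combinations a matter of a minimum and a maximum.\<close>

definition test_cont :: "(real \<Rightarrow> real) \<Rightarrow> bool" where
  "test_cont \<psi> \<longleftrightarrow> continuous_on UNIV \<psi> \<and> (\<exists>\<alpha>>0. \<exists>\<beta><1. \<forall>x. x \<notin> {\<alpha>..\<beta>} \<longrightarrow> \<psi> x = 0)"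

lemma test_cont_diff_scale:
  assumes "test_cont f" "test_cont g" shows "test_cont (\<lambda>x. f x - c * g x)"
proof -
  obtain \<alpha> \<beta> \<alpha>' \<beta>' where *: "0 < \<alpha>" "\<beta> < 1" "0 < \<alpha>'" "\<beta>' < 1"
    "\<forall>x. x \<notin> {\<alpha>..\<beta>} \<longrightarrow> f x = 0" "\<forall>x. x \<notin> {\<alpha>'..\<beta>'} \<longrightarrow> g x = 0"
    using assms by (auto simp: test_cont_def)
  have "\<forall>x. x \<notin> {min \<alpha> \<alpha>'..max \<beta> \<beta>'} \<longrightarrow> f x - c * g x = 0"
  proof (intro allI impI)
    fix x assume "x \<notin> {min \<alpha> \<alpha>'..max \<beta> \<beta>'}"
    then have "x \<notin> {\<alpha>..\<beta>}" "x \<notin> {\<alpha>'..\<beta>'}" by auto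
    then show "f x - c * g x = 0" using *(5,6) by simp
  qed
  moreover have "0 < min \<alpha> \<alpha>'" "max \<beta> \<beta>' < 1" using * by auto
  moreover have "continuous_on UNIV (\<lambda>x. f x - c * g x)"
    using assms by (intro continuous_intros) (auto simp: test_cont_def)
  ultimately show ?thesis unfolding test_cont_def by blast
qed

text \<open>Lebesgue measurability supplies continuous functions that converge almost everywhere.
  Projection onto the ball of radius \<open>B\<close> enforces the bound without moving the limit,
  and a cutoff gives compact support in the open interval.\<close>

lemma bounded_approx:
  fixes f :: "real \<Rightarrow> 'a::euclidean_space"
  assumes f: "f \<in> borel_measurable I01" and B: "\<And>x. norm (f x) \<le> B"
  obtains k where "\<And>n. continuous_on UNIV (k n)" "\<And>n x. norm (k n x) \<le> B"
    "\<And>n::nat. \<exists>\<alpha>>0. \<exists>\<beta><1. \<forall>x. x \<notin> {\<alpha>..\<beta>} \<longrightarrow> k n x = 0"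
    "AE x in I01. (\<lambda>n. k n x) \<longlonglongrightarrow> f x"
proof -
  have "f measurable_on {0<..<1}"
    using f by (subst measurable_on_iff_borel_measurable) auto
  then obtain N g where N: "negligible N" and g: "\<And>n. continuous_on UNIV (g n)"
    "\<And>x. x \<notin> N \<Longrightarrow> (\<lambda>n. g n x) \<longlonglongrightarrow> (if x \<in> {0<..<1} then f x else 0)"
    unfolding measurable_on_def by blast
  have B0: "0 \<le> B" using B[of 0] norm_ge_zero order_trans by blast
  \<comment> \<open>\<open>cut n\<close> is 0 within distance \<open>1/(n+3)\<close> of the ends and
    outside the unit interval, and 1 where the distance to both ends is at least
    \<open>2/(n+3)\<close>.\<close>
  define cut where "cut = (\<lambda>(n::nat) (x::real). max 0 (min 1 ((real n + 3) * min x (1 - x) - 1)))"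
  define k where "k = (\<lambda>n x. cut n x *\<^sub>R closest_point (cball 0 B) (g n x))"
  have cp: "continuous_on UNIV (closest_point (cball 0 B))"
    using B0 by (intro continuous_on_closest_point) auto
  have cpB: "norm (closest_point (cball 0 B) y) \<le> B" for y :: 'a
    using closest_point_in_set[of "cball 0 B" y] B0 by auto
  show thesis
  proof
    show "continuous_on UNIV (k n)" for n
      unfolding k_def cut_def
      by (intro continuous_intros continuous_on_compose2[OF cp g(1)]) auto
    show "norm (k n x) \<le> B" for n x
    proof -
      have "norm (k n x) \<le> 1 * norm (closest_point (cball 0 B) (g n x))"
        unfolding k_def norm_scaleR by (intro mult_right_mono) (auto simp: cut_def)
      also have "\<dots> \<le> B" using cpB by simp
      finally show ?thesis .
    qed
    show "\<exists>\<alpha>>0. \<exists>\<beta><1. \<forall>x. x \<notin> {\<alpha>..\<beta>} \<longrightarrow> k n x = 0" for n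
    proof (intro exI conjI allI impI)
      show "0 < 1 / (real n + 3)" "1 - 1 / (real n + 3) < 1" by auto
      fix x assume "x \<notin> {1 / (real n + 3)..1 - 1 / (real n + 3)}"
      then have "min x (1 - x) \<le> 1 / (real n + 3)" by auto
      then have "(real n + 3) * min x (1 - x) \<le> (real n + 3) * (1 / (real n + 3))"
        by (intro mult_left_mono) auto
      then have "cut n x = 0" by (simp add: cut_def)
      then show "k n x = 0" by (simp add: k_def)
    qed
    have "AE x in lebesgue. x \<notin> N"
      using N by (simp add: negligible_iff_null_sets AE_not_in)
    then have "AE x in I01. x \<notin> N"
      by (auto simp: AE_restrict_space_iff)
    then show "AE x in I01. (\<lambda>n. k n x) \<longlonglongrightarrow> f x"
      using AE_space
    proof eventually_elim
      case (elim x)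
      then have x: "0 < x" "x < 1" by auto
      have "(\<lambda>n. g n x) \<longlonglongrightarrow> f x" using g(2)[of x] elim x by simp
      then have "(\<lambda>n. closest_point (cball 0 B) (g n x)) \<longlonglongrightarrow> closest_point (cball 0 B) (f x)"
        by (rule continuous_on_tendsto_compose[OF cp]) auto
      moreover have "closest_point (cball 0 B) (f x) = f x"
        using B by (intro closest_point_self) auto
      moreover have "(\<lambda>n. cut n x) \<longlonglongrightarrow> 1"
      proof (rule tendsto_eventually)
        have m: "min x (1 - x) > 0" using x by auto
        have "eventually (\<lambda>n. 2 / min x (1 - x) \<le> real n) sequentially"
          using filterlim_real_sequentially by (auto simp: filterlim_at_top)
        then show "eventually (\<lambda>n. cut n x = 1) sequentially"
        proof eventually_elim
          case (elim n)
          then have "2 \<le> real n * min x (1 - x)" using m by (simp add: divide_le_eq)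
          also have "\<dots> \<le> (real n + 3) * min x (1 - x)" using m by (intro mult_right_mono) auto
          finally show ?case by (simp add: cut_def)
        qed
      qed
      ultimately have "(\<lambda>n. k n x) \<longlonglongrightarrow> 1 *\<^sub>R f x"
        unfolding k_def by (intro tendsto_scaleR) auto
      then show ?case by simp
    qed
  qed
qed

text \<open>A compactly supported \<open>h\<close> is divisible by \<open>x (1 - x)\<close> with a
  continuous quotient. Weierstrass applies to the quotient, and multiplying back makes the
  polynomial vanish at both ends.\<close>

lemma bounded_approx_polynomial:
  fixes f :: "real \<Rightarrow> 'a::euclidean_space"
  assumes f: "f \<in> borel_measurable I01" and B: "\<And>x. norm (f x) \<le> B"
  obtains k where "\<And>n. polynomial_function (k n)" "\<And>n x. x \<in> {0..1} \<Longrightarrow> norm (k n x) \<le> B + 1"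
    "\<And>n. k n 0 = 0" "\<And>n. k n 1 = 0" "AE x in I01. (\<lambda>n. k n x) \<longlonglongrightarrow> f x"
proof -
  obtain h where h: "\<And>n. continuous_on UNIV (h n)" "\<And>n x. norm (h n x) \<le> B"
    "\<And>n::nat. \<exists>\<alpha>>0. \<exists>\<beta><1. \<forall>x. x \<notin> {\<alpha>..\<beta>} \<longrightarrow> h n x = 0"
    "AE x in I01. (\<lambda>n. h n x) \<longlonglongrightarrow> f x"
    using bounded_approx[OF f B] by blast
  have "\<exists>k. polynomial_function k \<and> k 0 = 0 \<and> k 1 = 0 \<and> (\<forall>x\<in>{0..1}. norm (h n x - k x) \<le> 1 / Suc n)" for n
  proof -
    obtain \<alpha> \<beta> where ab: "0 < \<alpha>" "\<beta> < 1" "\<And>x. x \<notin> {\<alpha>..\<beta>} \<Longrightarrow> h n x = 0"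
      using h(3)[of n] by blast
    \<comment> \<open>On the support the maxima equal \<open>x\<close> and \<open>1 - x\<close>;
      elsewhere they keep the denominator positive.\<close>
    define w where "w = (\<lambda>x. (1 / (max \<alpha> x * max (1 - \<beta>) (1 - x))) *\<^sub>R h n x)"
    have pos: "max \<alpha> x > 0" "max (1 - \<beta>) (1 - x) > 0" for x using ab by auto
    have "continuous_on {0..1} w"
      unfolding w_def using pos
      by (intro continuous_intros continuous_on_subset[OF h(1)]) (auto simp: less_imp_neq[THEN not_sym])
    then obtain g where g: "polynomial_function g" "\<forall>x\<in>{0..1}. norm (w x - g x) < 1 / Suc n"
      using Stone_Weierstrass_polynomial_function[of "{0..1}" w "1 / Suc n"] by auto
    have "polynomial_function (\<lambda>x. (x * (1 - x)) *\<^sub>R g x)"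
      using g(1) by (intro polynomial_function_mult) (auto simp: polynomial_function_diff simp flip: real_scaleR_def)
    moreover have "norm (h n x - (x * (1 - x)) *\<^sub>R g x) \<le> 1 / Suc n" if x: "x \<in> {0..1}" for x
    proof -
      have "h n x = (x * (1 - x)) *\<^sub>R w x"
      proof (cases "x \<in> {\<alpha>..\<beta>}")
        case True
        then show ?thesis using ab by (simp add: w_def max_absorb2)
      next
        case False
        then show ?thesis using ab by (simp add: w_def)
      qed
      then have "norm (h n x - (x * (1 - x)) *\<^sub>R g x) = \<bar>x * (1 - x)\<bar> * norm (w x - g x)"
        by (simp flip: scaleR_diff_right)
      also have "\<dots> \<le> 1 * (1 / Suc n)"
        using g(2) x by (intro mult_mono) (auto simp: abs_mult mult_le_one less_imp_le)
      finally show ?thesis by simp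
    qed
    ultimately show ?thesis by (intro exI[of _ "\<lambda>x. (x * (1 - x)) *\<^sub>R g x"]) auto
  qed
  then obtain k where k: "\<And>n. polynomial_function (k n)" "\<And>n. k n 0 = 0" "\<And>n. k n 1 = 0"
    "\<And>n x. x \<in> {0..1} \<Longrightarrow> norm (h n x - k n x) \<le> 1 / Suc n"
    by metis
  show thesis
  proof (rule that[of k])
    show "norm (k n x) \<le> B + 1" if "x \<in> {0..1}" for n x
    proof -
      have "1 / real (Suc n) \<le> 1" by simp
      then show ?thesis
        using norm_triangle_sub[of "k n x" "h n x"] k(4)[OF that, of n] h(2)[of n x]
          norm_minus_commute[of "h n x" "k n x"] by linarith
    qed
    show "AE x in I01. (\<lambda>n. k n x) \<longlonglongrightarrow> f x"
      using h(4) AE_space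
    proof eventually_elim
      case (elim x)
      have "(\<lambda>n. h n x - k n x) \<longlonglongrightarrow> 0"
        using k(4)[of x] elim by (intro Lim_null_comparison[OF _ LIMSEQ_Suc[OF lim_1_over_n]]) auto
      then have "(\<lambda>n. h n x - (h n x - k n x)) \<longlonglongrightarrow> f x - 0"
        by (intro tendsto_diff elim(1))
      then show ?case by simp
    qed
  qed (use k in auto)
qed

text \<open>In the limit \<open>k n\<close> turns into \<open>sgn w\<close>, so orthogonality says
  that the integral of \<open>norm w\<close> is zero.\<close>

lemma AE_zero_if_approx:
  fixes w :: "real \<Rightarrow> 'a::euclidean_space"
  assumes w: "integrable I01 w"
    and k: "\<And>n. k n \<in> borel_measurable I01" "\<And>n x. x \<in> {0<..<1} \<Longrightarrow> norm (k n x) \<le> B"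
    and lim: "AE x in I01. (\<lambda>n. k n x) \<longlonglongrightarrow> sgn (w x)"
    and orth: "\<And>n. (\<integral>x. k n x \<bullet> w x \<partial>I01) = 0"
  shows "AE x in I01. w x = 0"
proof -
  note [measurable] = borel_measurable_integrable[OF w] k(1)
  have "(\<lambda>n. \<integral>x. k n x \<bullet> w x \<partial>I01) \<longlonglongrightarrow> (\<integral>x. sgn (w x) \<bullet> w x \<partial>I01)"
  proof (rule integral_dominated_convergence[where w="\<lambda>x. B * norm (w x)"])
    show "integrable I01 (\<lambda>x. B * norm (w x))" using w by simp
    show "AE x in I01. (\<lambda>n. k n x \<bullet> w x) \<longlonglongrightarrow> sgn (w x) \<bullet> w x"
      using lim by eventually_elim (intro tendsto_intros)
    show "AE x in I01. norm (k n x \<bullet> w x) \<le> B * norm (w x)" for n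
    proof (rule AE_I2)
      fix x assume "x \<in> space I01"
      then have "norm (k n x) * norm (w x) \<le> B * norm (w x)"
        using k(2)[of x n] by (intro mult_right_mono) auto
      then show "norm (k n x \<bullet> w x) \<le> B * norm (w x)"
        using Cauchy_Schwarz_ineq2[of "k n x" "w x"] by simp
    qed
    show "(\<lambda>x. sgn (w x) \<bullet> w x) \<in> borel_measurable I01"
      unfolding sgn_div_norm by measurable
  qed measurable
  then have "(\<integral>x. sgn (w x) \<bullet> w x \<partial>I01) = 0"
    unfolding orth by (rule LIMSEQ_unique) (rule tendsto_const)
  moreover have "sgn y \<bullet> y = norm y" for y :: 'a
    by (cases "y = 0") (auto simp: sgn_div_norm dot_square_norm power2_eq_square)
  ultimately have "(\<integral>x. norm (w x) \<partial>I01) = 0" by simp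
  then show ?thesis
    using w by (subst (asm) integral_nonneg_eq_0_iff_AE) auto
qed

text \<open>By the product rule the pairing of \<open>w\<close> with every polynomial vanishes, in
  particular with polynomials that approximate \<open>sgn w\<close>.\<close>

lemma ac_zero_imp_deriv_zero:
  fixes w :: "real \<Rightarrow> 'a::euclidean_space"
  assumes "ac (\<lambda>x. c) w" shows "AE x in I01. w x = 0"
proof -
  have w: "ac (\<lambda>x. 0) w"
    using ac_add[OF assms ac_const[of "-c"]] by simp
  have wm: "(\<lambda>x. sgn (w x)) \<in> borel_measurable I01"
    unfolding sgn_div_norm using L2_measurable[OF ac_L2[OF w]] by measurable
  obtain k where k: "\<And>n. polynomial_function (k n)" "\<And>n x. x \<in> {0..1} \<Longrightarrow> norm (k n x) \<le> 1 + 1"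
    "\<And>n. k n 0 = 0" "\<And>n. k n 1 = 0" "AE x in I01. (\<lambda>n. k n x) \<longlonglongrightarrow> sgn (w x)"
    by (rule bounded_approx_polynomial[OF wm, of 1]) (auto simp: norm_sgn)
  show ?thesis
  proof (rule AE_zero_if_approx[OF _ _ _ k(5)])
    show "k n \<in> borel_measurable I01" for n
      using k(1) continuous_on_polymonial_function by (blast intro: continuous_on_measurable_I01)
    show "norm (k n x) \<le> 2" if "x \<in> {0<..<1}" for n x using k(2)[of x n] that by auto
    show "(\<integral>x. k n x \<bullet> w x \<partial>I01) = 0" for n
    proof -
      obtain k' where "ac (k n) k'" using ac_polynomial[OF k(1)] by blast
      from ac_integral[OF ac_inner[OF this w]] show ?thesis by simp
    qed
  qed (use w in \<open>simp add: ac_L2 L2_integrable\<close>)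
qed

lemma ac_deriv_unique:
  fixes f :: "real \<Rightarrow> 'a::euclidean_space"
  assumes f: "ac f f'" and g: "ac g g'" and eq: "\<And>x. x \<in> {0..1} \<Longrightarrow> f x = g x + c"
  shows "AE x in I01. f' x = g' x"
proof -
  have "ac (\<lambda>x. f x + - 1 *\<^sub>R g x) (\<lambda>x. f' x + - 1 *\<^sub>R g' x)"
    by (intro ac_add f ac_bounded_linear[OF bounded_linear_scaleR_right g])
  then have "ac (\<lambda>x. c) (\<lambda>x. f' x + - 1 *\<^sub>R g' x)"
    by (rule ac_cong) (simp add: eq)
  from ac_zero_imp_deriv_zero[OF this] show ?thesis by eventually_elim simp
qed


text \<open>Mean zero is what makes the primitive that starts from 0 vanish again to the right of
  the support.\<close>

lemma test_cont_antideriv: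
  assumes \<psi>: "test_cont \<psi>" and zero: "(\<integral>x. \<psi> x \<partial>I01) = 0"
  obtains \<phi> where "test_fun \<phi>" "deriv \<phi> = \<psi>"
proof -
  obtain \<alpha> \<beta> where ab: "0 < \<alpha>" "\<beta> < 1" "\<And>x. x \<notin> {\<alpha>..\<beta>} \<Longrightarrow> \<psi> x = 0" and c: "continuous_on UNIV \<psi>"
    using \<psi> by (auto simp: test_cont_def)
  have "\<exists>F. \<forall>x::real. -\<infinity> < ereal x \<longrightarrow> ereal x < \<infinity> \<longrightarrow> (F has_vector_derivative \<psi> x) (at x)"
    using c by (intro einterval_antiderivative) (auto simp: continuous_on_eq_continuous_at)
  then obtain F where F: "\<And>x. (F has_real_derivative \<psi> x) (at x)"
    by (auto simp: has_real_derivative_iff_has_vector_derivative)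
  define \<phi> where "\<phi> = (\<lambda>x. F x - F 0)"
  have \<phi>: "(\<phi> has_real_derivative \<psi> x) (at x)" for x
    unfolding \<phi>_def using F[of x] by (auto intro!: derivative_eq_intros)
  have "ac \<phi> \<psi>"
    using \<phi> by (intro ac_C1 continuous_on_subset[OF c])
      (auto simp: has_real_derivative_iff_has_vector_derivative intro: has_vector_derivative_at_within)
  from ac_integral[OF this] have \<phi>1: "\<phi> 1 = 0" by (simp add: zero \<phi>_def)
  have const: "\<phi> t = \<phi> s" if "s \<le> t" "\<And>z. s < z \<Longrightarrow> z < t \<Longrightarrow> \<psi> z = 0" for s t
  proof (cases "s < t")
    case True
    then obtain z where "s < z" "z < t" "\<phi> t - \<phi> s = (t - s) * \<psi> z"
      using MVT2[of s t \<phi> \<psi>] \<phi> by blast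
    then show ?thesis using that(2)[of z] by simp
  qed (use that in auto)
  have out: "\<phi> x = 0" if x: "x \<notin> {\<alpha>..\<beta>}" for x
  proof -
    have "\<phi> 0 = 0" by (simp add: \<phi>_def)
    consider "x < \<alpha>" | "\<beta> < x" using x by (meson atLeastAtMost_iff not_le)
    then show ?thesis
    proof cases
      case 1
      then show ?thesis
        using const[of x 0] const[of 0 x] ab(1,3) \<open>\<phi> 0 = 0\<close> by (cases "x \<le> 0") auto
    next
      case 2
      then show ?thesis
        using const[of x 1] const[of 1 x] ab(2,3) \<phi>1 by (cases "x \<le> 1") auto
    qed
  qed
  show thesis
  proof
    show "test_fun \<phi>"
      unfolding test_fun_def C1_differentiable_on_def
    proof (intro conjI exI)
      show "\<forall>x\<in>UNIV. (\<phi> has_vector_derivative \<psi> x) (at x)"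
        using \<phi> by (simp add: has_real_derivative_iff_has_vector_derivative)
      show "compact {\<alpha>..\<beta>}" "{\<alpha>..\<beta>} \<subseteq> {0<..<1}" "\<forall>x. x \<notin> {\<alpha>..\<beta>} \<longrightarrow> \<phi> x = 0"
        using ab out by auto
    qed (rule c)
    show "deriv \<phi> = \<psi>" using \<phi> by (intro ext DERIV_imp_deriv)
  qed
qed

lemma test_cont_Linf: "test_cont \<psi> \<Longrightarrow> Linf \<psi>"
  by (intro continuous_on_Linf) (auto simp: test_cont_def intro: continuous_on_subset)

lemma Linf_integrable_scaleR:
  fixes h :: "real \<Rightarrow> 'a::{banach,second_countable_topology}"
  assumes "Linf k" "integrable I01 h" shows "integrable I01 (\<lambda>x. k x *\<^sub>R h x)"
proof -
  obtain C where C: "AE x in I01. norm (k x) \<le> C" using assms by (auto simp: Linf_def)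
  show ?thesis
  proof (rule Bochner_Integration.integrable_bound)
    show "integrable I01 (\<lambda>x. C * norm (h x))" using assms by simp
    show "(\<lambda>x. k x *\<^sub>R h x) \<in> borel_measurable I01"
      using assms by (auto simp: Linf_def)
    show "AE x in I01. norm (k x *\<^sub>R h x) \<le> norm (C * norm (h x))"
      using C
    proof eventually_elim
      case (elim x)
      then have "\<bar>k x\<bar> * norm (h x) \<le> \<bar>C\<bar> * norm (h x)" by (intro mult_right_mono) auto
      then show ?case by (simp add: abs_mult)
    qed
  qed
qed

text \<open>The du Bois-Reymond lemma. Subtracting a multiple of a fixed \<open>\<psi>1\<close> with
  nonzero mean turns every \<open>\<psi>\<close> into the derivative of a test function. Hence
  \<open>h\<close> pairs with \<open>\<psi>\<close> like the constant \<open>c\<close>, the mean of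
  \<open>h\<close> weighted by \<open>\<psi>1\<close>.\<close>

lemma weak_deriv_zero_imp_const:
  fixes h :: "real \<Rightarrow> 'a::euclidean_space"
  assumes h: "integrable I01 h" and orth: "\<And>\<phi>. test_fun \<phi> \<Longrightarrow> (\<integral>x. deriv \<phi> x *\<^sub>R h x \<partial>I01) = 0"
  shows "\<exists>c. AE x in I01. h x = c"
proof -
  \<comment> \<open>Such a function occurs among the continuous approximants of the constant 1,
    whose integrals tend to 1.\<close>
  obtain \<psi>1 where \<psi>1: "test_cont \<psi>1" "(\<integral>x. \<psi>1 x \<partial>I01) \<noteq> 0"
  proof -
    obtain k :: "nat \<Rightarrow> real \<Rightarrow> real" where k: "\<And>n. continuous_on UNIV (k n)" "\<And>n x. norm (k n x) \<le> 1"
      "\<And>n::nat. \<exists>\<alpha>>0. \<exists>\<beta><1. \<forall>x. x \<notin> {\<alpha>..\<beta>} \<longrightarrow> k n x = 0"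
      "AE x in I01. (\<lambda>n. k n x) \<longlonglongrightarrow> 1"
      using bounded_approx[of "\<lambda>x. 1::real" 1] by (metis borel_measurable_const norm_one order_refl)
    have tc: "test_cont (k n)" for n
      using k(1,3)[of n] by (auto simp: test_cont_def)
    have "(\<lambda>n. \<integral>x. k n x \<partial>I01) \<longlonglongrightarrow> (\<integral>x. 1 \<partial>I01)"
    proof (rule integral_dominated_convergence[where w="\<lambda>x. 1"])
      show "k n \<in> borel_measurable I01" for n
        using test_cont_Linf[OF tc] by (auto simp: Linf_def)
    qed (use k in auto)
    then have "(\<lambda>n. \<integral>x. k n x \<partial>I01) \<longlonglongrightarrow> 1"
      by (simp add: measure_restrict_space)
    then have "eventually (\<lambda>n. (\<integral>x. k n x \<partial>I01) > 0) sequentially"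
      by (rule order_tendstoD) simp
    then obtain n where "(\<integral>x. k n x \<partial>I01) > 0" by (auto simp: eventually_sequentially)
    with tc[of n] show thesis by (intro that[of "k n"]) auto
  qed
  define J where "J = (\<integral>x. \<psi>1 x \<partial>I01)"
  define c where "c = (\<integral>x. \<psi>1 x *\<^sub>R h x \<partial>I01) /\<^sub>R J"
  have main: "(\<integral>x. \<psi> x *\<^sub>R (h x - c) \<partial>I01) = 0" if \<psi>: "test_cont \<psi>" for \<psi>
  proof -
    define I where "I = (\<integral>x. \<psi> x \<partial>I01)"
    have int: "integrable I01 \<psi>" "integrable I01 \<psi>1"
      using \<psi> \<psi>1 by (auto intro!: L2_integrable Linf_imp_L2 test_cont_Linf)
    have tc: "test_cont (\<lambda>x. \<psi> x - (I / J) * \<psi>1 x)"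
      by (rule test_cont_diff_scale[OF \<psi> \<psi>1(1)])
    have "(\<integral>x. \<psi> x - (I / J) * \<psi>1 x \<partial>I01) = 0"
      using int \<psi>1(2) by (simp add: I_def J_def)
    from test_cont_antideriv[OF tc this] obtain \<phi> where
      "test_fun \<phi>" "deriv \<phi> = (\<lambda>x. \<psi> x - (I / J) * \<psi>1 x)" by blast
    with orth[of \<phi>] have "(\<integral>x. (\<psi> x - (I / J) * \<psi>1 x) *\<^sub>R h x \<partial>I01) = 0" by simp
    moreover have "(\<psi> x - (I / J) * \<psi>1 x) *\<^sub>R h x = \<psi> x *\<^sub>R h x - (I / J) *\<^sub>R (\<psi>1 x *\<^sub>R h x)" for x
      by (simp add: scaleR_diff_left)
    moreover have ih: "integrable I01 (\<lambda>x. \<psi> x *\<^sub>R h x)" "integrable I01 (\<lambda>x. \<psi>1 x *\<^sub>R h x)"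
      using \<psi> \<psi>1 h by (auto intro!: Linf_integrable_scaleR test_cont_Linf)
    ultimately have "(\<integral>x. \<psi> x *\<^sub>R h x \<partial>I01) = (I / J) *\<^sub>R (\<integral>x. \<psi>1 x *\<^sub>R h x \<partial>I01)"
      by (simp del: scaleR_scaleR)
    also have "\<dots> = I *\<^sub>R c" by (simp add: c_def divide_inverse)
    finally show ?thesis
      using ih int by (simp add: scaleR_diff_right I_def)
  qed
  have wm: "(\<lambda>x. sgn (h x - c)) \<in> borel_measurable I01"
    unfolding sgn_div_norm using borel_measurable_integrable[OF h] by measurable
  obtain k where k: "\<And>n. continuous_on UNIV (k n)" "\<And>n x. norm (k n x) \<le> 1"
      "\<And>n::nat. \<exists>\<alpha>>0. \<exists>\<beta><1. \<forall>x. x \<notin> {\<alpha>..\<beta>} \<longrightarrow> k n x = 0"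
      "AE x in I01. (\<lambda>n. k n x) \<longlonglongrightarrow> sgn (h x - c)"
    by (rule bounded_approx[OF wm, of 1]) (auto simp: norm_sgn)
  have "AE x in I01. h x - c = 0"
  proof (rule AE_zero_if_approx[OF _ _ k(2) k(4)])
    show hc: "integrable I01 (\<lambda>x. h x - c)" using h by simp
    show "k n \<in> borel_measurable I01" for n
      by (intro continuous_on_measurable_I01 continuous_on_subset[OF k(1)]) auto
    show "(\<integral>x. k n x \<bullet> (h x - c) \<partial>I01) = 0" for n
    proof -
      \<comment> \<open>Test functions are real valued, hence the vector valued approximants enter
        one coordinate at a time.\<close>
      have tc: "test_cont (\<lambda>x. k n x \<bullet> i)" for i
      proof -
        have "continuous_on UNIV (\<lambda>x. k n x \<bullet> i)" by (intro continuous_intros k(1))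
        then show ?thesis using k(3)[of n] unfolding test_cont_def by (metis inner_zero_left)
      qed
      have int: "integrable I01 (\<lambda>x. (k n x \<bullet> i) *\<^sub>R (h x - c))" for i
        using hc by (intro Linf_integrable_scaleR test_cont_Linf tc)
      have "k n x \<bullet> (h x - c) = (\<Sum>i\<in>Basis. ((k n x \<bullet> i) *\<^sub>R (h x - c)) \<bullet> i)" for x
        unfolding euclidean_inner[of "k n x" "h x - c"] by (intro sum.cong) (simp_all only: inner_scaleR_left)
      then have "(\<integral>x. k n x \<bullet> (h x - c) \<partial>I01) = (\<Sum>i\<in>Basis. (\<integral>x. ((k n x \<bullet> i) *\<^sub>R (h x - c)) \<bullet> i \<partial>I01))"
        using int by (simp only: Bochner_Integration.integral_sum integrable_inner_left)
      also have "\<dots> = (\<Sum>i\<in>Basis. (\<integral>x. (k n x \<bullet> i) *\<^sub>R (h x - c) \<partial>I01) \<bullet> i)"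
        using int by (intro sum.cong integral_inner_left) auto
      finally show ?thesis by (simp add: main[OF tc])
    qed
  qed
  then show ?thesis by auto
qed

section \<open>Weak derivatives and absolute continuity\<close>

lemma test_fun_ac:
  assumes "test_fun \<phi>" shows "ac \<phi> (deriv \<phi>)" "\<phi> 0 = 0" "\<phi> 1 = 0"
proof -
  obtain D where D: "\<And>x. (\<phi> has_vector_derivative D x) (at x)" "continuous_on UNIV D"
    using assms by (auto simp: test_fun_def C1_differentiable_on_def)
  then have "deriv \<phi> = D"
    by (intro ext DERIV_imp_deriv) (auto simp: has_real_derivative_iff_has_vector_derivative)
  then show "ac \<phi> (deriv \<phi>)"
    using D by (auto intro!: ac_C1 intro: continuous_on_subset has_vector_derivative_at_within)
  obtain K where "K \<subseteq> {0<..<1}" "\<forall>x. x \<notin> K \<longrightarrow> \<phi> x = 0"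
    using assms by (auto simp: test_fun_def)
  then show "\<phi> 0 = 0" "\<phi> 1 = 0" by force+
qed

lemma ac_weak_deriv:
  fixes F :: "real \<Rightarrow> 'a::{banach,second_countable_topology}"
  assumes F: "ac F g" and eq: "AE x in I01. f x = F x" and f: "f \<in> borel_measurable I01"
  shows "weak_deriv f g"
  unfolding weak_deriv_def
proof (intro allI impI)
  fix \<phi> assume \<phi>: "test_fun \<phi>"
  note a = test_fun_ac[OF \<phi>]
  have int: "integrable I01 (\<lambda>x. deriv \<phi> x *\<^sub>R F x)" "integrable I01 (\<lambda>x. \<phi> x *\<^sub>R g x)"
    using ac_L2[OF a(1)] ac_L2_self[OF F] ac_L2_self[OF a(1)] ac_L2[OF F]
    by (auto intro!: L2_bilinear_integrable[OF bounded_bilinear_scaleR])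
  have "(\<integral>x. deriv \<phi> x *\<^sub>R f x \<partial>I01) = (\<integral>x. deriv \<phi> x *\<^sub>R F x \<partial>I01)"
    using f eq L2_measurable[OF ac_L2[OF a(1)]] L2_measurable[OF ac_L2_self[OF F]]
    by (intro integral_cong_AE) auto
  moreover have "(\<integral>x. deriv \<phi> x *\<^sub>R F x \<partial>I01) + (\<integral>x. \<phi> x *\<^sub>R g x \<partial>I01) = 0"
    using ac_integral[OF ac_scaleR[OF a(1) F]] int by (simp add: a)
  ultimately show "(\<integral>x. deriv \<phi> x *\<^sub>R f x \<partial>I01) = - (\<integral>x. \<phi> x *\<^sub>R g x \<partial>I01)"
    by (simp add: eq_neg_iff_add_eq_0)
qed

lemma ac_prim: "L2 g \<Longrightarrow> ac (\<lambda>x. c + prim g x) g"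
  by (simp add: ac_def)

text \<open>\<open>f - prim g\<close> has weak derivative zero, so it is constant almost
  everywhere.\<close>

lemma weak_deriv_imp_ac:
  fixes f :: "real \<Rightarrow> 'a::euclidean_space"
  assumes f: "L2 f" and g: "L2 g" and fg: "weak_deriv f g"
  obtains F where "ac F g" "AE x in I01. F x = f x"
proof -
  have F: "ac (prim g) g" using ac_prim[OF g, of 0] by simp
  have "\<exists>c. AE x in I01. f x - prim g x = c"
  proof (rule weak_deriv_zero_imp_const)
    show "integrable I01 (\<lambda>x. f x - prim g x)"
      using f ac_L2_self[OF F] by (intro L2_integrable L2_diff)
    fix \<phi> assume \<phi>: "test_fun \<phi>"
    note a = test_fun_ac[OF \<phi>]
    have "integrable I01 (\<lambda>x. deriv \<phi> x *\<^sub>R prim g x)" "integrable I01 (\<lambda>x. deriv \<phi> x *\<^sub>R f x)"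
      using ac_L2[OF a(1)] ac_L2_self[OF F] f by (auto intro!: L2_bilinear_integrable[OF bounded_bilinear_scaleR])
    moreover have "weak_deriv (prim g) g"
      by (rule ac_weak_deriv[OF F]) (use F in \<open>auto intro: L2_measurable ac_L2_self\<close>)
    ultimately show "(\<integral>x. deriv \<phi> x *\<^sub>R (f x - prim g x) \<partial>I01) = 0"
      using fg \<phi> by (simp add: scaleR_diff_right weak_deriv_def)
  qed
  then obtain c where "AE x in I01. f x - prim g x = c" by blast
  then have "AE x in I01. c + prim g x = f x" by eventually_elim (auto simp: algebra_simps)
  with ac_prim[OF g, of c] show thesis by (rule that)
qed

section \<open>Sobolev functions\<close>

lemma AE_eq_continuous:
  fixes f g :: "real \<Rightarrow> 'a::euclidean_space"
  assumes f: "continuous_on {0..1} f" and g: "continuous_on {0..1} g"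
    and eq: "AE x in I01. f x = g x" and x: "x \<in> {0..1}"
  shows "f x = g x"
proof -
  have c: "continuous_on {0..1} (\<lambda>x. norm (f x - g x))"
    by (intro continuous_intros f g)
  have "integral {0..1} (\<lambda>x. norm (f x - g x)) = (\<integral>x. norm (f x - g x) \<partial>I01)"
    using prim_eq_integral[OF c, of 1] by (simp add: prim_1)
  also have "\<dots> = (\<integral>x. 0 \<partial>I01)"
    using eq continuous_on_measurable_I01[OF c] by (intro integral_cong_AE) auto
  finally have "integral {0..1} (\<lambda>x. norm (f x - g x)) = 0" by simp
  then have "\<forall>x\<in>{0..1}. norm (f x - g x) = 0"
    by (subst (asm) integral_eq_0_iff[OF c]) auto
  with x show ?thesis by simp
qed

text \<open>The choice behind \<open>cont_rep\<close> is harmless: continuous functions that agree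
  almost everywhere agree on the closed interval.\<close>

lemma cont_rep_eq:
  fixes f :: "real \<Rightarrow> 'a::euclidean_space"
  assumes F: "continuous_on {0..1} F" and eq: "AE x in I01. F x = f x" and x: "x \<in> {0..1}"
  shows "cont_rep f x = F x"
proof -
  have *: "continuous_on {0..1} (cont_rep f) \<and> (AE x in I01. cont_rep f x = f x)"
    unfolding cont_rep_def by (rule someI[of _ F]) (use F eq in auto)
  then have "AE x in I01. cont_rep f x = F x" using eq by (auto elim: AE_mp)
  with * F x show ?thesis by (blast intro: AE_eq_continuous)
qed

lemma H1_wderiv:
  assumes "H1 f" shows "L2 (wderiv f)" "weak_deriv f (wderiv f)"
proof -
  have "L2 (wderiv f) \<and> weak_deriv f (wderiv f)"
    using assms unfolding H1_def wderiv_def by (elim conjE) (rule someI_ex[of "\<lambda>g. L2 g \<and> weak_deriv f g"])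
  then show "L2 (wderiv f)" "weak_deriv f (wderiv f)" by auto
qed

lemma H1_L2: "H1 f \<Longrightarrow> L2 f"
  by (simp add: H1_def)

text \<open>Together with its converse \<open>ac_H1\<close> this trades the choices behind
  \<open>cont_rep\<close> and \<open>wderiv\<close> for the relation \<open>ac\<close>, on which the
  calculus rules are stated.\<close>

lemma H1_ac:
  fixes f :: "real \<Rightarrow> 'a::euclidean_space"
  assumes f: "H1 f"
  shows "ac (cont_rep f) (wderiv f)" "AE x in I01. cont_rep f x = f x"
proof -
  obtain F where F: "ac F (wderiv f)" "AE x in I01. F x = f x"
    using weak_deriv_imp_ac[OF H1_L2 H1_wderiv, OF f f f] by blast
  have eq: "cont_rep f x = F x" if "x \<in> {0..1}" for x
    by (rule cont_rep_eq[OF ac_continuous[OF F(1)] F(2) that])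
  show "ac (cont_rep f) (wderiv f)" by (rule ac_cong[OF F(1) eq])
  show "AE x in I01. cont_rep f x = f x"
    using F(2) AE_space by eventually_elim (simp add: eq)
qed

lemma ac_H1:
  fixes f :: "real \<Rightarrow> 'a::euclidean_space"
  assumes F: "ac F g" and eq: "AE x in I01. F x = f x" and f: "f \<in> borel_measurable I01"
  shows "H1 f" "AE x in I01. wderiv f x = g x" "x \<in> {0..1} \<Longrightarrow> cont_rep f x = F x"
proof -
  have eq': "AE x in I01. f x = F x" using eq by auto
  have "L2 f" by (rule L2_AE_cong[OF ac_L2_self[OF F] f eq'])
  then show H1: "H1 f"
    using ac_weak_deriv[OF F eq' f] ac_L2[OF F] by (auto simp: H1_def)
  show cr: "cont_rep f x = F x" if "x \<in> {0..1}" for x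
    by (rule cont_rep_eq[OF ac_continuous[OF F] eq that])
  show "AE x in I01. wderiv f x = g x"
    by (rule ac_deriv_unique[OF H1_ac(1)[OF H1] F, of 0]) (simp add: cr)
qed

lemma H1_bounded_linear:
  fixes f :: "real \<Rightarrow> 'a::euclidean_space" and T :: "'a \<Rightarrow> 'b::euclidean_space"
  assumes T: "bounded_linear T" and f: "H1 f"
  shows "H1 (\<lambda>x. T (f x))" "AE x in I01. wderiv (\<lambda>x. T (f x)) x = T (wderiv f x)"
    "x \<in> {0..1} \<Longrightarrow> cont_rep (\<lambda>x. T (f x)) x = T (cont_rep f x)"
proof -
  note a = H1_ac[OF f]
  have eq: "AE x in I01. T (cont_rep f x) = T (f x)" using a(2) by eventually_elim simp
  have m: "(\<lambda>x. T (f x)) \<in> borel_measurable I01"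
    by (intro L2_measurable L2_bounded_linear[OF T] H1_L2 f)
  note * = ac_H1[OF ac_bounded_linear[OF T a(1)] eq m]
  show "H1 (\<lambda>x. T (f x))" "AE x in I01. wderiv (\<lambda>x. T (f x)) x = T (wderiv f x)"
    "x \<in> {0..1} \<Longrightarrow> cont_rep (\<lambda>x. T (f x)) x = T (cont_rep f x)"
    by (fact *)+
qed

lemma H1_add:
  fixes f g :: "real \<Rightarrow> 'a::euclidean_space"
  assumes f: "H1 f" and g: "H1 g"
  shows "H1 (\<lambda>x. f x + g x)" "AE x in I01. wderiv (\<lambda>x. f x + g x) x = wderiv f x + wderiv g x"
    "x \<in> {0..1} \<Longrightarrow> cont_rep (\<lambda>x. f x + g x) x = cont_rep f x + cont_rep g x"
proof -
  note a = H1_ac[OF f] and b = H1_ac[OF g]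
  have eq: "AE x in I01. cont_rep f x + cont_rep g x = f x + g x"
    using a(2) b(2) by eventually_elim simp
  have m: "(\<lambda>x. f x + g x) \<in> borel_measurable I01"
    by (intro L2_measurable L2_add H1_L2 f g)
  note * = ac_H1[OF ac_add[OF a(1) b(1)] eq m]
  show "H1 (\<lambda>x. f x + g x)" "AE x in I01. wderiv (\<lambda>x. f x + g x) x = wderiv f x + wderiv g x"
    "x \<in> {0..1} \<Longrightarrow> cont_rep (\<lambda>x. f x + g x) x = cont_rep f x + cont_rep g x"
    by (fact *)+
qed

text \<open>Point values are not continuous in the L2 norm, so both end values can be prescribed.
  This lets the approximation meet the trace conditions of \<open>dom_A\<close>.\<close>

lemma L2_dense_ac:
  fixes f :: "real \<Rightarrow> 'a::euclidean_space"
  assumes f: "L2 f" and e: "0 < e"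
  obtains h h' where "ac h h'" "h 0 = c0" "h 1 = c1" "(\<integral>x. (norm (f x - h x))\<^sup>2 \<partial>I01) < e"
proof -
  note [measurable] = L2_measurable[OF f]
  \<comment> \<open>Truncation, since polynomial approximation was set up for bounded
    functions.\<close>
  define tr where "tr = (\<lambda>(n::nat) x. if norm (f x) \<le> real n then f x else 0)"
  have tr_meas [measurable]: "tr n \<in> borel_measurable I01" for n
    unfolding tr_def by measurable
  have "(\<lambda>n. \<integral>x. (norm (f x - tr n x))\<^sup>2 \<partial>I01) \<longlonglongrightarrow> (\<integral>x. 0 \<partial>I01)"
  proof (rule integral_dominated_convergence[where w="\<lambda>x. (norm (f x))\<^sup>2"])
    show "AE x in I01. (\<lambda>n. (norm (f x - tr n x))\<^sup>2) \<longlonglongrightarrow> 0"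
    proof (rule AE_I2, rule tendsto_eventually)
      fix x
      obtain N where "norm (f x) \<le> real N" using real_arch_simple by blast
      then show "eventually (\<lambda>n. (norm (f x - tr n x))\<^sup>2 = 0) sequentially"
        by (intro eventually_sequentiallyI[of N]) (auto simp: tr_def)
    qed
    show "AE x in I01. norm ((norm (f x - tr n x))\<^sup>2) \<le> (norm (f x))\<^sup>2" for n
      by (auto simp: tr_def)
  qed (use f in \<open>auto simp: L2_def\<close>)
  then have "eventually (\<lambda>n. (\<integral>x. (norm (f x - tr n x))\<^sup>2 \<partial>I01) < e / 4) sequentially"
    using e by (intro order_tendstoD) auto
  then obtain N where N: "(\<integral>x. (norm (f x - tr N x))\<^sup>2 \<partial>I01) < e / 4"
    by (auto simp: eventually_sequentially)
  have trB: "norm (tr N x) \<le> real N" for x by (auto simp: tr_def)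
  obtain k where k: "\<And>n. polynomial_function (k n)" "\<And>n x. x \<in> {0..1} \<Longrightarrow> norm (k n x) \<le> real N + 1"
    "\<And>n. k n 0 = 0" "\<And>n. k n 1 = 0" "AE x in I01. (\<lambda>n. k n x) \<longlonglongrightarrow> tr N x"
    by (rule bounded_approx_polynomial[OF tr_meas trB]) blast
  \<comment> \<open>The two powers carry the end values and tend to 0 at every interior
    point.\<close>
  define h where "h = (\<lambda>n x. k n x + (1 - x) ^ Suc n *\<^sub>R c0 + x ^ Suc n *\<^sub>R c1)"
  define B where "B = real N + 1 + norm c0 + norm c1"
  have poly: "polynomial_function (h n)" for n
  proof -
    have "real_polynomial_function (\<lambda>x::real. (1 - x) ^ Suc n)" "real_polynomial_function (\<lambda>x::real. x ^ Suc n)"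
      by (intro real_polynomial_function_power real_polynomial_function_diff;
          simp add: real_polynomial_function_eq)+
    then have "polynomial_function (\<lambda>x::real. (1 - x) ^ Suc n)" "polynomial_function (\<lambda>x::real. x ^ Suc n)"
      unfolding real_polynomial_function_eq by auto
    then show ?thesis
      unfolding h_def by (intro polynomial_function_add polynomial_function_mult k polynomial_function_const)
  qed
  have hB: "norm (h n x) \<le> B" if x: "x \<in> {0..1}" for n x
  proof -
    have "norm ((1 - x) ^ Suc n *\<^sub>R c0) \<le> 1 * norm c0" "norm (x ^ Suc n *\<^sub>R c1) \<le> 1 * norm c1"
      using x unfolding norm_scaleR by (intro mult_right_mono; simp add: power_abs[symmetric] power_le_one del: power_Suc)+
    then show ?thesis
      unfolding h_def B_def
      using k(2)[OF x, of n] norm_triangle_ineq[of "k n x + (1 - x) ^ Suc n *\<^sub>R c0" "x ^ Suc n *\<^sub>R c1"]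
        norm_triangle_ineq[of "k n x" "(1 - x) ^ Suc n *\<^sub>R c0"] by linarith
  qed
  have hm [measurable]: "h n \<in> borel_measurable I01" for n
    using poly continuous_on_polymonial_function by (blast intro: continuous_on_measurable_I01)
  have "(\<lambda>n. \<integral>x. (norm (tr N x - h n x))\<^sup>2 \<partial>I01) \<longlonglongrightarrow> (\<integral>x. 0 \<partial>I01)"
  proof (rule integral_dominated_convergence[where w="\<lambda>x. (real N + B)\<^sup>2"])
    show "AE x in I01. (\<lambda>n. (norm (tr N x - h n x))\<^sup>2) \<longlonglongrightarrow> 0"
      using k(5) AE_space
    proof eventually_elim
      case (elim x)
      then have x: "0 < x" "x < 1" by auto
      have "(\<lambda>n. h n x) \<longlonglongrightarrow> tr N x + 0 *\<^sub>R c0 + 0 *\<^sub>R c1"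
        unfolding h_def using x
        by (intro tendsto_intros elim(1) LIMSEQ_Suc[OF LIMSEQ_realpow_zero]) auto
      then have "(\<lambda>n. (norm (tr N x - h n x))\<^sup>2) \<longlonglongrightarrow> (norm (tr N x - tr N x))\<^sup>2"
        by (intro tendsto_intros) simp
      then show ?case by simp
    qed
    show "AE x in I01. norm ((norm (tr N x - h n x))\<^sup>2) \<le> (real N + B)\<^sup>2" for n
    proof (rule AE_I2)
      fix x assume "x \<in> space I01"
      then have "norm (tr N x - h n x) \<le> real N + B"
        using trB[of x] hB[of x n] norm_triangle_ineq4[of "tr N x" "h n x"] by auto
      then show "norm ((norm (tr N x - h n x))\<^sup>2) \<le> (real N + B)\<^sup>2"
        by (simp add: power_mono)
    qed
  qed auto
  then have "eventually (\<lambda>n. (\<integral>x. (norm (tr N x - h n x))\<^sup>2 \<partial>I01) < e / 4) sequentially"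
    using e by (intro order_tendstoD) auto
  then obtain n where n: "(\<integral>x. (norm (tr N x - h n x))\<^sup>2 \<partial>I01) < e / 4"
    by (auto simp: eventually_sequentially)
  obtain h' where h': "ac (h n) h'" using ac_polynomial[OF poly] by blast
  have L: "L2 (tr N)" by (rule L2_bound[OF f, of _ 1]) (auto simp: tr_def)
  have i: "integrable I01 (\<lambda>x. (norm (f x - tr N x))\<^sup>2)" "integrable I01 (\<lambda>x. (norm (tr N x - h n x))\<^sup>2)"
    "integrable I01 (\<lambda>x. (norm (f x - h n x))\<^sup>2)"
    using L2_diff[OF f L] L2_diff[OF L ac_L2_self[OF h']] L2_diff[OF f ac_L2_self[OF h']] by (auto simp: L2_def)
  have "(\<integral>x. (norm (f x - h n x))\<^sup>2 \<partial>I01)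
    \<le> (\<integral>x. 2 * (norm (f x - tr N x))\<^sup>2 + 2 * (norm (tr N x - h n x))\<^sup>2 \<partial>I01)"
  proof (rule integral_mono)
    fix x
    have "(norm (f x - h n x))\<^sup>2 \<le> (norm (f x - tr N x) + norm (tr N x - h n x))\<^sup>2"
      by (intro power_mono norm_diff_triangle_ineq[THEN order_trans] norm_ge_zero)
         (metis diff_add_cancel add_diff_eq norm_triangle_ineq)
    then show "(norm (f x - h n x))\<^sup>2 \<le> 2 * (norm (f x - tr N x))\<^sup>2 + 2 * (norm (tr N x - h n x))\<^sup>2"
      using sum_squares_bound[of "norm (f x - tr N x)" "norm (tr N x - h n x)"]
      by (simp add: power2_sum)
  qed (use i in auto)
  also have "\<dots> < e" using i N n by simp
  finally show thesis
    using h' k by (intro that[of "h n" h']) (auto simp: h_def)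
qed

text \<open>The Riesz-Fischer argument for geometrically fast sequences. The rate \<open>1/9\<close>
  for squares corresponds to the rate \<open>1/3\<close> in the completeness assumption of
  \<open>semi_inner_semigroup\<close>.\<close>

lemma L2_complete:
  fixes f :: "nat \<Rightarrow> real \<Rightarrow> 'a::euclidean_space"
  assumes f: "\<And>n. L2 (f n)" and le: "\<And>n. (\<integral>x. (norm (f (Suc n) x - f n x))\<^sup>2 \<partial>I01) \<le> K * (1/9) ^ n"
  obtains g where "L2 g" "(\<lambda>n. \<integral>x. (norm (g x - f n x))\<^sup>2 \<partial>I01) \<longlonglongrightarrow> 0"
proof -
  note [measurable] = L2_measurable[OF f]
  \<comment> \<open>With the weight \<open>2 ^ k\<close> the series of integrals still converges,
    and its pointwise sum \<open>W\<close> bounds the increments by \<open>sqrt W\<close> times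
    \<open>2 ^ k\<close> to the power \<open>-1/2\<close>. So \<open>sqrt W\<close> becomes a square
    integrable majorant.\<close>
  define w where "w = (\<lambda>k x. 2 ^ k * (norm (f (Suc k) x - f k x))\<^sup>2)"
  have K: "0 \<le> K" using le[of 0] by (intro order_trans[OF _ le[of 0, simplified]]) simp
  have wint: "integrable I01 (w k)" for k
    using L2_diff[OF f f, of "Suc k" k] by (simp add: w_def L2_def)
  have w0: "0 \<le> w k x" for k x by (simp add: w_def)
  have wle: "(\<integral>x. w k x \<partial>I01) \<le> K * (2/9) ^ k" for k
    using mult_left_mono[OF le[of k], of "2 ^ k"] by (simp add: w_def field_simps)
  have geo: "summable (\<lambda>k. K * (2/9::real) ^ k)" by (intro summable_mult summable_geometric) simp
  have sumint: "summable (\<lambda>k. \<integral>x. w k x \<partial>I01)"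
    by (rule summable_comparison_test'[OF geo, of 0]) (use wle w0 in auto)
  have "(\<integral>\<^sup>+x. (\<Sum>k. ennreal (w k x)) \<partial>I01) = (\<Sum>k. \<integral>\<^sup>+x. ennreal (w k x) \<partial>I01)"
    by (rule nn_integral_suminf) (use wint in auto)
  also have "\<dots> = (\<Sum>k. ennreal (\<integral>x. w k x \<partial>I01))"
    using wint w0 by (simp add: nn_integral_eq_integral)
  also have "\<dots> = ennreal (\<Sum>k. \<integral>x. w k x \<partial>I01)"
    using sumint w0 by (intro suminf_ennreal2) auto
  finally have "(\<integral>\<^sup>+x. (\<Sum>k. ennreal (w k x)) \<partial>I01) \<noteq> \<infinity>" by simp
  then have "AE x in I01. (\<Sum>k. ennreal (w k x)) \<noteq> \<infinity>"
    by (intro nn_integral_noteq_infinite) (use wint in auto)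
  then have sw: "AE x in I01. summable (\<lambda>k. w k x)"
    by eventually_elim (intro summable_suminf_not_top w0, simp)
  define W where "W = (\<lambda>x. \<Sum>k. w k x)"
  have Wint: "integrable I01 W"
    unfolding W_def
    by (rule integrable_suminf[OF wint]) (use sw sumint w0 in auto)
  define r where "r = 1 / sqrt (2::real)"
  have r: "0 < r" "r < 1" "r\<^sup>2 = 1/2" by (auto simp: r_def power_divide)
  define g where "g = (\<lambda>x. lim (\<lambda>n. f n x))"
  have gm [measurable]: "g \<in> borel_measurable I01"
    unfolding g_def by (intro borel_measurable_lim_metric) measurable
  have bound: "AE x in I01. 0 \<le> W x \<and> (\<forall>n. norm (g x - f n x) \<le> (1 / (1 - r)) * r ^ n * sqrt (W x))"
    using sw
  proof eventually_elim
    case (elim x)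
    have W0: "0 \<le> W x" unfolding W_def by (intro suminf_nonneg elim w0)
    have d: "norm (f (Suc k) x - f k x) \<le> sqrt (W x) * r ^ k" for k
    proof (rule power2_le_imp_le)
      have "w k x \<le> W x" unfolding W_def using sum_le_suminf[OF elim, of "{k}"] w0 by simp
      then have "(norm (f (Suc k) x - f k x))\<^sup>2 \<le> W x * (1/2) ^ k"
        by (simp add: w_def field_simps)
      also have "\<dots> = (sqrt (W x) * r ^ k)\<^sup>2"
        using W0 by (simp add: power_mult_distrib r(3)[symmetric] power_mult[symmetric] mult.commute)
      finally show "(norm (f (Suc k) x - f k x))\<^sup>2 \<le> (sqrt (W x) * r ^ k)\<^sup>2" .
      show "0 \<le> sqrt (W x) * r ^ k" using W0 r by simp
    qed
    have geo: "(\<lambda>k. sqrt (W x) * r ^ (k + n)) sums (sqrt (W x) * (r ^ n * (1 / (1 - r))))" for n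
      unfolding power_add mult.commute[of "r ^ _" "r ^ n"]
      using r by (intro sums_mult geometric_sums) auto
    have sd: "summable (\<lambda>k. f (Suc (k + n)) x - f (k + n) x)" for n
      by (rule summable_comparison_test'[OF sums_summable[OF geo[of n]], of 0]) (use d in auto)
    have tel: "(\<lambda>k. f (Suc (k + n)) x - f (k + n) x) sums (g x - f n x)" for n
    proof -
      have "convergent (\<lambda>n. f n x)"
      proof -
        have "(\<Sum>k<m. f (Suc k) x - f k x) = f m x - f 0 x" for m by (rule sum_lessThan_telescope)
        then have "(\<lambda>m. f m x - f 0 x) \<longlonglongrightarrow> (\<Sum>k. f (Suc k) x - f k x)"
          using summable_LIMSEQ[OF sd[of 0]] by simp
        from tendsto_add[OF this tendsto_const[of "f 0 x"]] show ?thesis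
          by (auto simp: convergent_def)
      qed
      then have "(\<lambda>n. f n x) \<longlonglongrightarrow> g x" by (simp add: g_def convergent_LIMSEQ_iff)
      then have "(\<lambda>m. f (m + n) x - f n x) \<longlonglongrightarrow> g x - f n x"
        by (intro tendsto_intros LIMSEQ_ignore_initial_segment)
      moreover have "(\<Sum>k<m. f (Suc (k + n)) x - f (k + n) x) = f (m + n) x - f n x" for m
        using sum_lessThan_telescope[of "\<lambda>k. f (k + n) x" m] by simp
      ultimately show ?thesis by (simp add: sums_def)
    qed
    have "norm (g x - f n x) \<le> (1 / (1 - r)) * r ^ n * sqrt (W x)" for n
    proof -
      have "norm (g x - f n x) \<le> sqrt (W x) * (r ^ n * (1 / (1 - r)))"
        by (rule norm_sums_le[OF tel geo]) (use d in auto)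
      then show ?thesis by (simp add: ac_simps)
    qed
    with W0 show ?case by blast
  qed
  define C where "C = (1 / (1 - r))\<^sup>2 * (\<integral>x. W x \<partial>I01)"
  have Wm [measurable]: "W \<in> borel_measurable I01" using Wint by auto
  have sL: "L2 (\<lambda>x. sqrt (W x))"
    unfolding L2_def
  proof
    show "integrable I01 (\<lambda>x. (norm (sqrt (W x)))\<^sup>2)"
      by (rule integrable_cong_AE_imp[OF Wint]) (measurable, use bound in \<open>auto elim!: AE_mp\<close>)
  qed measurable
  have gf: "L2 (\<lambda>x. g x - f n x)" for n
  proof (rule L2_bound[OF sL])
    show "AE x in I01. norm (g x - f n x) \<le> ((1 / (1 - r)) * r ^ n) * norm (sqrt (W x))"
      using bound by eventually_elim (auto simp: real_sqrt_abs)
  qed measurable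
  have "L2 g" using L2_add[OF gf[of 0] f[of 0]] by simp
  moreover have "(\<lambda>n. \<integral>x. (norm (g x - f n x))\<^sup>2 \<partial>I01) \<longlonglongrightarrow> 0"
  proof (rule tendsto_sandwich[OF _ _ tendsto_const])
    show "(\<lambda>n. C * (1/2) ^ n) \<longlonglongrightarrow> 0"
      by (intro tendsto_mult_right_zero LIMSEQ_realpow_zero) auto
    show "eventually (\<lambda>n. (\<integral>x. (norm (g x - f n x))\<^sup>2 \<partial>I01) \<le> C * (1/2) ^ n) sequentially"
    proof (rule always_eventually, rule allI)
      fix n
      have "(\<integral>x. (norm (g x - f n x))\<^sup>2 \<partial>I01) \<le> (\<integral>x. ((1 / (1 - r))\<^sup>2 * (1/2) ^ n) * W x \<partial>I01)"
      proof (rule integral_mono_AE)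
        show "AE x in I01. (norm (g x - f n x))\<^sup>2 \<le> ((1 / (1 - r))\<^sup>2 * (1/2) ^ n) * W x"
          using bound
        proof eventually_elim
          case (elim x)
          then have "(norm (g x - f n x))\<^sup>2 \<le> ((1 / (1 - r)) * r ^ n * sqrt (W x))\<^sup>2"
            by (intro power_mono) auto
          also have "\<dots> = (1 / (1 - r))\<^sup>2 * (r\<^sup>2) ^ n * W x"
            using elim by (simp add: power_mult_distrib power_divide power_mult[symmetric] mult.commute)
          finally show ?case by (simp only: r(3))
        qed
      qed (use gf Wint in \<open>auto simp: L2_def\<close>)
      then show "(\<integral>x. (norm (g x - f n x))\<^sup>2 \<partial>I01) \<le> C * (1/2) ^ n"
        by (simp add: C_def ac_simps)
    qed
  qed auto
  ultimately show thesis by (rule that)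
qed

section \<open>Semigroups that are dissipative for a quadratic form\<close>

text \<open>The form may be degenerate, because states that agree almost everywhere are distinct
  functions. Scalars are complex only to match \<open>c0_semigroup\<close>; the form is real valued
  and homogeneous for real factors.\<close>

locale semi_inner =
  fixes scl :: "complex \<Rightarrow> 'x::ab_group_add \<Rightarrow> 'x" and H :: "'x set" and b :: "'x \<Rightarrow> 'x \<Rightarrow> real"
  assumes zero_mem [simp]: "0 \<in> H"
    and add_mem [simp]: "X \<in> H \<Longrightarrow> Y \<in> H \<Longrightarrow> X + Y \<in> H"
    and diff_mem [simp]: "X \<in> H \<Longrightarrow> Y \<in> H \<Longrightarrow> X - Y \<in> H"
    and scl_mem [simp]: "X \<in> H \<Longrightarrow> scl c X \<in> H"
    and sym: "X \<in> H \<Longrightarrow> Y \<in> H \<Longrightarrow> b X Y = b Y X"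
    and add_left [simp]: "X \<in> H \<Longrightarrow> Y \<in> H \<Longrightarrow> Z \<in> H \<Longrightarrow> b (X + Y) Z = b X Z + b Y Z"
    and scl_left [simp]: "X \<in> H \<Longrightarrow> Z \<in> H \<Longrightarrow> b (scl (complex_of_real r) X) Z = r * b X Z"
    and nonneg: "X \<in> H \<Longrightarrow> 0 \<le> b X X"
begin

lemma add_right [simp]: "X \<in> H \<Longrightarrow> Y \<in> H \<Longrightarrow> Z \<in> H \<Longrightarrow> b Z (X + Y) = b Z X + b Z Y"
  using sym[of Z] by simp

lemma scl_right [simp]: "X \<in> H \<Longrightarrow> Z \<in> H \<Longrightarrow> b Z (scl (complex_of_real r) X) = r * b Z X"
  using sym[of Z] by simp

lemma diff_left [simp]:
  assumes "X \<in> H" "Y \<in> H" "Z \<in> H" shows "b (X - Y) Z = b X Z - b Y Z"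
  using add_left[of "X - Y" Y Z] assms by simp

lemma diff_right [simp]: "X \<in> H \<Longrightarrow> Y \<in> H \<Longrightarrow> Z \<in> H \<Longrightarrow> b Z (X - Y) = b Z X - b Z Y"
  using sym[of Z] by simp

lemma zero_left [simp]: "Z \<in> H \<Longrightarrow> b 0 Z = 0"
  using diff_left[of 0 0 Z] by simp

lemma scl_minus_one [simp]: "X \<in> H \<Longrightarrow> Z \<in> H \<Longrightarrow> b (scl (- 1) X) Z = - b X Z"
  using scl_left[of X Z "-1"] by simp

definition n :: "'x \<Rightarrow> real" where "n X = sqrt (b X X)"

lemma n_nonneg [simp]: "X \<in> H \<Longrightarrow> 0 \<le> n X"
  by (simp add: n_def nonneg)

lemma n_power2: "X \<in> H \<Longrightarrow> (n X)\<^sup>2 = b X X"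
  by (simp add: n_def nonneg)

lemma n_zero [simp]: "n 0 = 0"
  by (simp add: n_def)

lemma Cauchy_Schwarz:
  assumes X: "X \<in> H" and Y: "Y \<in> H" shows "\<bar>b X Y\<bar> \<le> n X * n Y"
proof -
  have q: "0 \<le> b X X - 2 * r * b X Y + r\<^sup>2 * b Y Y" for r
    using nonneg[of "X - scl (complex_of_real r) Y"] X Y sym[OF X Y]
    by (simp add: power2_eq_square algebra_simps)
  have "(b X Y)\<^sup>2 \<le> b X X * b Y Y"
  proof (cases "b Y Y = 0")
    case True
    have "b X Y = 0"
    proof (rule ccontr)
      assume "b X Y \<noteq> 0"
      \<comment> \<open>For this value of \<open>r\<close> the quadratic expression would equal
        -1.\<close>
      then show False using q[of "(b X X + 1) / (2 * b X Y)"] True by simp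
    qed
    then show ?thesis using True by simp
  next
    case False
    then have "b Y Y > 0" using nonneg[OF Y] by simp
    then show ?thesis using q[of "b X Y / b Y Y"]
      by (simp add: field_simps power2_eq_square)
  qed
  then have "sqrt ((b X Y)\<^sup>2) \<le> sqrt (b X X * b Y Y)" by (rule real_sqrt_le_mono)
  then show ?thesis by (simp add: n_def real_sqrt_mult)
qed

lemma n_triangle:
  assumes X: "X \<in> H" and Y: "Y \<in> H" shows "n (X + Y) \<le> n X + n Y"
proof (rule power2_le_imp_le)
  have "b X Y \<le> n X * n Y" using Cauchy_Schwarz[OF X Y] by simp
  then show "(n (X + Y))\<^sup>2 \<le> (n X + n Y)\<^sup>2"
    using X Y sym[OF X Y] by (simp add: n_power2 power2_sum)
qed (use X Y in simp)

lemma n_scl: "X \<in> H \<Longrightarrow> n (scl (complex_of_real r) X) = \<bar>r\<bar> * n X"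
  by (simp add: n_def real_sqrt_mult mult.assoc[symmetric])

text \<open>Replaces rewriting inside \<open>n\<close>: vectors that differ by a null vector are not
  equal, but \<open>b\<close> does not distinguish them.\<close>

lemma n_eqI:
  assumes "X \<in> H" "Y \<in> H" "\<And>Z. Z \<in> H \<Longrightarrow> b X Z = b Y Z" shows "n X = n Y"
  using assms(3)[of X] assms(3)[of Y] sym[OF assms(1,2)] assms(1,2) by (simp add: n_def)

lemma n_commute:
  assumes "X \<in> H" "Y \<in> H" shows "n (X - Y) = n (Y - X)"
proof -
  have "n (X - Y) = n (scl (complex_of_real (-1)) (Y - X))"
    by (rule n_eqI) (use assms in simp_all)
  then show ?thesis using assms by (subst (asm) n_scl) auto
qed

lemma n_diff_le:
  assumes "X \<in> H" "Y \<in> H" shows "n (X - Y) \<le> n X + n Y"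
proof -
  have "n (X - Y) = n (X + scl (complex_of_real (-1)) Y)"
    by (rule n_eqI) (use assms in simp_all)
  also have "\<dots> \<le> n X + n Y"
    using n_triangle[of X "scl (complex_of_real (-1)) Y"] n_scl[of Y "-1"] assms by simp
  finally show ?thesis .
qed

lemma n_diff_triangle:
  assumes "X \<in> H" "Y \<in> H" "Z \<in> H" shows "n (X - Z) \<le> n (X - Y) + n (Y - Z)"
  using n_triangle[of "X - Y" "Y - Z"] assms by simp

lemma n_le_diff:
  assumes "X \<in> H" "Y \<in> H" shows "n X \<le> n Y + n (X - Y)"
  using n_triangle[of "Y" "X - Y"] assms by simp

lemma b_eq_of_n_zero:
  assumes "X \<in> H" "Y \<in> H" "n (X - Y) = 0" "Z \<in> H" shows "b X Z = b Y Z"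
  using Cauchy_Schwarz[of "X - Y" Z] assms by simp

end

text \<open>Completeness is asked for in the form in which the gliding hump uses it, for increments
  of size at most \<open>(1/3) ^ k\<close>.\<close>

locale semi_inner_semigroup = semi_inner scl H b
  for scl :: "complex \<Rightarrow> 'x::ab_group_add \<Rightarrow> 'x" and H b +
  fixes S :: "real \<Rightarrow> 'x \<Rightarrow> 'x"
  assumes semigroup: "c0_semigroup scl H n S"
    and complete: "(\<And>k. x k \<in> H) \<Longrightarrow> (\<And>k. n (x (Suc k) - x k) \<le> (1/3) ^ k)
      \<Longrightarrow> \<exists>Y\<in>H. (\<lambda>k::nat. n (x k - Y)) \<longlonglongrightarrow> 0"
begin

lemma S_mem [simp]: "0 \<le> t \<Longrightarrow> X \<in> H \<Longrightarrow> S t X \<in> H"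
  using semigroup by (simp add: c0_semigroup_def)

text \<open>\<open>S t\<close> is linear only modulo null vectors. Placed in the first argument of
  \<open>b\<close>, additivity becomes a genuine equation; the lemmas that follow do the same for
  the other laws.\<close>

lemma S_add [simp]:
  assumes "0 \<le> t" "X \<in> H" "Y \<in> H" "Z \<in> H"
  shows "b (S t (X + Y)) Z = b (S t X) Z + b (S t Y) Z"
  using b_eq_of_n_zero[of "S t (X + Y)" "S t X + S t Y" Z] semigroup assms by (simp add: c0_semigroup_def)

lemma S_diff [simp]:
  assumes "0 \<le> t" "X \<in> H" "Y \<in> H" "Z \<in> H"
  shows "b (S t (X - Y)) Z = b (S t X) Z - b (S t Y) Z"
  using S_add[of t "X - Y" Y Z] assms by simp

lemma S_scl [simp]:
  assumes "0 \<le> t" "X \<in> H" "Z \<in> H"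
  shows "b (S t (scl (complex_of_real r) X)) Z = r * b (S t X) Z"
  using b_eq_of_n_zero[of "S t (scl (complex_of_real r) X)" "scl (complex_of_real r) (S t X)" Z] semigroup assms
  by (simp add: c0_semigroup_def)

lemma S_zero [simp]:
  assumes "X \<in> H" "Z \<in> H" shows "b (S 0 X) Z = b X Z"
  using b_eq_of_n_zero[of "S 0 X" X Z] semigroup assms by (simp add: c0_semigroup_def)

lemma S_semigroup:
  assumes "0 \<le> s" "0 \<le> t" "X \<in> H" "Z \<in> H" shows "b (S (s + t) X) Z = b (S s (S t X)) Z"
  using b_eq_of_n_zero[of "S (s + t) X" "S s (S t X)" Z] semigroup assms by (simp add: c0_semigroup_def)

lemma S_continuous_0: "X \<in> H \<Longrightarrow> ((\<lambda>t. n (S t X - X)) \<longlongrightarrow> 0) (at_right 0)"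
  using semigroup by (simp add: c0_semigroup_def)

lemma S_bounded: "0 \<le> t \<Longrightarrow> \<exists>C. \<forall>X\<in>H. n (S t X) \<le> C * n X"
  using semigroup by (simp add: c0_semigroup_def)

definition opnorm :: "real \<Rightarrow> real" where
  "opnorm t = (SUP Z\<in>{Z\<in>H. n Z \<le> 1}. n (S t Z))"

lemma opnorm_bdd:
  assumes "0 \<le> t" shows "bdd_above ((\<lambda>Z. n (S t Z)) ` {Z\<in>H. n Z \<le> 1})"
proof -
  obtain C where C: "\<forall>X\<in>H. n (S t X) \<le> C * n X"
    using S_bounded[OF assms] by blast
  show ?thesis
  proof (rule bdd_aboveI2)
    fix Z assume Z: "Z \<in> {Z\<in>H. n Z \<le> 1}"
    have "n (S t Z) \<le> C * n Z" using C Z by simp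
    also have "\<dots> \<le> \<bar>C\<bar> * n Z" using Z by (intro mult_right_mono) auto
    also have "\<dots> \<le> \<bar>C\<bar> * 1" using Z by (intro mult_left_mono) auto
    finally show "n (S t Z) \<le> \<bar>C\<bar>" by simp
  qed
qed

lemma opnorm_nonneg: assumes "0 \<le> t" shows "0 \<le> opnorm t"
  unfolding opnorm_def
proof (rule cSUP_upper2[OF opnorm_bdd[OF assms]])
  show "0 \<in> {Z\<in>H. n Z \<le> 1}" by simp
qed (use assms in simp)

text \<open>Null vectors cannot be normalised; for them boundedness of \<open>S t\<close> already
  says that the image is null.\<close>

lemma opnorm_bound:
  assumes t: "0 \<le> t" and X: "X \<in> H" shows "n (S t X) \<le> opnorm t * n X"
proof (cases "n X = 0")
  case True
  then show ?thesis using S_bounded[OF t] X by fastforce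
next
  case False
  then have pos: "0 < n X" using X by (simp add: less_le)
  have mem: "scl (complex_of_real (1 / n X)) X \<in> H" using X by simp
  have "n (S t (scl (complex_of_real (1 / n X)) X)) = n (scl (complex_of_real (1 / n X)) (S t X))"
    by (rule n_eqI) (use t X in \<open>simp_all only: S_mem scl_mem S_scl scl_left\<close>)
  also have "\<dots> = n (S t X) / n X"
    by (subst n_scl) (use t X pos in auto)
  finally have e: "n (S t (scl (complex_of_real (1 / n X)) X)) = n (S t X) / n X" .
  have "n (scl (complex_of_real (1 / n X)) X) = 1"
    by (subst n_scl) (use X pos in auto)
  with mem have "n (S t X) / n X \<le> opnorm t"
    unfolding opnorm_def e[symmetric] by (intro cSUP_upper opnorm_bdd t) auto
  then show ?thesis using pos by (simp add: field_simps)
qed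

text \<open>The uniform boundedness principle, by the gliding hump argument of Sokal.\<close>

lemma locally_bounded:
  obtains d C where "0 < d" "\<And>t. 0 \<le> t \<Longrightarrow> t \<le> d \<Longrightarrow> opnorm t \<le> C"
proof (rule ccontr)
  assume "\<not> thesis"
  \<comment> \<open>Failure of the claim yields times tending to 0 with norms above
    \<open>4 ^ k\<close>. A vector \<open>Y\<close> will be built whose images at these times are
    unbounded, against strong continuity at 0.\<close>
  then have "\<exists>t\<ge>0. t \<le> 1 / real (Suc k) \<and> opnorm t > 4 ^ k" for k :: nat
    using that[of "1 / real (Suc k)" "4 ^ k"] by (force simp: not_le)
  then obtain t where t: "\<And>k::nat. 0 \<le> t k" "\<And>k. t k \<le> 1 / real (Suc k)" "\<And>k. opnorm (t k) > 4 ^ k"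
    by metis
  \<comment> \<open>Strong continuity is a limit from the right, so the time 0 has to be
    excluded.\<close>
  have tpos: "t k \<noteq> 0" for k
  proof
    assume "t k = 0"
    have "opnorm 0 \<le> 1"
      unfolding opnorm_def
    proof (rule cSUP_least)
      have "0 \<in> {Z\<in>H. n Z \<le> 1}" by simp
      then show "{Z\<in>H. n Z \<le> 1} \<noteq> {}" by blast
      show "n (S 0 Z) \<le> 1" if "Z \<in> {Z\<in>H. n Z \<le> 1}" for Z
        using n_eqI[of "S 0 Z" Z] that by simp
    qed
    moreover have "(1::real) \<le> 4 ^ k" by simp
    ultimately show False using t(3)[of k] unfolding \<open>t k = 0\<close> by linarith
  qed
  have "\<exists>Z\<in>H. n Z \<le> 1 \<and> (2/3) * opnorm (t k) < n (S (t k) Z)" for k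
  proof -
    have "(2/3) * opnorm (t k) < opnorm (t k)" using t(3)[of k] zero_less_power[of "4::real" k] by linarith
    moreover have "{Z\<in>H. n Z \<le> 1} \<noteq> {}"
    proof -
      have "0 \<in> {Z\<in>H. n Z \<le> 1}" by simp
      then show ?thesis by blast
    qed
    ultimately show ?thesis
      using less_cSUP_iff[OF _ opnorm_bdd[OF t(1)[of k]], of "(2/3) * opnorm (t k)"] unfolding opnorm_def by auto
  qed
  then obtain Z where Z: "\<And>k. Z k \<in> H" "\<And>k. n (Z k) \<le> 1" "\<And>k. (2/3) * opnorm (t k) < n (S (t k) (Z k))"
    by metis
  define \<xi> where "\<xi> = (\<lambda>k. scl (complex_of_real ((1/3) ^ k)) (Z k))"
  have \<xi>: "\<xi> k \<in> H" "n (\<xi> k) \<le> (1/3) ^ k" for k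
  proof -
    show "\<xi> k \<in> H" using Z by (simp add: \<xi>_def del: of_real_power)
    have "n (\<xi> k) = (1/3) ^ k * n (Z k)" unfolding \<xi>_def by (subst n_scl) (use Z in auto)
    then show "n (\<xi> k) \<le> (1/3) ^ k" using mult_left_mono[OF Z(2)[of k], of "(1/3) ^ k"] by simp
  qed
  have S\<xi>: "(2/3) * opnorm (t k) * (1/3) ^ k \<le> n (S (t k) (\<xi> k))" for k
  proof -
    have "n (S (t k) (\<xi> k)) = n (scl (complex_of_real ((1/3) ^ k)) (S (t k) (Z k)))"
      unfolding \<xi>_def by (rule n_eqI) (use t(1) Z(1) in \<open>simp_all del: of_real_power\<close>)
    also have "\<dots> = (1/3) ^ k * n (S (t k) (Z k))"
      by (subst n_scl) (use t(1) Z(1) in auto)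
    finally show ?thesis using mult_right_mono[OF less_imp_le[OF Z(3)[of k]], of "(1/3) ^ k"] by (simp add: mult.commute)
  qed
  \<comment> \<open>The sign is chosen so that the new hump is not cancelled:
    \<open>2 S \<xi>\<close> is the difference of \<open>S (x + \<xi>)\<close> and
    \<open>S (x - \<xi>)\<close>, so one of the two has at least the norm of
    \<open>S \<xi>\<close>.\<close>
  define x where "x = rec_nat 0 (\<lambda>k y. if n (S (t k) (\<xi> k)) \<le> n (S (t k) (y + \<xi> k)) then y + \<xi> k else y - \<xi> k)"
  have x0: "x 0 = 0" and xS: "x (Suc k) = (if n (S (t k) (\<xi> k)) \<le> n (S (t k) (x k + \<xi> k)) then x k + \<xi> k else x k - \<xi> k)" for k
    by (simp_all add: x_def)
  have xH: "x k \<in> H" for k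
    by (induction k) (use \<xi>(1) in \<open>auto simp: x0 xS\<close>)
  have big: "n (S (t k) (\<xi> k)) \<le> n (S (t k) (x (Suc k)))" for k
  proof (cases "n (S (t k) (\<xi> k)) \<le> n (S (t k) (x k + \<xi> k))")
    case False
    note m = xH[of k] \<xi>(1)[of k] t(1)[of k]
    have "2 * n (S (t k) (\<xi> k)) = n (scl (complex_of_real 2) (S (t k) (\<xi> k)))"
      by (subst n_scl) (use m in auto)
    also have "\<dots> = n (S (t k) (x k + \<xi> k) - S (t k) (x k - \<xi> k))"
      by (rule n_eqI) (use m in \<open>simp_all del: of_real_numeral\<close>)
    also have "\<dots> \<le> n (S (t k) (x k + \<xi> k)) + n (S (t k) (x k - \<xi> k))"
      by (rule n_diff_le) (use m in auto)
    finally show ?thesis using False by (simp add: xS)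
  qed (simp add: xS)
  have step: "n (x (Suc k) - x k) \<le> (1/3) ^ k" for k
  proof -
    have "n (x (Suc k) - x k) = n (\<xi> k)"
    proof (cases "n (S (t k) (\<xi> k)) \<le> n (S (t k) (x k + \<xi> k))")
      case False
      then have "n (x (Suc k) - x k) = n (x k - x (Suc k))" using xH n_commute by blast
      with False show ?thesis by (simp add: xS)
    qed (simp add: xS)
    then show ?thesis using \<xi>(2) by simp
  qed
  obtain Y where Y: "Y \<in> H" "(\<lambda>k. n (x k - Y)) \<longlonglongrightarrow> 0"
    using complete[OF xH step] by blast
  have tail: "n (x (Suc k) - x (Suc k + m)) \<le> (1/2) * (1/3) ^ k" for k m
  proof -
    \<comment> \<open>The exact value of the finite geometric sum, which is what carries the
      induction.\<close>
    have "n (x (Suc k) - x (Suc k + m)) \<le> (1/2) * (1/3) ^ k * (1 - (1/3) ^ m)"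
    proof (induction m)
      case 0
      have "n (x (Suc k) - x (Suc k)) = 0" using n_def xH by simp
      then show ?case by simp
    next
      case (Suc m)
      have "n (x (Suc k) - x (Suc k + Suc m)) \<le> n (x (Suc k) - x (Suc k + m)) + n (x (Suc k + m) - x (Suc k + Suc m))"
        by (rule n_diff_triangle) (rule xH)+
      also have "n (x (Suc k + m) - x (Suc k + Suc m)) \<le> (1/3) ^ (Suc k + m)"
        using step[of "Suc k + m"] n_commute[OF xH xH] by simp
      finally show ?case using Suc by (simp add: power_add field_simps)
    qed
    also have "\<dots> \<le> (1/2) * (1/3) ^ k * 1" by (intro mult_left_mono) auto
    finally show ?thesis by simp
  qed
  have near: "n (x (Suc k) - Y) \<le> (1/2) * (1/3) ^ k" for k
  proof (rule tendsto_lowerbound[where F=sequentially and f="\<lambda>m. (1/2) * (1/3) ^ k + n (x (m + Suc k) - Y)"])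
    show "(\<lambda>m. (1/2) * (1/3) ^ k + n (x (m + Suc k) - Y)) \<longlonglongrightarrow> (1/2) * (1/3) ^ k"
      using tendsto_add[OF tendsto_const LIMSEQ_ignore_initial_segment[OF Y(2), of "Suc k"], of "(1/2) * (1/3) ^ k"]
      by simp
    show "eventually (\<lambda>m. n (x (Suc k) - Y) \<le> (1/2) * (1/3) ^ k + n (x (m + Suc k) - Y)) sequentially"
    proof (rule always_eventually, rule allI)
      fix m
      show "n (x (Suc k) - Y) \<le> (1/2) * (1/3) ^ k + n (x (m + Suc k) - Y)"
        using n_diff_triangle[OF xH[of "Suc k"] xH[of "Suc k + m"] Y(1)] tail[of k m]
        by (simp add: add.commute)
    qed
  qed simp
  \<comment> \<open>In units of \<open>opnorm (t k) / 3 ^ k\<close> the hump contributes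
    \<open>2/3\<close> and the remaining steps take away at most \<open>1/2\<close>, so
    \<open>1/6\<close> is left. The ratio \<open>4/3\<close> sets the growth of the norms against
    the decay of the steps.\<close>
  have lower: "(1/6) * (4/3) ^ k \<le> n (S (t k) Y)" for k
  proof -
    have m: "S (t k) (x (Suc k)) \<in> H" "S (t k) Y \<in> H" using t(1) xH Y by auto
    have "n (S (t k) (x (Suc k)) - S (t k) Y) = n (S (t k) (x (Suc k) - Y))"
      by (rule n_eqI) (use t(1) xH Y in auto)
    also have "\<dots> \<le> opnorm (t k) * n (x (Suc k) - Y)"
      by (rule opnorm_bound) (use t(1) xH Y in auto)
    also have "\<dots> \<le> opnorm (t k) * ((1/2) * (1/3) ^ k)"
      by (intro mult_left_mono near opnorm_nonneg t)
    finally have "n (S (t k) (x (Suc k))) \<le> n (S (t k) Y) + opnorm (t k) * ((1/2) * (1/3) ^ k)"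
      using n_le_diff[OF m] by simp
    with S\<xi>[of k] big[of k] have "(1/6) * (opnorm (t k) * (1/3) ^ k) \<le> n (S (t k) Y)"
      by (simp add: algebra_simps)
    moreover have "(4/3::real) ^ k \<le> opnorm (t k) * (1/3) ^ k"
      using mult_right_mono[OF less_imp_le[OF t(3)[of k]], of "(1/3) ^ k"]
      by (simp add: power_divide)
    ultimately show ?thesis by simp
  qed
  have "t \<longlonglongrightarrow> 0"
    by (rule tendsto_sandwich[OF _ _ tendsto_const LIMSEQ_Suc[OF lim_1_over_n]])
       (use t(1,2) in \<open>auto intro!: always_eventually\<close>)
  then have "filterlim t (at_right 0) sequentially"
    unfolding filterlim_at using t(1) tpos by (auto simp: less_le intro!: always_eventually)
  then have "(\<lambda>k. n (S (t k) Y - Y)) \<longlonglongrightarrow> 0"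
    by (rule filterlim_compose[OF S_continuous_0[OF Y(1)]])
  then have "eventually (\<lambda>k. n (S (t k) Y - Y) < 1) sequentially"
    by (rule order_tendstoD) simp
  moreover obtain N where N: "6 * (n Y + 1) < (4/3) ^ N"
    using real_arch_pow[of "4/3" "6 * (n Y + 1)"] by auto
  then have "eventually (\<lambda>k. 6 * (n Y + 1) \<le> (4/3) ^ k) sequentially"
    by (intro eventually_sequentiallyI[of N] order_trans[OF less_imp_le[OF N]] power_increasing) auto
  ultimately have "eventually (\<lambda>k::nat. False) sequentially"
  proof eventually_elim
    case (elim k)
    have "n (S (t k) Y) \<le> n Y + n (S (t k) Y - Y)"
      by (rule n_le_diff) (use t(1) Y in auto)
    with lower[of k] elim show ?case by simp
  qed
  then show False by simp
qed


text \<open>Left difference quotients at \<open>t\<close> involve \<open>S (t - h)\<close>.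
  Factoring out the fixed operator \<open>S (t - d)\<close> leaves a time close to 0, where
  \<open>locally_bounded\<close> applies.\<close>

lemma bounded_before:
  assumes t: "0 < t"
  obtains d C where "0 < d" "d \<le> t" "\<And>h X. 0 \<le> h \<Longrightarrow> h \<le> d \<Longrightarrow> X \<in> H \<Longrightarrow> n (S (t - h) X) \<le> C * n X"
proof -
  obtain d C where d: "0 < d" and C: "\<And>t. 0 \<le> t \<Longrightarrow> t \<le> d \<Longrightarrow> opnorm t \<le> C"
    using locally_bounded by blast
  define d' where "d' = min d t"
  have d': "0 < d'" "d' \<le> t" "d' \<le> d" using d t by (auto simp: d'_def)
  show thesis
  proof (rule that[of d' "C * opnorm (t - d')"])
    fix h X assume h: "0 \<le> h" "h \<le> d'" and X: "X \<in> H"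
    have SX: "S (t - d') X \<in> H" using d' X by simp
    have "n (S (t - h) X) = n (S (d' - h) (S (t - d') X))"
      using S_semigroup[of "d' - h" "t - d'" X] h d' X by (intro n_eqI) auto
    also have "\<dots> \<le> opnorm (d' - h) * n (S (t - d') X)"
      using h SX by (intro opnorm_bound) auto
    also have "\<dots> \<le> C * n (S (t - d') X)"
      using h d' SX by (intro mult_right_mono C) auto
    also have "\<dots> \<le> C * (opnorm (t - d') * n X)"
      using d' d X order_trans[OF opnorm_nonneg[of 0] C[of 0]] by (intro mult_left_mono opnorm_bound) auto
    finally show "n (S (t - h) X) \<le> C * opnorm (t - d') * n X" by (simp add: mult.assoc)
  qed (use d' in auto)
qed

section \<open>Differentiability of orbits and decay\<close>

definition quot_err :: "'x \<Rightarrow> 'x \<Rightarrow> real \<Rightarrow> real" where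
  "quot_err X Y h = n (scl (complex_of_real (1 / h)) (S h X - X) - Y)"

lemma diff_quot_iff: "diff_quot_tendsto scl n S X Y \<longleftrightarrow> (quot_err X Y \<longlongrightarrow> 0) (at_right 0)"
  unfolding diff_quot_tendsto_def quot_err_def[abs_def] by (rule refl)

text \<open>Modulo null vectors \<open>S t\<close> commutes with the difference quotient at 0. The
  first estimate serves the right derivative of the orbit, the second puts \<open>S t X\<close> into
  the domain of the generator.\<close>

lemma forward_quotient:
  assumes X: "X \<in> H" and Y: "Y \<in> H" and t: "0 \<le> t" and h: "0 < h"
  shows "n (scl (complex_of_real (1 / h)) (S (t + h) X - S t X) - S t Y) \<le> opnorm t * quot_err X Y h"
    "quot_err (S t X) (S t Y) h \<le> opnorm t * quot_err X Y h"
proof -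
  let ?c = "complex_of_real (1 / h)"
  have m: "S h X \<in> H" "S t X \<in> H" "S t Y \<in> H" "S (t + h) X \<in> H" "S t (S h X) \<in> H" "S h (S t X) \<in> H"
    using X Y t h by auto
  have e1: "b (S (t + h) X) Z = b (S t (S h X)) Z" "b (S (t + h) X) Z = b (S h (S t X)) Z" if "Z \<in> H" for Z
    using S_semigroup[of t h X Z] S_semigroup[of h t X Z] X t h that by (simp_all add: add.commute)
  have le: "n (S t (scl ?c (S h X - X) - Y)) \<le> opnorm t * quot_err X Y h"
    unfolding quot_err_def by (rule opnorm_bound) (use t X Y m in \<open>simp_all only: diff_mem scl_mem\<close>)
  have "n (scl ?c (S (t + h) X - S t X) - S t Y) = n (S t (scl ?c (S h X - X) - Y))"
    by (rule n_eqI) (use t X Y m in \<open>simp_all only: diff_mem scl_mem S_mem diff_left scl_left S_diff S_scl e1(1)\<close>)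
  with le show "n (scl ?c (S (t + h) X - S t X) - S t Y) \<le> opnorm t * quot_err X Y h" by simp
  have "quot_err (S t X) (S t Y) h = n (S t (scl ?c (S h X - X) - Y))"
    unfolding quot_err_def
    by (rule n_eqI) (use t X Y m e1 in \<open>simp_all only: diff_mem scl_mem S_mem diff_left scl_left S_diff S_scl\<close>)
  with le show "quot_err (S t X) (S t Y) h \<le> opnorm t * quot_err X Y h" by simp
qed

text \<open>For \<open>s = t - h\<close> the quotient is \<open>S s\<close> applied to the quotient
  at 0, whereas \<open>S t Y\<close> is \<open>S s (S h Y)\<close>. This is the source of the
  additional error \<open>S h Y - Y\<close>.\<close>

lemma orbit_quotient:
  assumes X: "X \<in> H" and Y: "Y \<in> H" and q: "(quot_err X Y \<longlongrightarrow> 0) (at_right 0)" and t: "0 < t"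
  shows "((\<lambda>s. n (scl (complex_of_real (1 / (s - t))) (S s X - S t X) - S t Y)) \<longlongrightarrow> 0) (at t)"
proof -
  obtain d C where d: "0 < d" "d \<le> t"
    and C: "\<And>h X. 0 \<le> h \<Longrightarrow> h \<le> d \<Longrightarrow> X \<in> H \<Longrightarrow> n (S (t - h) X) \<le> C * n X"
    using bounded_before[OF t] by blast
  define K where "K = max (opnorm t) (max C 0)"
  define err where "err = (\<lambda>h. K * (quot_err X Y h + n (S h Y - Y)))"
  have bound: "n (scl (complex_of_real (1 / (s - t))) (S s X - S t X) - S t Y) \<le> err \<bar>s - t\<bar>"
    if s: "s \<noteq> t" "\<bar>s - t\<bar> < d" for s
  proof -
    define h where "h = \<bar>s - t\<bar>"
    have h: "0 < h" "h < d" using s by (auto simp: h_def)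
    let ?c = "complex_of_real (1 / h)"
    have m: "S h X \<in> H" "S h Y \<in> H" using X Y h by auto
    have q0: "0 \<le> quot_err X Y h"
      unfolding quot_err_def by (rule n_nonneg) (use X Y m in \<open>simp only: diff_mem scl_mem\<close>)
    have q1: "0 \<le> n (S h Y - Y)" using m Y by simp
    show ?thesis
    proof (cases "t < s")
      case True
      then have "s = t + h" by (simp add: h_def)
      then have "n (scl (complex_of_real (1 / (s - t))) (S s X - S t X) - S t Y) \<le> opnorm t * quot_err X Y h"
        using forward_quotient(1)[OF X Y _ h(1), of t] t by simp
      also have "\<dots> \<le> K * quot_err X Y h" using q0 by (intro mult_right_mono) (auto simp: K_def)
      also have "\<dots> \<le> err h" unfolding err_def using q1 by (intro mult_left_mono) (auto simp: K_def)
      finally show ?thesis by (simp add: h_def)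
    next
      case False
      then have st: "s = t - h" using s by (simp add: h_def)
      have sp: "0 \<le> s" using st h d by simp
      have mm: "S s X \<in> H" "S t X \<in> H" "S s Y \<in> H" "S t Y \<in> H" "S s (S h X) \<in> H" "S s (S h Y) \<in> H"
        using X Y sp t m by auto
      have e1: "b (S t V) Z = b (S s (S h V)) Z" if "V \<in> H" "Z \<in> H" for V Z
        using S_semigroup[of s h V Z] sp h that by (simp add: st)
      define V where "V = scl ?c (S h X - X) - Y"
      have V: "V \<in> H" unfolding V_def using m X Y by (simp only: diff_mem scl_mem)
      have sc: "complex_of_real (1 / (s - t)) = complex_of_real (- (1 / h))" by (simp add: st)
      have "n (scl (complex_of_real (1 / (s - t))) (S s X - S t X) - S t Y) = n (S s (V - (S h Y - Y)))"
        unfolding sc V_def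
      proof (rule n_eqI, goal_cases)
        case (3 Z)
        then show ?case using X Y m mm sp
          by (simp only: diff_mem scl_mem S_mem diff_left scl_left S_diff S_scl e1) (simp add: algebra_simps)
      qed (use X Y m mm sp in \<open>simp_all only: diff_mem scl_mem S_mem\<close>)
      also have "\<dots> \<le> C * n (V - (S h Y - Y))"
        using C[of h "V - (S h Y - Y)"] h V m Y by (simp add: st)
      also have "\<dots> \<le> K * n (V - (S h Y - Y))"
        using V m Y by (intro mult_right_mono) (auto simp: K_def)
      also have "\<dots> \<le> K * (n V + n (S h Y - Y))"
        using V m Y by (intro mult_left_mono n_diff_le) (auto simp: K_def)
      finally show ?thesis by (simp add: err_def quot_err_def V_def h_def)
    qed
  qed
  have "(err \<longlongrightarrow> K * (0 + 0)) (at_right 0)"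
    unfolding err_def by (intro tendsto_intros q S_continuous_0 Y)
  moreover have "filterlim (\<lambda>s. \<bar>s - t\<bar>) (at_right 0) (at t)"
    unfolding filterlim_at
  proof
    have "((\<lambda>s. \<bar>s - t\<bar>) \<longlongrightarrow> \<bar>t - t\<bar>) (at t)" by (intro tendsto_intros)
    then show "((\<lambda>s. \<bar>s - t\<bar>) \<longlongrightarrow> 0) (at t)" by simp
    show "eventually (\<lambda>s. \<bar>s - t\<bar> \<in> {0<..} \<and> \<bar>s - t\<bar> \<noteq> 0) (at t)"
      by (auto simp: eventually_at_filter)
  qed
  ultimately have lim: "((\<lambda>s. err \<bar>s - t\<bar>) \<longlongrightarrow> 0) (at t)"
    using filterlim_compose by fastforce
  show ?thesis
  proof (rule Lim_null_comparison[OF _ lim])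
    have "eventually (\<lambda>s. s \<noteq> t \<and> \<bar>s - t\<bar> < d \<and> 0 \<le> s) (at t)"
      unfolding eventually_at using d by (intro exI[of _ d]) (auto simp: dist_real_def)
    then show "eventually (\<lambda>s. norm (n (scl (complex_of_real (1 / (s - t))) (S s X - S t X) - S t Y)) \<le> err \<bar>s - t\<bar>) (at t)"
    proof eventually_elim
      case (elim s)
      have "scl (complex_of_real (1 / (s - t))) (S s X - S t X) - S t Y \<in> H"
        using elim t X Y by (simp only: diff_mem scl_mem S_mem less_imp_le)
      then show ?case using bound[of s] elim by simp
    qed
  qed
qed

text \<open>The increment of the square is \<open>b (S s X - S t X) (S s X + S t X)\<close>. As the
  space carries only a seminorm, the product rule is replaced by the explicit remainder
  \<open>R\<close>.\<close>

lemma orbit_derivative: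
  assumes X: "X \<in> H" and Y: "Y \<in> H" and q: "(quot_err X Y \<longlongrightarrow> 0) (at_right 0)" and t: "0 < t"
  shows "((\<lambda>s. b (S s X) (S s X)) has_real_derivative 2 * b (S t X) (S t Y)) (at t)"
proof -
  define W where "W = S t Y"
  define V where "V = (\<lambda>s. scl (complex_of_real (1 / (s - t))) (S s X - S t X))"
  define e where "e = (\<lambda>s. n (V s - W))"
  have e: "(e \<longlongrightarrow> 0) (at t)" using orbit_quotient[OF assms] by (simp add: e_def V_def W_def)
  have W: "W \<in> H" and St: "S t X \<in> H" using X Y t by (auto simp: W_def)
  define R where "R = (\<lambda>s. e s * (\<bar>s - t\<bar> * (e s + n W) + 2 * n (S t X)) + n W * (\<bar>s - t\<bar> * (e s + n W)))"
  have "(R \<longlongrightarrow> 0 * (\<bar>t - t\<bar> * (0 + n W) + 2 * n (S t X)) + n W * (\<bar>t - t\<bar> * (0 + n W))) (at t)"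
    unfolding R_def by (intro tendsto_intros e)
  then have R: "(R \<longlongrightarrow> 0) (at t)" by simp
  have bound: "\<bar>(b (S s X) (S s X) - b (S t X) (S t X)) / (s - t) - 2 * b (S t X) W\<bar> \<le> R s"
    if s: "s \<noteq> t" "0 \<le> s" for s
  proof -
    have Ss: "S s X \<in> H" using X s by simp
    have V: "V s \<in> H" unfolding V_def using Ss St by (simp only: diff_mem scl_mem)
    have bV: "b (V s) Z = (b (S s X) Z - b (S t X) Z) / (s - t)" if "Z \<in> H" for Z
      unfolding V_def using Ss St that by (simp only: diff_mem scl_left diff_left) simp
    have "n (S s X - S t X) = n (scl (complex_of_real (s - t)) (V s))"
      by (rule n_eqI) (use s Ss St V in \<open>simp_all only: diff_mem scl_mem scl_left diff_left bV, simp_all\<close>)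
    also have "\<dots> = \<bar>s - t\<bar> * n (V s)" by (rule n_scl[OF V])
    also have "\<dots> \<le> \<bar>s - t\<bar> * (e s + n W)"
      using n_le_diff[OF V W] by (intro mult_left_mono) (auto simp: e_def)
    finally have d: "n (S s X - S t X) \<le> \<bar>s - t\<bar> * (e s + n W)" .
    have e0: "0 \<le> e s" unfolding e_def using V W by simp
    have "(b (S s X) (S s X) - b (S t X) (S t X)) / (s - t) - 2 * b (S t X) W
      = b (V s - W) (S s X + S t X) + b W (S s X - S t X)"
      using s V W Ss St by (simp add: bV sym[of W] sym[of "S t X" "S s X"] diff_divide_distrib add_divide_distrib)
    also have "\<bar>\<dots>\<bar> \<le> \<bar>b (V s - W) (S s X + S t X)\<bar> + \<bar>b W (S s X - S t X)\<bar>" by simp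
    also have "\<bar>b (V s - W) (S s X + S t X)\<bar> \<le> e s * n (S s X + S t X)"
      unfolding e_def by (rule Cauchy_Schwarz) (use V W Ss St in auto)
    also have "\<dots> \<le> e s * (\<bar>s - t\<bar> * (e s + n W) + 2 * n (S t X))"
      using n_triangle[OF Ss St] n_le_diff[OF Ss St] d e0 by (intro mult_left_mono) auto
    also have "\<bar>b W (S s X - S t X)\<bar> \<le> n W * n (S s X - S t X)"
      by (rule Cauchy_Schwarz) (use W Ss St in auto)
    also have "\<dots> \<le> n W * (\<bar>s - t\<bar> * (e s + n W))"
      using d W by (intro mult_left_mono) auto
    finally show ?thesis by (simp add: R_def)
  qed
  have "((\<lambda>s. (b (S s X) (S s X) - b (S t X) (S t X)) / (s - t) - 2 * b (S t X) W) \<longlongrightarrow> 0) (at t)"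
  proof (rule Lim_null_comparison[OF _ R])
    have "eventually (\<lambda>s. s \<noteq> t \<and> 0 \<le> s) (at t)"
      unfolding eventually_at using t by (intro exI[of _ t]) (auto simp: dist_real_def)
    then show "eventually (\<lambda>s. norm ((b (S s X) (S s X) - b (S t X) (S t X)) / (s - t) - 2 * b (S t X) W) \<le> R s) (at t)"
      by eventually_elim (use bound in simp)
  qed
  then show ?thesis
    unfolding has_field_derivative_iff W_def by (rule LIM_zero_cancel)
qed

lemma orbit_continuous_0:
  assumes X: "X \<in> H" shows "((\<lambda>s. b (S s X) (S s X)) \<longlongrightarrow> b X X) (at_right 0)"
proof -
  have "((\<lambda>s. n (S s X)) \<longlongrightarrow> n X) (at_right 0)"
  proof (rule LIM_zero_cancel)
    show "((\<lambda>s. n (S s X) - n X) \<longlongrightarrow> 0) (at_right 0)"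
    proof (rule Lim_null_comparison[OF _ S_continuous_0[OF X]])
      show "eventually (\<lambda>s. norm (n (S s X) - n X) \<le> n (S s X - X)) (at_right 0)"
        using eventually_at_right_less
      proof eventually_elim
        case (elim s)
        then have "S s X \<in> H" using X by simp
        then show ?case
          using n_le_diff[of "S s X" X] n_le_diff[of X "S s X"] n_commute[of X "S s X"] X by simp
      qed
    qed
  qed
  then have "((\<lambda>s. (n (S s X))\<^sup>2) \<longlongrightarrow> (n X)\<^sup>2) (at_right 0)" by (intro tendsto_intros)
  then have "((\<lambda>s. (n (S s X))\<^sup>2) \<longlongrightarrow> b X X) (at_right 0)" using X by (simp add: n_power2)
  then show ?thesis
    by (rule Lim_transform_eventually)
       (use eventually_at_right_less in \<open>eventually_elim, use X in \<open>simp add: n_power2\<close>\<close>)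
qed

theorem exponential_decay:
  assumes gen: "is_generator scl H n D A S"
    and dense: "\<And>X e. X \<in> H \<Longrightarrow> 0 < e \<Longrightarrow> \<exists>Y\<in>D. n (X - Y) < e"
    and dissip: "\<And>X. X \<in> D \<Longrightarrow> b X (A X) \<le> - \<nu> * b X X"
    and X: "X \<in> H" and t: "0 \<le> t"
  shows "b (S t X) (S t X) \<le> exp (- 2 * \<nu> * t) * b X X"
proof -
  have D: "X \<in> H" "A X \<in> H" "(quot_err X (A X) \<longlongrightarrow> 0) (at_right 0)" if "X \<in> D" for X
    using gen that by (auto simp: is_generator_def diff_quot_iff)
  \<comment> \<open>\<open>S t (A X)\<close> and \<open>A (S t X)\<close> are limits of the same
    difference quotients, hence differ by a null vector.\<close>
  have SD: "S t X \<in> D \<and> b (S t X) (S t (A X)) = b (S t X) (A (S t X))" if XD: "X \<in> D" and t: "0 \<le> t" for X t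
  proof -
    note DX = D[OF XD]
    have m: "S t X \<in> H" "S t (A X) \<in> H" using DX t by auto
    have "((\<lambda>h. opnorm t * quot_err X (A X) h) \<longlongrightarrow> opnorm t * 0) (at_right 0)"
      by (intro tendsto_intros DX)
    then have lim0: "((\<lambda>h. opnorm t * quot_err X (A X) h) \<longlongrightarrow> 0) (at_right 0)" by simp
    have lim: "(quot_err (S t X) (S t (A X)) \<longlongrightarrow> 0) (at_right 0)"
    proof (rule Lim_null_comparison[OF _ lim0])
      show "eventually (\<lambda>h. norm (quot_err (S t X) (S t (A X)) h) \<le> opnorm t * quot_err X (A X) h) (at_right 0)"
        using eventually_at_right_less
      proof eventually_elim
        case (elim h)
        then have "S h (S t X) \<in> H" using m by simp
        then have "0 \<le> quot_err (S t X) (S t (A X)) h"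
          unfolding quot_err_def using m by (intro n_nonneg) (simp only: diff_mem scl_mem)
        then show ?case using forward_quotient(2)[OF DX(1,2) t elim] by simp
      qed
    qed
    then have "\<exists>Y\<in>H. diff_quot_tendsto scl n S (S t X) Y"
      using m by (auto simp: diff_quot_iff)
    with m gen have StD: "S t X \<in> D" by (simp add: is_generator_def)
    note DS = D[OF StD]
    have "((\<lambda>h. quot_err (S t X) (S t (A X)) h + quot_err (S t X) (A (S t X)) h) \<longlongrightarrow> 0 + 0) (at_right 0)"
      by (intro tendsto_intros lim DS)
    moreover have "eventually (\<lambda>h. n (S t (A X) - A (S t X)) \<le> quot_err (S t X) (S t (A X)) h + quot_err (S t X) (A (S t X)) h) (at_right 0)"
      using eventually_at_right_less
    proof eventually_elim
      case (elim h)
      then have q: "scl (complex_of_real (1 / h)) (S h (S t X) - S t X) \<in> H"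
        using m by (simp only: diff_mem scl_mem S_mem less_imp_le)
      show ?case
        using n_diff_triangle[OF m(2) q DS(2)] n_commute[OF m(2) q] by (simp add: quot_err_def)
    qed
    ultimately have "n (S t (A X) - A (S t X)) \<le> 0"
      by (intro tendsto_lowerbound[where F="at_right (0::real)"]) auto
    then have "n (S t (A X) - A (S t X)) = 0"
      using m DS by (intro antisym) auto
    from b_eq_of_n_zero[OF m(2) DS(2) this m(1)] show ?thesis
      using StD sym m DS by metis
  qed
  define f where "f = (\<lambda>X s. exp (2 * \<nu> * s) * b (S s X) (S s X))"
  have onD: "b (S t X) (S t X) \<le> exp (- 2 * \<nu> * t) * b X X" if XD: "X \<in> D" for X
  proof -
    note DX = D[OF XD]
    have f0: "f X 0 = b X X"
      using n_eqI[of "S 0 X" X] DX n_power2[of "S 0 X"] n_power2[of X] by (simp add: f_def)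
    have deriv: "(f X has_real_derivative
        2 * \<nu> * exp (2 * \<nu> * s) * b (S s X) (S s X) + exp (2 * \<nu> * s) * (2 * b (S s X) (S s (A X)))) (at s)"
      if "0 < s" for s
      unfolding f_def using that DX
      by (auto intro!: derivative_eq_intros orbit_derivative[of X "A X"])
    have "f X t \<le> f X 0"
    proof (rule DERIV_nonpos_imp_decreasing_open[OF t])
      fix s :: real assume s: "0 < s" "s < t"
      have "b (S s X) (S s (A X)) \<le> - \<nu> * b (S s X) (S s X)"
        using SD[OF XD, of s] dissip[of "S s X"] s by simp
      then have "exp (2 * \<nu> * s) * (2 * b (S s X) (S s (A X))) \<le> exp (2 * \<nu> * s) * (2 * (- \<nu> * b (S s X) (S s X)))"
        by (intro mult_left_mono) auto
      then show "\<exists>y. (f X has_real_derivative y) (at s) \<and> y \<le> 0"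
        using deriv[OF s(1)] by (intro exI conjI) (auto simp: algebra_simps)
    next
      show "continuous_on {0..t} (f X)"
        unfolding continuous_on_eq_continuous_within
      proof
        fix s assume s: "s \<in> {0..t}"
        show "continuous (at s within {0..t}) (f X)"
        proof (cases "s = 0")
          case True
          have "at 0 within {0..t} = at 0 within ({0..t} - {0})" by (simp add: at_within_def)
          also have "\<dots> \<le> at_right 0" by (rule at_le) auto
          finally have le: "at 0 within {0..t} \<le> at_right 0" .
          have "(f X \<longlongrightarrow> exp (2 * \<nu> * 0) * b X X) (at_right 0)"
            unfolding f_def by (intro tendsto_intros orbit_continuous_0 DX)
          then have "(f X \<longlongrightarrow> f X 0) (at_right 0)" by (simp add: f0)
          then have "(f X \<longlongrightarrow> f X 0) (at 0 within {0..t})"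
            by (rule filterlim_mono[OF _ order_refl le])
          then show ?thesis using True by (simp add: continuous_within)
        next
          case False
          then have "0 < s" using s by simp
          from DERIV_isCont[OF deriv[OF this]] show ?thesis
            by (rule continuous_at_imp_continuous_at_within)
        qed
      qed
    qed
    then have "exp (2 * \<nu> * t) * b (S t X) (S t X) \<le> b X X" unfolding f0 by (simp add: f_def)
    then have "exp (- 2 * \<nu> * t) * (exp (2 * \<nu> * t) * b (S t X) (S t X)) \<le> exp (- 2 * \<nu> * t) * b X X"
      by (intro mult_left_mono) auto
    then show ?thesis by (simp add: mult.assoc[symmetric] exp_add[symmetric])
  qed
  have nD: "n (S t Y) \<le> exp (- \<nu> * t) * n Y" if "Y \<in> D" for Y
  proof -
    have "sqrt (b (S t Y) (S t Y)) \<le> sqrt (exp (- 2 * \<nu> * t) * b Y Y)"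
      by (intro real_sqrt_le_mono onD that)
    also have "exp (- 2 * \<nu> * t) = (exp (- \<nu> * t))\<^sup>2"
      by (simp add: power2_eq_square exp_add[symmetric])
    finally show ?thesis by (simp add: n_def real_sqrt_mult)
  qed
  have "n (S t X) \<le> exp (- \<nu> * t) * n X"
  proof (rule field_le_epsilon)
    fix e :: real assume e: "0 < e"
    \<comment> \<open>At the fixed time \<open>t\<close> the approximation error enters twice,
      through the operator norm and through \<open>n Y\<close>.\<close>
    define K where "K = opnorm t + exp (- \<nu> * t)"
    have K: "0 < K" unfolding K_def by (intro add_nonneg_pos opnorm_nonneg t) simp
    then obtain Y where Y: "Y \<in> D" "n (X - Y) < e / K"
      using dense[OF X, of "e / K"] e by auto
    note YH = D(1)[OF Y(1)]
    have "n (S t X) \<le> n (S t Y) + n (S t X - S t Y)"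
      by (rule n_le_diff) (use t X YH in auto)
    also have "n (S t X - S t Y) = n (S t (X - Y))"
      by (rule n_eqI) (use t X YH in auto)
    also have "\<dots> \<le> opnorm t * n (X - Y)" by (rule opnorm_bound) (use t X YH in auto)
    also have "n (S t Y) \<le> exp (- \<nu> * t) * n Y" by (rule nD[OF Y(1)])
    also have "\<dots> \<le> exp (- \<nu> * t) * (n X + n (X - Y))"
      using n_le_diff[OF YH X] n_commute[OF X YH] by (intro mult_left_mono) auto
    finally have "n (S t X) \<le> exp (- \<nu> * t) * n X + K * n (X - Y)"
      by (simp add: K_def algebra_simps)
    moreover have "K * n (X - Y) \<le> e" using Y(2) K by (simp add: field_simps)
    ultimately show "n (S t X) \<le> exp (- \<nu> * t) * n X + e" by simp
  qed
  then have "(n (S t X))\<^sup>2 \<le> (exp (- \<nu> * t) * n X)\<^sup>2"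
    by (intro power_mono) (use t X in auto)
  also have "\<dots> = (exp (- \<nu> * t))\<^sup>2 * b X X" using X by (simp add: power_mult_distrib n_power2)
  also have "(exp (- \<nu> * t))\<^sup>2 = exp (- 2 * \<nu> * t)"
    by (simp add: power2_eq_square exp_add[symmetric])
  finally show ?thesis using t X by (simp add: n_power2)
qed

end

section \<open>A Lyapunov form for the damped wave equation\<close>

abbreviation weight :: "(real \<Rightarrow> real) \<Rightarrow> (real \<Rightarrow> 'a::real_vector) \<Rightarrow> real \<Rightarrow> 'a" (infixr \<open>\<odot>\<close> 75) where
  "k \<odot> f \<equiv> \<lambda>x. k x *\<^sub>R f x"

text \<open>For complex functions this is the real part of the Hermitian product, so that
  \<open>b\<close> below is real bilinear.\<close>

definition ip :: "(real \<Rightarrow> 'a::euclidean_space) \<Rightarrow> (real \<Rightarrow> 'a) \<Rightarrow> real" where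
  "ip f g = (\<integral>x. f x \<bullet> g x \<partial>I01)"

lemma ip_commute: "ip f g = ip g f"
  by (simp add: ip_def inner_commute)

lemma ip_integrable: "L2 f \<Longrightarrow> L2 g \<Longrightarrow> integrable I01 (\<lambda>x. f x \<bullet> g x)"
  by (rule L2_bilinear_integrable[OF bounded_bilinear_inner])

lemma ip_add_left: "L2 f \<Longrightarrow> L2 g \<Longrightarrow> L2 h \<Longrightarrow> ip (\<lambda>x. f x + g x) h = ip f h + ip g h"
  by (simp add: ip_def inner_add_left ip_integrable)

lemma ip_add_right: "L2 f \<Longrightarrow> L2 g \<Longrightarrow> L2 h \<Longrightarrow> ip h (\<lambda>x. f x + g x) = ip h f + ip h g"
  by (simp add: ip_def inner_add_right ip_integrable)

lemma ip_diff_left: "L2 f \<Longrightarrow> L2 g \<Longrightarrow> L2 h \<Longrightarrow> ip (\<lambda>x. f x - g x) h = ip f h - ip g h"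
  by (simp add: ip_def inner_diff_left ip_integrable)

lemma ip_diff_right: "L2 f \<Longrightarrow> L2 g \<Longrightarrow> L2 h \<Longrightarrow> ip h (\<lambda>x. f x - g x) = ip h f - ip h g"
  by (simp add: ip_def inner_diff_right ip_integrable)

lemma ip_scaleR_left: "ip (\<lambda>x. c *\<^sub>R f x) g = c * ip f g"
  by (simp add: ip_def)

lemma ip_scaleR_right: "ip f (\<lambda>x. c *\<^sub>R g x) = c * ip f g"
  by (simp add: ip_def)

lemma ip_cong_AE:
  assumes "L2 f" "L2 g" "L2 f'" "L2 g'" "AE x in I01. f x = f' x" "AE x in I01. g x = g' x"
  shows "ip f g = ip f' g'"
  unfolding ip_def
proof (rule integral_cong_AE)
  show "AE x in I01. f x \<bullet> g x = f' x \<bullet> g' x" using assms(5,6) by eventually_elim simp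
qed (use assms(1-4) in \<open>auto intro!: borel_measurable_integrable ip_integrable\<close>)

lemma ip_self_nonneg: "0 \<le> ip f f"
  unfolding ip_def by (intro Bochner_Integration.integral_nonneg) simp

lemma L2_norm_ip: "L2_norm f = sqrt (ip f f)"
  by (simp add: L2_norm_def ip_def power2_norm_eq_inner)

lemma L2_norm_nonneg: "0 \<le> L2_norm f"
  by (simp add: L2_norm_def)

lemma L2_norm_power2: "(L2_norm f)\<^sup>2 = ip f f"
  by (simp add: L2_norm_ip ip_self_nonneg)

interpretation L2: semi_inner "\<lambda>c f x. Re c *\<^sub>R (f x :: 'a::euclidean_space)" "{f. L2 f}" ip
proof
  fix X Y Z :: "real \<Rightarrow> 'a" and c r
  assume X: "X \<in> {f. L2 f}"
  show "ip X X \<ge> 0" by (rule ip_self_nonneg)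
  show "(\<lambda>x. Re c *\<^sub>R X x) \<in> {f. L2 f}" using X by (simp add: L2_scaleR)
  assume Y: "Y \<in> {f. L2 f}"
  show "X + Y \<in> {f. L2 f}" "X - Y \<in> {f. L2 f}"
    using L2_add[of X Y] L2_diff[of X Y] X Y by (simp_all add: plus_fun_def fun_diff_def)
  show "ip X Y = ip Y X" by (rule ip_commute)
  assume Z: "Z \<in> {f. L2 f}"
  show "ip (X + Y) Z = ip X Z + ip Y Z"
    using ip_add_left[of X Y Z] X Y Z by (simp add: plus_fun_def)
next
  fix X Z :: "real \<Rightarrow> 'a" and r
  show "ip (\<lambda>x. Re (complex_of_real r) *\<^sub>R X x) Z = r * ip X Z"
    by (simp add: ip_scaleR_left)
  show "0 \<in> {f. L2 (f :: real \<Rightarrow> 'a)}" by (simp add: zero_fun_def)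
qed

lemma ip_Cauchy_Schwarz: "L2 f \<Longrightarrow> L2 g \<Longrightarrow> \<bar>ip f g\<bar> \<le> L2_norm f * L2_norm g"
  using L2.Cauchy_Schwarz[of f g] by (simp add: L2_norm_ip L2.n_def)

lemma L2_norm_fun: "L2 f \<Longrightarrow> L2 (\<lambda>x. norm (f x))"
  by (rule L2_bound[of f _ 1]) (auto dest: L2_measurable)

lemma integral_norm_le_L2_norm:
  fixes f :: "real \<Rightarrow> 'a::euclidean_space"
  assumes "L2 f" shows "(\<integral>x. norm (f x) \<partial>I01) \<le> L2_norm f"
proof -
  have "ip (\<lambda>x. norm (f x)) (\<lambda>x. 1) \<le> L2_norm (\<lambda>x. norm (f x)) * L2_norm (\<lambda>x. 1::real)"
    using ip_Cauchy_Schwarz[OF L2_norm_fun[OF assms] L2_const[of "1::real"]] by simp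
  then show ?thesis
    by (simp add: ip_def L2_norm_def measure_restrict_space)
qed

lemma L2_norm_mono:
  fixes f :: "real \<Rightarrow> 'a::euclidean_space" and g :: "real \<Rightarrow> 'b::euclidean_space"
  assumes f: "L2 f" and g: "L2 g" and C: "0 \<le> C" and le: "AE x in I01. norm (g x) \<le> C * norm (f x)"
  shows "L2_norm g \<le> C * L2_norm f"
proof (rule power2_le_imp_le)
  have "(\<integral>x. (norm (g x))\<^sup>2 \<partial>I01) \<le> (\<integral>x. C\<^sup>2 * (norm (f x))\<^sup>2 \<partial>I01)"
  proof (rule integral_mono_AE)
    show "AE x in I01. (norm (g x))\<^sup>2 \<le> C\<^sup>2 * (norm (f x))\<^sup>2"
      using le
    proof eventually_elim
      case (elim x)
      then have "(norm (g x))\<^sup>2 \<le> (C * norm (f x))\<^sup>2" by (intro power_mono) auto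
      then show ?case by (simp add: power_mult_distrib)
    qed
  qed (use f g in \<open>auto simp: L2_def\<close>)
  then show "(L2_norm g)\<^sup>2 \<le> (C * L2_norm f)\<^sup>2"
    by (simp add: L2_norm_def power_mult_distrib)
qed (use C in \<open>simp add: L2_norm_nonneg\<close>)

lemma ip_weight_mono:
  fixes v :: "real \<Rightarrow> 'a::euclidean_space"
  assumes "L2 v" "Linf k" "Linf l" "AE x in I01. k x \<le> l x"
  shows "ip (k \<odot> v) v \<le> ip (l \<odot> v) v"
  unfolding ip_def
proof (rule integral_mono_AE)
  show "AE x in I01. (k x *\<^sub>R v x) \<bullet> v x \<le> (l x *\<^sub>R v x) \<bullet> v x"
    using assms(4) by eventually_elim (simp add: mult_right_mono)
qed (use assms in \<open>auto intro!: ip_integrable Linf_mult_L2[OF bounded_bilinear_scaleR] simp del: inner_scaleR_left\<close>)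

lemma ip_by_parts:
  fixes f g :: "real \<Rightarrow> 'a::euclidean_space"
  assumes f: "ac f f'" and g: "ac g g'"
  shows "ip f' g + ip f g' = f 1 \<bullet> g 1 - f 0 \<bullet> g 0"
proof -
  have "integrable I01 (\<lambda>x. f' x \<bullet> g x)" "integrable I01 (\<lambda>x. f x \<bullet> g' x)"
    using ac_L2[OF f] ac_L2[OF g] ac_L2_self[OF f] ac_L2_self[OF g] by (auto intro: ip_integrable)
  then show ?thesis using ac_integral[OF ac_inner[OF f g]] by (simp add: ip_def)
qed

lemma weight_L2: "Linf k \<Longrightarrow> L2 f \<Longrightarrow> L2 (k \<odot> f)"
  by (rule Linf_mult_L2[OF bounded_bilinear_scaleR])

lemma norm_prim_le_L2_norm:
  fixes f :: "real \<Rightarrow> 'a::euclidean_space"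
  assumes "L2 f" shows "norm (prim f x) \<le> L2_norm f"
  using norm_prim_le[OF L2_integrable[OF assms], of x] integral_norm_le_L2_norm[OF assms] by linarith

lemma L2_norm_le_sup:
  fixes f :: "real \<Rightarrow> 'a::euclidean_space"
  assumes "L2 f" "0 \<le> B" "AE x in I01. norm (f x) \<le> B" shows "L2_norm f \<le> B"
proof -
  have "L2_norm f \<le> B * L2_norm (\<lambda>x. 1::real)"
    by (rule L2_norm_mono) (use assms in auto)
  then show ?thesis by (simp add: L2_norm_def measure_restrict_space)
qed

text \<open>Any essential bound will do; choosing one turns it into a constant that depends on the
  weight alone.\<close>

definition Lsup :: "(real \<Rightarrow> real) \<Rightarrow> real" where
  "Lsup k = (SOME B. 0 \<le> B \<and> (AE x in I01. \<bar>k x\<bar> \<le> B))"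

lemma Lsup:
  assumes "Linf k" shows "0 \<le> Lsup k" "AE x in I01. \<bar>k x\<bar> \<le> Lsup k"
proof -
  obtain B where "AE x in I01. \<bar>k x\<bar> \<le> B" using assms by (auto simp: Linf_def)
  then have "0 \<le> max B 0 \<and> (AE x in I01. \<bar>k x\<bar> \<le> max B 0)" by (auto elim: eventually_mono)
  then have "0 \<le> Lsup k \<and> (AE x in I01. \<bar>k x\<bar> \<le> Lsup k)"
    unfolding Lsup_def by (rule someI)
  then show "0 \<le> Lsup k" "AE x in I01. \<bar>k x\<bar> \<le> Lsup k" by auto
qed

lemma Linf_mult:
  fixes k l :: "real \<Rightarrow> real"
  assumes k: "Linf k" and l: "Linf l" shows "Linf (\<lambda>x. k x * l x)"
proof -
  have "AE x in I01. norm (k x * l x) \<le> Lsup k * Lsup l"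
    using Lsup(2)[OF k] Lsup(2)[OF l] by eventually_elim (auto simp: abs_mult intro!: mult_mono)
  then show ?thesis using k l by (auto simp: Linf_def)
qed

lemma L2_norm_weight:
  fixes f :: "real \<Rightarrow> 'a::euclidean_space"
  assumes k: "Linf k" and f: "L2 f" shows "L2_norm (k \<odot> f) \<le> Lsup k * L2_norm f"
  by (rule L2_norm_mono[OF f weight_L2[OF k f] Lsup(1)[OF k]])
     (use Lsup(2)[OF k] in \<open>eventually_elim, auto intro: mult_right_mono\<close>)

text \<open>The shape of the bound lets error terms be added up by their coefficients, with
  \<open>s\<close> and \<open>t\<close> later the square roots of energies or of the
  dissipation.\<close>

lemma ip_bound:
  assumes "L2 f" "L2 g" "L2_norm f \<le> A * s" "L2_norm g \<le> B * t"
  shows "\<bar>ip f g\<bar> \<le> A * B * (s * t)"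
proof -
  have "L2_norm f * L2_norm g \<le> (A * s) * (B * t)"
    using assms L2_norm_nonneg[of f] L2_norm_nonneg[of g] by (intro mult_mono) auto
  then show ?thesis using ip_Cauchy_Schwarz[OF assms(1,2)] by (simp add: ac_simps)
qed

lemma inner_bound:
  fixes x y :: "'a::real_inner"
  assumes "norm x \<le> A * s" "norm y \<le> B * t" "0 \<le> c"
  shows "\<bar>c * (x \<bullet> y)\<bar> \<le> c * (A * B) * (s * t)"
proof -
  have "norm x * norm y \<le> (A * s) * (B * t)"
    using assms(1,2) order_trans[OF norm_ge_zero assms(1)] by (intro mult_mono) auto
  then have "\<bar>x \<bullet> y\<bar> \<le> A * B * (s * t)"
    using Cauchy_Schwarz_ineq2[of x y] by (simp add: ac_simps)
  then have "c * \<bar>x \<bullet> y\<bar> \<le> c * (A * B * (s * t))" using assms(3) by (rule mult_left_mono)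
  then show ?thesis using assms(3) by (simp add: abs_mult mult.assoc)
qed

lemma le_sqrt_mult:
  assumes "0 < r" "0 \<le> x" "r * x\<^sup>2 \<le> E" shows "x \<le> 1 / sqrt r * sqrt E"
proof -
  have "x\<^sup>2 \<le> E / r" using assms by (simp add: field_simps)
  then have "sqrt (x\<^sup>2) \<le> sqrt (E / r)" by (rule real_sqrt_le_mono)
  then show ?thesis using assms by (simp add: real_sqrt_divide)
qed

text \<open>\<open>a\<close> stands for the continuous representative of the coefficient and
  \<open>a'\<close> for its weak derivative. The existential constants of the assumptions become
  parameters, so that the weights can be defined from them.\<close>

locale damped_wave =
  fixes a a' q :: "real \<Rightarrow> real" and \<alpha>1 \<alpha>2 \<beta>1 \<gamma>1 \<mu>1 :: real
    and Ka alo Kq qlo c d :: real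
  assumes a: "ac a a'" and a': "a' \<in> borel_measurable I01" "AE x in I01. \<bar>a' x\<bar> \<le> Ka"
    and Ka: "0 \<le> Ka" and alo: "0 < alo" "\<And>x. x \<in> {0..1} \<Longrightarrow> alo \<le> a x"
    and q: "q \<in> borel_measurable I01" "AE x in I01. 0 \<le> q x" "AE x in I01. q x \<le> Kq"
    and qlo: "0 < qlo" "AE x in I01. x \<in> {c<..<d} \<longrightarrow> qlo \<le> q x"
    and cd: "0 \<le> c" "c < d" "d \<le> 1"
    and pos: "0 < \<alpha>1" "0 < \<alpha>2" "0 < \<beta>1" "0 < \<gamma>1" "0 < \<mu>1"
begin

text \<open>
  The function \<open>p\<close> vanishes at both ends of the interval, and \<open>p'\<close> and \<open>(p' a - p a') / a\<close> are at
  least \<open>4 th - C0 xi\<close>: the exponentials beat \<open>a'\<close>, and the switch from the increasing branch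
  that vanishes at \<open>0\<close> to the one that vanishes at \<open>1\<close> takes place where \<open>xi > 0\<close>, inside the
  damped interval. The weight \<open>g\<close> is what compensates the loss there.
\<close>

definition "c1 = a 1 / \<beta>1"
definition "c0 = a 0 / \<mu>1"
text \<open>Chosen to make \<open>\<bar>a'\<bar> \<le> k a\<close>; the summand 1 keeps the
  exponential rate positive when \<open>Ka\<close> is 0.\<close>

definition "k = Ka / alo + 1"
text \<open>A bump that is positive exactly between \<open>c\<close> and \<open>d\<close>. The
  square makes the truncated parabola continuously differentiable.\<close>

definition "xi x = (max 0 ((x - c) * (d - x)))\<^sup>2" for x :: real
definition "xi' x = 2 * max 0 ((x - c) * (d - x)) * (c + d - 2 * x)" for x :: real
definition "Xi = prim xi"
definition "p x = (Xi 1 - Xi x) * (exp (k * x) - 1) + Xi x * (1 - exp (k * (1 - x)))" for x :: real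
definition "p' x = (Xi 1 - Xi x) * (k * exp (k * x)) + Xi x * (k * exp (k * (1 - x)))
  - xi x * (exp (k * x) + exp (k * (1 - x)) - 2)" for x :: real
text \<open>Bounds \<open>exp (k x) + exp (k (1 - x)) - 2\<close> on the unit interval, the slope
  lost per unit of \<open>xi\<close> where the branches of \<open>p\<close> are switched.\<close>

definition "C0 = 2 * exp k - 2"
text \<open>The pointwise gain \<open>k Xi 1\<close> is \<open>4 th\<close>, and integration by
  parts halves it. In the kinetic energy \<open>g\<close> takes back one \<open>th\<close>, which
  leaves \<open>th\<close>; in the potential energy it adds one.\<close>

definition "th = k * Xi 1 / 4"
definition "g x = th + C0 / 2 * xi x" for x :: real
definition "g' x = C0 / 2 * xi' x" for x :: real

section \<open>Weights of the multipliers and their lower bounds\<close>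

lemma c_pos: "0 < c1" "0 < c0"
  using alo(1) alo(2)[of 0] alo(2)[of 1] pos by (auto simp: c1_def c0_def)

lemma k_bounds: "1 \<le> k" "AE x in I01. \<bar>a' x\<bar> \<le> k * a x"
proof -
  show k1: "1 \<le> k" using Ka alo by (simp add: k_def)
  show "AE x in I01. \<bar>a' x\<bar> \<le> k * a x"
    using a'(2) AE_space
  proof eventually_elim
    case (elim x)
    then have "Ka \<le> k * alo" "alo \<le> a x" using alo by (auto simp: k_def field_simps)
    moreover have "k * alo \<le> k * a x" using \<open>alo \<le> a x\<close> k1 by (intro mult_left_mono) auto
    ultimately show ?case using elim by linarith
  qed
qed

lemma xi_deriv: "(xi has_real_derivative xi' x) (at x)"
proof -
  have sq: "((\<lambda>y::real. (max 0 y)\<^sup>2) has_real_derivative 2 * max 0 y) (at y)" for y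
  proof -
    consider "y < 0" | "y > 0" | "y = 0" by linarith
    then show ?thesis
    proof cases
      case 1
      have "((\<lambda>y::real. 0) has_real_derivative 0) (at y)" by simp
      then have "((\<lambda>y::real. (max 0 y)\<^sup>2) has_real_derivative 0) (at y)"
        by (rule has_field_derivative_transform_within_open[where S="{..<0}"]) (use 1 in auto)
      then show ?thesis using 1 by simp
    next
      case 2
      have "((\<lambda>y::real. y\<^sup>2) has_real_derivative 2 * y) (at y)"
        by (auto intro!: derivative_eq_intros)
      then have "((\<lambda>y::real. (max 0 y)\<^sup>2) has_real_derivative 2 * y) (at y)"
        by (rule has_field_derivative_transform_within_open[where S="{0<..}"]) (use 2 in auto)
      then show ?thesis using 2 by simp
    next
      case 3
      have "((\<lambda>h::real. ((max 0 (0 + h))\<^sup>2 - (max 0 0)\<^sup>2) / h) \<longlongrightarrow> 0) (at 0)"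
      proof (rule Lim_null_comparison)
        show "eventually (\<lambda>h. norm (((max 0 (0 + h))\<^sup>2 - (max 0 0)\<^sup>2) / h) \<le> \<bar>h\<bar>) (at (0::real))"
          by (rule always_eventually) (auto simp: max_def power2_eq_square)
        show "((\<lambda>h::real. \<bar>h\<bar>) \<longlongrightarrow> 0) (at 0)" by (intro tendsto_eq_intros) auto
      qed
      then show ?thesis using 3 by (simp add: DERIV_def)
    qed
  qed
  have "((\<lambda>x. (x - c) * (d - x)) has_real_derivative (c + d - 2 * x)) (at x)"
    by (auto intro!: derivative_eq_intros)
  from DERIV_chain2[OF sq this] show ?thesis
    unfolding xi_def[abs_def] xi'_def by simp
qed

lemma xi_nonneg: "0 \<le> xi x" by (simp add: xi_def)

lemma xi_out:
  assumes "x \<notin> {c<..<d}" shows "xi x = 0" "xi' x = 0"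
proof -
  have "(x - c) * (d - x) \<le> 0"
  proof (cases "x \<le> c")
    case True
    then show ?thesis using cd by (intro mult_nonpos_nonneg) auto
  next
    case False
    then show ?thesis using assms by (intro mult_nonneg_nonpos) auto
  qed
  then show "xi x = 0" "xi' x = 0" by (simp_all add: xi_def xi'_def)
qed

lemma xi_ends: "xi 0 = 0" "xi 1 = 0"
  by (rule xi_out(1), use cd in simp)+

lemma xi_continuous: "continuous_on A xi" "continuous_on A xi'"
  unfolding xi_def[abs_def] xi'_def[abs_def] by (intro continuous_intros)+

lemma xi_ac: "ac xi xi'"
proof (rule ac_C1)
  show "(xi has_vector_derivative xi' x) (at x within {0..1})" for x
    using xi_deriv[of x] unfolding has_real_derivative_iff_has_vector_derivative
    by (rule has_vector_derivative_at_within)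
qed (rule xi_continuous)

lemma xi_L2: "L2 xi"
  by (intro Linf_imp_L2 continuous_on_Linf xi_continuous)

lemma Xi_ac: "ac Xi xi"
  using ac_prim[OF xi_L2, of 0] by (simp add: Xi_def)

text \<open>The factors \<open>Xi 1 - Xi x\<close> and \<open>Xi x\<close> of the two branches of
  \<open>p\<close> are nonnegative with a constant positive sum, like a partition of unity that is
  not normalised.\<close>

lemma Xi_bounds: "Xi 0 = 0" "0 \<le> Xi x" "Xi x \<le> Xi 1" "0 < Xi 1"
proof -
  show "Xi 0 = 0" by (simp add: Xi_def)
  note i = L2_integrable[OF xi_L2]
  show "0 \<le> Xi x" unfolding Xi_def prim_def using xi_nonneg by (intro Bochner_Integration.integral_nonneg) auto
  show "Xi x \<le> Xi 1" unfolding Xi_def prim_1 unfolding prim_def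
    by (rule integral_mono[OF prim_integrable[OF i] i]) (auto simp: indicator_def xi_nonneg)
  have c: "continuous_on {0..1} xi" by (rule xi_continuous)
  have e: "Xi 1 = integral {0..1} xi" unfolding Xi_def by (rule prim_eq_integral[OF c]) simp
  have "xi ((c + d) / 2) \<noteq> 0"
  proof -
    have "(c + d) / 2 - c = (d - c) / 2" "d - (c + d) / 2 = (d - c) / 2" by (auto simp: field_simps)
    then show ?thesis using cd by (simp add: xi_def max_def)
  qed
  moreover have "(c + d) / 2 \<in> {0..1}" using cd by auto
  ultimately have "Xi 1 \<noteq> 0"
    unfolding e by (subst integral_eq_0_iff[OF c]) (auto simp: xi_nonneg)
  moreover have "0 \<le> Xi 1" unfolding Xi_def prim_def using xi_nonneg by (intro Bochner_Integration.integral_nonneg) auto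
  ultimately show "0 < Xi 1" by simp
qed

lemma p'_continuous: "continuous_on {0..1} p'"
  unfolding p'_def[abs_def]
  by (intro continuous_intros xi_continuous ac_continuous[OF Xi_ac])

lemma p_ac: "ac p p'"
proof -
  have e1: "ac (\<lambda>x. exp (k * x) - 1) (\<lambda>x. k * exp (k * x))"
    by (rule ac_C1) (auto intro!: derivative_eq_intros continuous_intros
        simp: has_real_derivative_iff_has_vector_derivative[symmetric])
  have e2: "ac (\<lambda>x. 1 - exp (k * (1 - x))) (\<lambda>x. k * exp (k * (1 - x)))"
    by (rule ac_C1) (auto intro!: derivative_eq_intros continuous_intros
        simp: has_real_derivative_iff_has_vector_derivative[symmetric])
  have s: "ac (\<lambda>x. Xi 1 - Xi x) (\<lambda>x. - xi x)"
    using ac_add[OF ac_const[of "Xi 1"] ac_bounded_linear[OF bounded_linear_minus[OF bounded_linear_ident] Xi_ac]] by simp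
  have "ac (\<lambda>x. (Xi 1 - Xi x) * (exp (k * x) - 1) + Xi x * (1 - exp (k * (1 - x))))
    (\<lambda>x. (- xi x * (exp (k * x) - 1) + (Xi 1 - Xi x) * (k * exp (k * x)))
      + (xi x * (1 - exp (k * (1 - x))) + Xi x * (k * exp (k * (1 - x)))))"
    by (intro ac_add ac_bilinear[OF bounded_bilinear_mult] e1 e2 s Xi_ac)
  also have "(\<lambda>x. (- xi x * (exp (k * x) - 1) + (Xi 1 - Xi x) * (k * exp (k * x)))
      + (xi x * (1 - exp (k * (1 - x))) + Xi x * (k * exp (k * (1 - x))))) = p'"
    by (auto simp: p'_def fun_eq_iff algebra_simps)
  finally show ?thesis by (simp add: p_def[abs_def])
qed

lemma p_ends: "p 0 = 0" "p 1 = 0"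
  by (simp_all add: p_def Xi_bounds)

lemma exp_bounds:
  assumes "x \<in> {0..1}" shows "1 \<le> exp (k * x)" "exp (k * x) \<le> exp k"
  using assms k_bounds(1) by (auto intro: mult_left_le)

lemma C0_pos: "0 < C0"
  using k_bounds(1) by (simp add: C0_def)

text \<open>The exponentials are at least 1, so the branches together have slope at least
  \<open>k Xi 1\<close>; the loss is the derivative of the switch.\<close>

lemma p'_lower: assumes x: "x \<in> {0..1}" shows "k * Xi 1 - C0 * xi x \<le> p' x"
proof -
  have x': "1 - x \<in> {0..1}" using x by auto
  note e = exp_bounds[OF x] exp_bounds[OF x']
  have "(Xi 1 - Xi x) * k \<le> (Xi 1 - Xi x) * (k * exp (k * x))" "Xi x * k \<le> Xi x * (k * exp (k * (1 - x)))"
    using e k_bounds(1) Xi_bounds(2,3)[of x] by (auto intro!: mult_left_mono)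
  moreover have "xi x * (exp (k * x) + exp (k * (1 - x)) - 2) \<le> xi x * C0"
  proof (rule mult_left_mono[OF _ xi_nonneg])
    show "exp (k * x) + exp (k * (1 - x)) - 2 \<le> C0" using e unfolding C0_def by linarith
  qed
  ultimately show ?thesis by (simp add: p'_def algebra_simps)
qed

text \<open>Because \<open>\<bar>a'\<bar> \<le> k a\<close>, the term in \<open>a'\<close> costs at
  most \<open>(exp (k x) - 1) k a\<close> on the first branch and leaves \<open>k a\<close>; the
  second branch is its mirror image. The rate \<open>k\<close> of the exponentials is chosen for
  this.\<close>

lemma pa_lower:
  "AE x in I01. k * Xi 1 * a x - C0 * xi x * a x \<le> p' x * a x - p x * a' x"
  using k_bounds(2) AE_space
proof eventually_elim
  case (elim x)
  then have x: "x \<in> {0..1}" and x': "1 - x \<in> {0..1}" by auto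
  note e = exp_bounds[OF x] exp_bounds[OF x']
  have ax: "0 < a x" using alo(1) alo(2)[OF x] by simp
  have "(exp (k * x) - 1) * a' x \<le> (exp (k * x) - 1) * (k * a x)"
    "(exp (k * (1 - x)) - 1) * (- a' x) \<le> (exp (k * (1 - x)) - 1) * (k * a x)"
    using e elim(1) by (intro mult_left_mono; simp add: abs_le_iff)+
  then have "k * a x \<le> k * exp (k * x) * a x - (exp (k * x) - 1) * a' x"
    "k * a x \<le> k * exp (k * (1 - x)) * a x + (exp (k * (1 - x)) - 1) * a' x"
    by (simp_all add: algebra_simps)
  then have "(Xi 1 - Xi x) * (k * a x) \<le> (Xi 1 - Xi x) * (k * exp (k * x) * a x - (exp (k * x) - 1) * a' x)"
    "Xi x * (k * a x) \<le> Xi x * (k * exp (k * (1 - x)) * a x + (exp (k * (1 - x)) - 1) * a' x)"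
    using Xi_bounds(2,3)[of x] by (auto intro!: mult_left_mono)
  moreover have "(xi x * a x) * (exp (k * x) + exp (k * (1 - x)) - 2) \<le> (xi x * a x) * C0"
  proof (rule mult_left_mono)
    show "exp (k * x) + exp (k * (1 - x)) - 2 \<le> C0" using e unfolding C0_def by linarith
    show "0 \<le> xi x * a x" using xi_nonneg[of x] ax by simp
  qed
  moreover have "p' x * a x - p x * a' x = (Xi 1 - Xi x) * (k * exp (k * x) * a x - (exp (k * x) - 1) * a' x)
    + Xi x * (k * exp (k * (1 - x)) * a x + (exp (k * (1 - x)) - 1) * a' x)
    - (xi x * a x) * (exp (k * x) + exp (k * (1 - x)) - 2)"
    by (simp add: p'_def p_def algebra_simps)
  ultimately show ?case by (simp add: algebra_simps)
qed

lemma th_pos: "0 < th"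
  using k_bounds(1) Xi_bounds(4) by (simp add: th_def)

lemma g_ac: "ac g g'"
proof -
  have "ac (\<lambda>x. th + (C0 / 2) *\<^sub>R xi x) (\<lambda>x. 0 + (C0 / 2) *\<^sub>R xi' x)"
    by (intro ac_add ac_const ac_bounded_linear[OF bounded_linear_scaleR_right] xi_ac)
  then show ?thesis by (simp add: g_def[abs_def] g'_def[abs_def])
qed

lemma g_ends: "g 0 = th" "g 1 = th"
  by (simp_all add: g_def xi_ends)

lemma Linf_coeffs: "Linf a" "Linf a'" "Linf q" "Linf p" "Linf p'" "Linf g" "Linf g'" "Linf xi"
proof -
  show "Linf q"
    unfolding Linf_def using q by (auto intro!: exI[of _ Kq] elim!: AE_mp)
  show "Linf a'" unfolding Linf_def using a' by auto
  show "Linf g'" unfolding g'_def[abs_def] by (intro continuous_on_Linf continuous_intros xi_continuous)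
  show "Linf p'" by (intro continuous_on_Linf p'_continuous)
qed (use a p_ac g_ac xi_ac in \<open>auto intro: ac_Linf\<close>)

text \<open>
  This is \<open>th u(1) - \<integral>\<^sub>x\<^sup>1 g u\<^sub>x\<close> in terms of \<open>y = u\<^sub>x\<close> and \<open>e2 = u(1)\<close>. Its derivative is exactly
  \<open>g u\<^sub>x\<close>, so that no lower order term in \<open>u\<close> appears.
\<close>

definition multiplier :: "(real \<Rightarrow> complex) \<Rightarrow> complex \<Rightarrow> real \<Rightarrow> complex" where
  "multiplier y e2 x = th *\<^sub>R e2 - (prim (g \<odot> y) 1 - prim (g \<odot> y) x)"

lemma multiplier_ac: assumes "L2 y" shows "ac (multiplier y e2) (g \<odot> y)"
proof -
  have "L2 (g \<odot> y)" using assms by (intro weight_L2 Linf_coeffs)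
  from ac_prim[OF this, of "th *\<^sub>R e2 - prim (g \<odot> y) 1"] show ?thesis
    by (rule ac_cong) (simp add: multiplier_def)
qed

lemma multiplier_1: "multiplier y e2 1 = th *\<^sub>R e2"
  by (simp add: multiplier_def)

text \<open>Integrate \<open>g v'\<close> from \<open>x\<close> to 1 by parts. The boundary term at
  1 is \<open>th v(1)\<close> and cancels; besides \<open>g v\<close> only \<open>g'\<close>
  remains, which vanishes off the damped interval.\<close>

lemma multiplier_ac_deriv:
  assumes v: "ac v v'" and x: "x \<in> {0..1}"
  shows "multiplier v' (v 1) x = g x *\<^sub>R v x + (prim (g' \<odot> v) 1 - prim (g' \<odot> v) x)"
proof -
  have i: "integrable I01 (g' \<odot> v)" "integrable I01 (g \<odot> v')"
    by (intro L2_integrable weight_L2 Linf_coeffs ac_L2[OF v] ac_L2_self[OF v])+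
  have e: "g t *\<^sub>R v t = g 0 *\<^sub>R v 0 + (prim (g' \<odot> v) t + prim (g \<odot> v') t)" if "t \<in> {0..1}" for t
    using ac_eq_prim[OF ac_scaleR[OF g_ac v] that] prim_add[OF i] by simp
  have "th *\<^sub>R v 1 = g 0 *\<^sub>R v 0 + (prim (g' \<odot> v) 1 + prim (g \<odot> v') 1)"
    using e[of 1] by (simp add: g_ends)
  then show ?thesis unfolding multiplier_def using e[OF x] by (simp add: algebra_simps)
qed

text \<open>
  On \<open>(u\<^sub>x, u\<^sub>t, \<eta>\<^sub>1, \<eta>\<^sub>2, \<zeta>\<^sub>1)\<close>, \<open>eform\<close> is twice the energy, \<open>fform\<close> the perturbation by the two
  multipliers, and \<open>diss\<close> the dissipation.
\<close>

fun eform :: "state \<Rightarrow> state \<Rightarrow> real" where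
  "eform (y, v, e1, e2, z) (Y, V, E1, E2, Z) =
    ip (a \<odot> y) Y + ip v V + c1 * (e1 \<bullet> E1) + c1 * \<alpha>2 * (e2 \<bullet> E2) + c0 * (z \<bullet> Z)"

abbreviation esq :: "state \<Rightarrow> real" where "esq X \<equiv> eform X X"

fun fform :: "state \<Rightarrow> state \<Rightarrow> real" where
  "fform (y, v, e1, e2, z) (Y, V, E1, E2, Z) =
    ip (p \<odot> y) V + ip (multiplier y e2) V + c1 * th * (e2 \<bullet> E1) + c0 * (multiplier y e2 0 \<bullet> Z)"

fun diss :: "state \<Rightarrow> real" where
  "diss (y, v, e1, e2, z) = ip (q \<odot> v) v + c1 * \<alpha>1 * (norm e1)\<^sup>2 + c0 * \<gamma>1 * (norm z)\<^sup>2"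

text \<open>The reduced form of the generator, applied to a state with \<open>v(1) = \<eta>\<^sub>1\<close> and \<open>v(0) = \<zeta>\<^sub>1\<close>.\<close>

definition red_gen :: "(real \<Rightarrow> complex) \<Rightarrow> (real \<Rightarrow> complex) \<Rightarrow> (real \<Rightarrow> complex) \<Rightarrow> (real \<Rightarrow> complex) \<Rightarrow> complex \<Rightarrow> state" where
  "red_gen y y' v v' e2 = (v', (\<lambda>x. (a' x *\<^sub>R y x + a x *\<^sub>R y' x) - q x *\<^sub>R v x),
     - (\<alpha>1 *\<^sub>R v 1) - \<alpha>2 *\<^sub>R e2 - \<beta>1 *\<^sub>R y 1, v 1, - (\<gamma>1 *\<^sub>R v 0) + \<mu>1 *\<^sub>R y 0)"

text \<open>\<open>c1\<close> and \<open>c0\<close> are tuned so that the boundary terms of the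
  integration by parts cancel against the traces of \<open>y\<close> in the boundary equations. The
  weight \<open>c1 \<alpha>2\<close> cancels the coupling of \<open>e2\<close> with
  \<open>v 1\<close>.\<close>

lemma eform_red_gen:
  assumes y: "ac y y'" and v: "ac v v'"
  shows "eform (y, v, v 1, e2, v 0) (red_gen y y' v v' e2) = - diss (y, v, v 1, e2, v 0)"
proof -
  note L = ac_L2[OF y] ac_L2[OF v] ac_L2_self[OF y] ac_L2_self[OF v]
  define W where "W = ip (\<lambda>x. a' x *\<^sub>R y x + a x *\<^sub>R y' x) v"
  have "W + ip (a \<odot> y) v' = (a 1 *\<^sub>R y 1) \<bullet> v 1 - (a 0 *\<^sub>R y 0) \<bullet> v 0"
    unfolding W_def by (rule ip_by_parts[OF ac_scaleR[OF a y] v])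
  then have A: "ip (a \<odot> y) v' = a 1 * (y 1 \<bullet> v 1) - a 0 * (y 0 \<bullet> v 0) - W" by simp
  have B: "ip v (\<lambda>x. (a' x *\<^sub>R y x + a x *\<^sub>R y' x) - q x *\<^sub>R v x) = W - ip (q \<odot> v) v"
    unfolding W_def using L by (subst ip_diff_right) (auto intro!: L2_add weight_L2 Linf_coeffs simp: ip_commute)
  show ?thesis
    unfolding red_gen_def eform.simps diss.simps A B using pos
    by (simp add: inner_simps c1_def c0_def power2_norm_eq_inner inner_commute field_simps)
qed

text \<open>An exact identity whose right side is free of the traces \<open>y 0\<close> and
  \<open>y 1\<close>: those in \<open>s3\<close> cancel against the boundary terms of
  \<open>fform\<close>, since \<open>c1 \<beta>1 = a 1\<close> and \<open>c0 \<mu>1 = a 0\<close>.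
  The negative square of \<open>e2\<close> comes from the same boundary term at 1.\<close>

lemma fform_red_gen:
  assumes y: "ac y y'" and v: "ac v v'"
  defines "G \<equiv> \<lambda>x. prim (g' \<odot> v) 1 - prim (g' \<odot> v) x"
  shows "fform (y, v, v 1, e2, v 0) (red_gen y y' v v' e2) + fform (red_gen y y' v v' e2) (y, v, v 1, e2, v 0)
    = ip (\<lambda>x. (g x - p' x / 2) *\<^sub>R v x) v
      - ip (\<lambda>x. ((p' x * a x - p x * a' x) / 2 + g x * a x) *\<^sub>R y x) y
      - c1 * th * \<alpha>2 * (norm e2)\<^sup>2 + c1 * th * (norm (v 1))\<^sup>2 + c0 * th * (norm (v 0))\<^sup>2
      - ip (p \<odot> y) (q \<odot> v) - ip (multiplier y e2) (q \<odot> v) + ip G v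
      - c1 * th * \<alpha>1 * (e2 \<bullet> v 1) - c0 * \<gamma>1 * (multiplier y e2 0 \<bullet> v 0) + c0 * (G 0 \<bullet> v 0)"
proof -
  note L = ac_L2[OF y] ac_L2[OF v] ac_L2_self[OF y] ac_L2_self[OF v]
  let ?w' = "\<lambda>x. a' x *\<^sub>R y x + a x *\<^sub>R y' x"
  let ?m = "multiplier y e2"
  have w: "ac (a \<odot> y) ?w'" by (rule ac_scaleR[OF a y])
  have m: "ac ?m (g \<odot> y)" by (rule multiplier_ac[OF L(3)])
  note L' = ac_L2[OF w] ac_L2_self[OF m]
  have qv: "L2 (q \<odot> v)" by (intro weight_L2 Linf_coeffs L)
  have LG: "L2 G" unfolding G_def
    by (intro L2_diff L2_const Linf_imp_L2 continuous_on_Linf continuous_prim L2_integrable weight_L2 Linf_coeffs L)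
  \<comment> \<open>\<open>v\<close> paired with \<open>v'\<close> is half the derivative of the
    square, and \<open>p\<close> vanishes at the ends. The same idea, with \<open>a y\<close> in
    place of one factor, gives \<open>s2\<close>.\<close>
  have s1: "ip (p \<odot> v') v = - ip (p' \<odot> v) v / 2"
  proof -
    have "ip (\<lambda>x. p' x *\<^sub>R v x + p x *\<^sub>R v' x) v + ip (p \<odot> v) v' = 0"
      using ip_by_parts[OF ac_scaleR[OF p_ac v] v] by (simp add: p_ends)
    moreover have "ip (p \<odot> v) v' = ip (p \<odot> v') v"
      unfolding ip_def by (rule Bochner_Integration.integral_cong) (auto simp: inner_commute)
    ultimately show ?thesis
      using L by (simp add: ip_add_left weight_L2 Linf_coeffs)
  qed
  have s2: "ip (p \<odot> y) ?w' = (ip (p \<odot> y) (a' \<odot> y) - ip (p' \<odot> y) (a \<odot> y)) / 2"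
  proof -
    have "ip (\<lambda>x. p' x *\<^sub>R y x + p x *\<^sub>R y' x) (a \<odot> y) + ip (p \<odot> y) ?w' = 0"
      using ip_by_parts[OF ac_scaleR[OF p_ac y] w] by (simp add: p_ends)
    moreover have "ip (p \<odot> y') (a \<odot> y) = ip (p \<odot> y) (a \<odot> y')"
      unfolding ip_def by (rule Bochner_Integration.integral_cong) (auto simp: inner_commute)
    ultimately show ?thesis
      using L by (simp add: ip_add_left ip_add_right weight_L2 Linf_coeffs)
  qed
  have s3: "ip ?m ?w' = th * a 1 * (e2 \<bullet> y 1) - a 0 * (?m 0 \<bullet> y 0) - ip (g \<odot> y) (a \<odot> y)"
    using ip_by_parts[OF m w] by (simp add: multiplier_1 algebra_simps)
  have s4: "ip (multiplier v' (v 1)) v = ip (g \<odot> v) v + ip G v"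
  proof -
    have "ip (multiplier v' (v 1)) v = ip (\<lambda>x. g x *\<^sub>R v x + G x) v"
      unfolding ip_def by (rule Bochner_Integration.integral_cong) (auto simp: multiplier_ac_deriv[OF v] G_def)
    then show ?thesis using L LG by (simp add: ip_add_left weight_L2 Linf_coeffs)
  qed
  have s5: "multiplier v' (v 1) 0 = th *\<^sub>R v 0 + G 0"
    using multiplier_ac_deriv[OF v, of 0] by (simp add: G_def g_ends)
  have s6: "ip (\<lambda>x. ((p' x * a x - p x * a' x) / 2 + g x * a x) *\<^sub>R y x) y
    = (ip (p' \<odot> y) (a \<odot> y) - ip (p \<odot> y) (a' \<odot> y)) / 2
      + ip (g \<odot> y) (a \<odot> y)"
  proof -
    have "ip (\<lambda>x. ((p' x * a x - p x * a' x) / 2 + g x * a x) *\<^sub>R y x) y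
      = ip (\<lambda>x. (1/2) *\<^sub>R ((p' x * a x) *\<^sub>R y x) - (1/2) *\<^sub>R ((p x * a' x) *\<^sub>R y x) + (g x * a x) *\<^sub>R y x) y"
      by (rule arg_cong2[where f=ip]) (auto simp: fun_eq_iff scaleR_add_left scaleR_diff_left diff_divide_distrib)
    also have "\<dots> = (1/2) * ip (\<lambda>x. (p' x * a x) *\<^sub>R y x) y - (1/2) * ip (\<lambda>x. (p x * a' x) *\<^sub>R y x) y
        + ip (\<lambda>x. (g x * a x) *\<^sub>R y x) y"
      using L by (simp add: ip_add_left ip_diff_left ip_scaleR_left L2_diff L2_scaleR weight_L2 Linf_mult Linf_coeffs del: scaleR_scaleR)
    finally have e: "ip (\<lambda>x. ((p' x * a x - p x * a' x) / 2 + g x * a x) *\<^sub>R y x) y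
      = (1/2) * ip (\<lambda>x. (p' x * a x) *\<^sub>R y x) y - (1/2) * ip (\<lambda>x. (p x * a' x) *\<^sub>R y x) y
        + ip (\<lambda>x. (g x * a x) *\<^sub>R y x) y" .
    have w: "ip (\<lambda>x. (p' x * a x) *\<^sub>R y x) y = ip (p' \<odot> y) (a \<odot> y)"
      "ip (\<lambda>x. (p x * a' x) *\<^sub>R y x) y = ip (p \<odot> y) (a' \<odot> y)"
      "ip (\<lambda>x. (g x * a x) *\<^sub>R y x) y = ip (g \<odot> y) (a \<odot> y)"
      unfolding ip_def by (intro Bochner_Integration.integral_cong; simp)+
    show ?thesis unfolding e w by (simp add: diff_divide_distrib)
  qed
  have s7: "ip (\<lambda>x. (g x - p' x / 2) *\<^sub>R v x) v = ip (g \<odot> v) v - ip (p' \<odot> v) v / 2"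
  proof -
    have "ip (\<lambda>x. (g x - p' x / 2) *\<^sub>R v x) v = ip (\<lambda>x. g x *\<^sub>R v x - (1/2) *\<^sub>R (p' x *\<^sub>R v x)) v"
      by (rule arg_cong2[where f=ip]) (auto simp: fun_eq_iff scaleR_diff_left)
    also have "\<dots> = ip (g \<odot> v) v - (1/2) * ip (p' \<odot> v) v"
      using L by (simp add: ip_diff_left ip_scaleR_left L2_scaleR weight_L2 Linf_coeffs del: scaleR_scaleR)
    finally show ?thesis by simp
  qed
  have t1: "ip (p \<odot> y) (\<lambda>x. ?w' x - q x *\<^sub>R v x)
      = ip (p \<odot> y) ?w' - ip (p \<odot> y) (q \<odot> v)"
    by (intro ip_diff_right L' qv weight_L2 Linf_coeffs L)
  have t2: "ip ?m (\<lambda>x. ?w' x - q x *\<^sub>R v x) = ip ?m ?w' - ip ?m (q \<odot> v)"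
    by (intro ip_diff_right L' qv)
  show ?thesis
    unfolding red_gen_def fform.simps t1 t2 s1 s2 s3 s4 s5 s6 s7
    using pos by (simp add: inner_simps c1_def c0_def power2_norm_eq_inner inner_commute field_simps)
qed


section \<open>Bounds by energy and dissipation, and the choice of the Lyapunov form\<close>

lemma a_weight: "L2 (y :: real \<Rightarrow> complex) \<Longrightarrow> alo * ip y y \<le> ip (a \<odot> y) y"
  using ip_weight_mono[of y "\<lambda>x. alo" a, OF _ _ Linf_coeffs(1) AE_I2] alo
  by (simp add: ip_scaleR_left)

lemma q_weight: "L2 (v :: real \<Rightarrow> complex) \<Longrightarrow> 0 \<le> ip (q \<odot> v) v"
  using ip_weight_mono[of v "\<lambda>x. 0" q] Linf_coeffs q by (auto simp: ip_def)

lemma eform_bounds: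
  fixes y v :: "real \<Rightarrow> complex" and e1 e2 z :: complex
  assumes y: "L2 y" and v: "L2 v"
  defines "E \<equiv> esq (y, v, e1, e2, z)"
  shows "L2_norm y \<le> 1 / sqrt alo * sqrt E" "L2_norm v \<le> sqrt E" "norm e1 \<le> 1 / sqrt c1 * sqrt E"
    "norm e2 \<le> 1 / sqrt (c1 * \<alpha>2) * sqrt E" "norm z \<le> 1 / sqrt c0 * sqrt E" "0 \<le> E"
proof -
  note a_weight[OF y] ip_self_nonneg[of v] c_pos pos
  have nn: "0 \<le> alo * ip y y" "0 \<le> ip v v" "0 \<le> c1 * (norm e1)\<^sup>2" "0 \<le> c1 * \<alpha>2 * (norm e2)\<^sup>2" "0 \<le> c0 * (norm z)\<^sup>2"
    using alo c_pos pos by (auto simp: ip_self_nonneg)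
  have E: "alo * ip y y + ip v v + c1 * (norm e1)\<^sup>2 + c1 * \<alpha>2 * (norm e2)\<^sup>2 + c0 * (norm z)\<^sup>2 \<le> E"
    using a_weight[OF y] by (simp add: E_def power2_norm_eq_inner)
  show "0 \<le> E" using E nn by linarith
  show "L2_norm y \<le> 1 / sqrt alo * sqrt E"
    by (rule le_sqrt_mult) (use alo E nn in \<open>simp_all add: L2_norm_nonneg L2_norm_power2\<close>)
  have "L2_norm v \<le> 1 / sqrt 1 * sqrt E"
    by (rule le_sqrt_mult) (use E nn in \<open>simp_all add: L2_norm_nonneg L2_norm_power2\<close>)
  then show "L2_norm v \<le> sqrt E" by simp
  show "norm e1 \<le> 1 / sqrt c1 * sqrt E" "norm e2 \<le> 1 / sqrt (c1 * \<alpha>2) * sqrt E" "norm z \<le> 1 / sqrt c0 * sqrt E"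
    by (rule le_sqrt_mult; (use c_pos pos in \<open>simp; fail\<close>)?; use E nn in linarith)+
qed

lemma damped_weight:
  assumes "Linf w" "0 \<le> K" "AE x in I01. w x \<le> K * q x" and v: "L2 (v :: real \<Rightarrow> complex)"
  shows "ip (w \<odot> v) v \<le> K * ip (q \<odot> v) v"
proof -
  have "Linf (\<lambda>x. K * q x)" by (intro Linf_mult Linf_const Linf_coeffs)
  then have "ip (w \<odot> v) v \<le> ip (\<lambda>x. (K * q x) *\<^sub>R v x) v"
    by (intro ip_weight_mono assms)
  also have "\<dots> = K * ip (q \<odot> v) v"
    using ip_scaleR_left[of K "\<lambda>x. q x *\<^sub>R v x" v] by simp
  finally show ?thesis .
qed

lemma damped_L2_norm:
  assumes w: "Linf w" "0 \<le> K" "AE x in I01. (w x)\<^sup>2 \<le> K * q x" and v: "L2 (v :: real \<Rightarrow> complex)"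
  shows "L2_norm (w \<odot> v) \<le> sqrt K * sqrt (ip (q \<odot> v) v)"
proof -
  have "Linf (\<lambda>x. (w x)\<^sup>2)" unfolding power2_eq_square by (intro Linf_mult w)
  from damped_weight[OF this w(2,3) v]
  have "ip (\<lambda>x. (w x)\<^sup>2 *\<^sub>R v x) v \<le> K * ip (q \<odot> v) v" .
  moreover have "ip (\<lambda>x. (w x)\<^sup>2 *\<^sub>R v x) v = ip (w \<odot> v) (w \<odot> v)"
    by (simp add: ip_def power2_eq_square mult.assoc)
  ultimately show ?thesis
    unfolding L2_norm_ip real_sqrt_mult[symmetric] by simp
qed

text \<open>Between \<open>c\<close> and \<open>d\<close> the damping is at least
  \<open>qlo\<close>; elsewhere \<open>w\<close> vanishes and \<open>q\<close> is nonnegative.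
  Applied to \<open>xi\<close> and to the square of \<open>g'\<close>.\<close>

lemma support_weight:
  assumes c: "continuous_on {0..1} w" and out: "\<And>x. x \<notin> {c<..<d} \<Longrightarrow> w x = 0"
  obtains K where "0 \<le> K" "AE x in I01. w x \<le> K * q x"
proof -
  obtain B where B: "\<forall>x\<in>{0..1}. \<bar>w x\<bar> \<le> B"
    using compact_imp_bounded[OF compact_continuous_image[OF c]] by (auto simp: bounded_iff)
  then have B0: "0 \<le> B" using abs_ge_zero order_trans by (metis atLeastAtMost_iff order_refl zero_le_one)
  show thesis
  proof (rule that[of "B / qlo"])
    show "AE x in I01. w x \<le> B / qlo * q x"
      using qlo(2) q(2) AE_space
    proof eventually_elim
      case (elim x)
      show ?case
      proof (cases "x \<in> {c<..<d}")
        case True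
        have "x \<in> {0..1}" using elim by auto
        then have "w x \<le> B" using B abs_le_D1 by blast
        also have "\<dots> = B / qlo * qlo" using qlo by simp
        also have "\<dots> \<le> B / qlo * q x" using True elim qlo B0 by (intro mult_left_mono) auto
        finally show ?thesis .
      next
        case False
        then show ?thesis using out elim B0 qlo(1) by simp
      qed
    qed
  qed (use B0 qlo in simp)
qed

lemma weight_bound:
  assumes "Linf w" "L2 y" "L2 v"
  shows "L2_norm (w \<odot> y) \<le> Lsup w * (1 / sqrt alo) * sqrt (esq (y, v, e1, e2, z))"
  using L2_norm_weight[OF assms(1,2)]
    mult_left_mono[OF eform_bounds(1)[OF assms(2,3), where ?e1.0=e1 and ?e2.0=e2 and ?z=z] Lsup(1)[OF assms(1)]]
  by (simp only: mult.assoc)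

text \<open>Bounds the multiplier pointwise by the root of the energy; the factor 2 accounts for the
  primitives at 1 and at \<open>x\<close>.\<close>

definition "Cm = th * (1 / sqrt (c1 * \<alpha>2)) + 2 * (Lsup g * (1 / sqrt alo))"

lemma Cm_nonneg: "0 \<le> Cm"
  using th_pos Lsup(1)[OF Linf_coeffs(6)] alo c_pos pos by (simp add: Cm_def)

lemma multiplier_bound:
  assumes y: "L2 y" and v: "L2 v"
  shows "norm (multiplier y e2 x) \<le> Cm * sqrt (esq (y, v, e1, e2, z))"
proof -
  note b = eform_bounds[OF y v, where ?e1.0=e1 and ?e2.0=e2 and ?z=z]
  have pr: "norm (prim (g \<odot> y) x) \<le> Lsup g * (1 / sqrt alo) * sqrt (esq (y, v, e1, e2, z))" for x
    using norm_prim_le_L2_norm[OF weight_L2[OF Linf_coeffs(6) y], of x]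
      weight_bound[OF Linf_coeffs(6) y v, of e1 e2 z] by linarith
  have "norm (multiplier y e2 x) \<le> norm (th *\<^sub>R e2) + (norm (prim (g \<odot> y) 1) + norm (prim (g \<odot> y) x))"
    unfolding multiplier_def by (intro norm_triangle_le_diff add_left_mono norm_triangle_ineq4)
  then show ?thesis
    using mult_left_mono[OF b(4) less_imp_le[OF th_pos]] pr[of 1] pr[of x]
    by (simp only: Cm_def norm_scaleR abs_of_pos[OF th_pos] distrib_right mult.assoc)
qed

definition "Cf = Lsup p * (1 / sqrt alo) * 1 + Cm * 1 + c1 * th * (1 / sqrt (c1 * \<alpha>2) * (1 / sqrt c1)) + c0 * (Cm * (1 / sqrt c0))"

lemma Cf_nonneg: "0 \<le> Cf"
  unfolding Cf_def using Lsup(1)[OF Linf_coeffs(4)] Cm_nonneg th_pos alo c_pos pos by simp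

text \<open>Ensures that a small multiple of the perturbation leaves the form equivalent to the
  energy.\<close>

lemma fform_bound:
  assumes y: "L2 y" and v: "L2 v" and Y: "L2 Y" and V: "L2 V"
  shows "\<bar>fform (y, v, e1, e2, z) (Y, V, E1, E2, Z)\<bar>
    \<le> Cf * (sqrt (esq (y, v, e1, e2, z)) * sqrt (esq (Y, V, E1, E2, Z)))"
proof -
  define s where "s = sqrt (esq (y, v, e1, e2, z))"
  define S where "S = sqrt (esq (Y, V, E1, E2, Z))"
  note b = eform_bounds[OF y v, where ?e1.0=e1 and ?e2.0=e2 and ?z=z, folded s_def]
  note bb = eform_bounds[OF Y V, where ?e1.0=E1 and ?e2.0=E2 and ?z=Z, folded S_def]
  have m: "norm (multiplier y e2 x) \<le> Cm * s" for x unfolding s_def by (rule multiplier_bound[OF y v])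
  have mL: "L2 (multiplier y e2)" by (rule ac_L2_self[OF multiplier_ac[OF y]])
  have mN: "L2_norm (multiplier y e2) \<le> Cm * s"
    using m[of 0] order_trans[OF norm_ge_zero m[of 0]] by (intro L2_norm_le_sup[OF mL]) (auto intro: m)
  have V1: "L2_norm V \<le> 1 * S" using bb(2) by simp
  have 1: "\<bar>ip (p \<odot> y) V\<bar> \<le> Lsup p * (1 / sqrt alo) * 1 * (s * S)"
    by (rule ip_bound[OF weight_L2[OF Linf_coeffs(4) y] V weight_bound[OF Linf_coeffs(4) y v, of e1 e2 z, folded s_def] V1])
  have 2: "\<bar>ip (multiplier y e2) V\<bar> \<le> Cm * 1 * (s * S)" by (rule ip_bound[OF mL V mN V1])
  have 3: "\<bar>c1 * th * (e2 \<bullet> E1)\<bar> \<le> c1 * th * (1 / sqrt (c1 * \<alpha>2) * (1 / sqrt c1)) * (s * S)"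
    by (rule inner_bound[OF b(4) bb(3)]) (use c_pos th_pos in simp)
  have 4: "\<bar>c0 * (multiplier y e2 0 \<bullet> Z)\<bar> \<le> c0 * (Cm * (1 / sqrt c0)) * (s * S)"
    by (rule inner_bound[OF m bb(5)]) (use c_pos in simp)
  have "\<bar>fform (y, v, e1, e2, z) (Y, V, E1, E2, Z)\<bar>
      \<le> \<bar>ip (p \<odot> y) V\<bar> + \<bar>ip (multiplier y e2) V\<bar> + \<bar>c1 * th * (e2 \<bullet> E1)\<bar> + \<bar>c0 * (multiplier y e2 0 \<bullet> Z)\<bar>" by simp
  also have "\<dots> \<le> Cf * (s * S)"
    unfolding Cf_def distrib_right using 1 2 3 4 by (intro add_mono)
  finally show ?thesis by (simp add: s_def S_def)
qed

text \<open>The weights turn the identity \<open>fform_red_gen\<close> into \<open>- th\<close>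
  times the energy plus terms with damped factors. One damped factor leads to the mixed term, two
  lead to a multiple of \<open>diss\<close>.\<close>

lemma fform_red_gen_le:
  obtains C where "0 \<le> C" "\<And>y y' v v' e2. ac y y' \<Longrightarrow> ac v v' \<Longrightarrow>
    fform (y, v, v 1, e2, v 0) (red_gen y y' v v' e2) + fform (red_gen y y' v v' e2) (y, v, v 1, e2, v 0)
      \<le> - th * esq (y, v, v 1, e2, v 0) + C * diss (y, v, v 1, e2, v 0)
        + C * (sqrt (esq (y, v, v 1, e2, v 0)) * sqrt (diss (y, v, v 1, e2, v 0)))"
proof -
  obtain Kx where Kx: "0 \<le> Kx" "AE x in I01. xi x \<le> Kx * q x"
    using support_weight[OF xi_continuous(1) xi_out(1)] by blast
  have g2: "continuous_on {0..1} (\<lambda>x. (g' x)\<^sup>2)"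
    unfolding g'_def[abs_def] by (intro continuous_intros xi_continuous)
  obtain Kg where Kg: "0 \<le> Kg" "AE x in I01. (g' x)\<^sup>2 \<le> Kg * q x"
    by (rule support_weight[OF g2]) (auto simp: g'_def xi_out(2))
  define Q where "Q = sqrt (max Kq 0)"
  have q2: "AE x in I01. (q x)\<^sup>2 \<le> max Kq 0 * q x"
    using q(2,3) by eventually_elim (auto simp: power2_eq_square intro: mult_right_mono)
  define K1 where "K1 = 1 / sqrt (c1 * \<alpha>1)"
  define K0 where "K0 = 1 / sqrt (c0 * \<gamma>1)"
  have Kpos: "0 \<le> K1" "0 \<le> K0" "0 \<le> Q" using c_pos pos by (auto simp: K1_def K0_def Q_def)
  \<comment> \<open>\<open>Ca\<close> adds up \<open>r1\<close> to \<open>r5\<close>, with one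
    damped factor each, and \<open>Cb\<close> adds up \<open>r6\<close> to \<open>r9\<close>, with
    two.\<close>
  define Ca where "Ca = (Lsup p * (1 / sqrt alo)) * Q + Cm * Q + 2 * sqrt Kg * 1 + c1 * th * \<alpha>1 * ((1 / sqrt (c1 * \<alpha>2)) * K1)
    + c0 * \<gamma>1 * (Cm * K0)"
  define Cb where "Cb = 2 * c1 * th * K1\<^sup>2 + 2 * c0 * th * K0\<^sup>2 + C0 * Kx + c0 * ((2 * sqrt Kg) * K0)"
  have nn: "0 \<le> Ca" "0 \<le> Cb"
    unfolding Ca_def Cb_def
    using Lsup(1)[OF Linf_coeffs(4)] Cm_nonneg Kpos Kg Kx c_pos pos th_pos C0_pos alo by auto
  show thesis
  proof (rule that[of "Ca + Cb"])
    show "0 \<le> Ca + Cb" using nn by simp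
    fix y y' v v' :: "real \<Rightarrow> complex" and e2
    assume y: "ac y y'" and v: "ac v v'"
    note L = ac_L2_self[OF y] ac_L2_self[OF v]
    define E where "E = esq (y, v, v 1, e2, v 0)"
    define D where "D = diss (y, v, v 1, e2, v 0)"
    define G where "G = (\<lambda>x. prim (g' \<odot> v) 1 - prim (g' \<odot> v) x)"
    define s where "s = sqrt E"
    define t where "t = sqrt D"
    note b = eform_bounds[OF L, where ?e1.0="v 1" and ?e2.0=e2 and ?z="v 0", folded E_def, folded s_def]
    have iq: "0 \<le> ip (q \<odot> v) v" by (rule q_weight[OF L(2)])
    have tr: "0 \<le> c1 * \<alpha>1 * (norm (v 1))\<^sup>2" "0 \<le> c0 * \<gamma>1 * (norm (v 0))\<^sup>2" using c_pos pos by auto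
    have De: "D = ip (q \<odot> v) v + c1 * \<alpha>1 * (norm (v 1))\<^sup>2 + c0 * \<gamma>1 * (norm (v 0))\<^sup>2"
      by (simp add: D_def)
    have D0: "0 \<le> D" using De iq tr by linarith
    have st: "0 \<le> s" "0 \<le> t" "t\<^sup>2 = D" using b(6) D0 by (auto simp: s_def t_def)
    have iqD: "ip (q \<odot> v) v \<le> D" using De tr by linarith
    have v1: "norm (v 1) \<le> K1 * t" and v0: "norm (v 0) \<le> K0 * t"
      unfolding K1_def K0_def t_def by (rule le_sqrt_mult; use De iq tr c_pos pos in simp)+
    have damped: "L2_norm (w \<odot> v) \<le> sqrt K * t"
      if "Linf w" "0 \<le> K" "AE x in I01. (w x)\<^sup>2 \<le> K * q x" for w K
    proof -
      have "L2_norm (w \<odot> v) \<le> sqrt K * sqrt (ip (q \<odot> v) v)" by (rule damped_L2_norm[OF that L(2)])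
      also have "\<dots> \<le> sqrt K * t" unfolding t_def using iqD that(2) by (intro mult_left_mono real_sqrt_le_mono) auto
      finally show ?thesis .
    qed
    have qv: "L2_norm (q \<odot> v) \<le> Q * t" unfolding Q_def by (rule damped[OF Linf_coeffs(3) _ q2]) simp
    have gv: "norm (prim (g' \<odot> v) x) \<le> sqrt Kg * t" for x
      using norm_prim_le_L2_norm[OF weight_L2[OF Linf_coeffs(7) L(2)], of x] damped[OF Linf_coeffs(7) Kg] by linarith
    have G: "norm (G x) \<le> 2 * sqrt Kg * t" for x
      unfolding G_def using norm_triangle_ineq4[of "prim (g' \<odot> v) 1" "prim (g' \<odot> v) x"] gv[of 1] gv[of x] by linarith
    have qvL: "L2 (q \<odot> v)" and py: "L2 (p \<odot> y)" by (intro weight_L2 Linf_coeffs L)+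
    have GL: "L2 G" unfolding G_def
      by (intro L2_diff L2_const Linf_imp_L2 continuous_on_Linf continuous_prim L2_integrable weight_L2 Linf_coeffs L)
    have mL: "L2 (multiplier y e2)" by (rule ac_L2_self[OF multiplier_ac[OF L(1)]])
    have m: "norm (multiplier y e2 x) \<le> Cm * s" for x unfolding s_def E_def by (rule multiplier_bound[OF L])
    have mN: "L2_norm (multiplier y e2) \<le> Cm * s" and GN: "L2_norm G \<le> 2 * sqrt Kg * t"
      using st Cm_nonneg Kg(1) by (intro L2_norm_le_sup mL GL; simp add: m G)+
    have vN: "L2_norm v \<le> 1 * s" using b(2) by simp
    have r1: "\<bar>ip (p \<odot> y) (q \<odot> v)\<bar> \<le> (Lsup p * (1 / sqrt alo)) * Q * (s * t)"
      by (rule ip_bound[OF py qvL weight_bound[OF Linf_coeffs(4) L, of "v 1" e2 "v 0", folded E_def, folded s_def] qv])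
    have r2: "\<bar>ip (multiplier y e2) (q \<odot> v)\<bar> \<le> Cm * Q * (s * t)" by (rule ip_bound[OF mL qvL mN qv])
    have r3: "\<bar>ip G v\<bar> \<le> 2 * sqrt Kg * 1 * (s * t)"
      using ip_bound[OF GL L(2) GN vN] by (simp add: mult.commute)
    have r4: "\<bar>c1 * th * \<alpha>1 * (e2 \<bullet> v 1)\<bar> \<le> c1 * th * \<alpha>1 * ((1 / sqrt (c1 * \<alpha>2)) * K1) * (s * t)"
      by (rule inner_bound[OF b(4) v1]) (use c_pos pos th_pos in simp)
    have r5: "\<bar>c0 * \<gamma>1 * (multiplier y e2 0 \<bullet> v 0)\<bar> \<le> c0 * \<gamma>1 * (Cm * K0) * (s * t)"
      by (rule inner_bound[OF m v0]) (use c_pos pos in simp)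
    have "\<bar>c0 * (G 0 \<bullet> v 0)\<bar> \<le> c0 * ((2 * sqrt Kg) * K0) * (t * t)"
      by (rule inner_bound[OF G v0]) (use c_pos in simp)
    then have r6: "\<bar>c0 * (G 0 \<bullet> v 0)\<bar> \<le> c0 * ((2 * sqrt Kg) * K0) * D"
      by (simp only: st(3)[symmetric] power2_eq_square)
    \<comment> \<open>Twice, because the trace term stands once in the identity and once more in the
      energy that is completed to \<open>th * E\<close>; \<open>r8\<close> is analogous.\<close>
    have r7: "2 * (c1 * th * (norm (v 1))\<^sup>2) \<le> 2 * c1 * th * K1\<^sup>2 * D"
      using power_mono[OF v1 norm_ge_zero, of 2] c_pos th_pos
      by (simp add: power_mult_distrib st(3) mult.assoc)
    have r8: "2 * (c0 * th * (norm (v 0))\<^sup>2) \<le> 2 * c0 * th * K0\<^sup>2 * D"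
      using power_mono[OF v0 norm_ge_zero, of 2] c_pos th_pos
      by (simp add: power_mult_distrib st(3) mult.assoc)
    have r9: "C0 * ip (xi \<odot> v) v \<le> C0 * Kx * D"
      using damped_weight[OF Linf_coeffs(8) Kx L(2)] mult_left_mono[OF iqD Kx(1)] C0_pos by simp
    have Lc: "Linf (\<lambda>x. g x - p' x / 2)" "Linf (\<lambda>x. C0 * xi x - th)" "Linf (\<lambda>x. th * a x)"
      by (intro continuous_on_Linf continuous_intros p'_continuous xi_continuous ac_continuous[OF g_ac] ac_continuous[OF a]; simp)+
    \<comment> \<open>Kinetic part: the coefficient exceeds \<open>- th\<close> by at most
      \<open>C0 xi\<close>, which the damping absorbs.\<close>
    have Q1: "ip (\<lambda>x. (g x - p' x / 2) *\<^sub>R v x) v \<le> C0 * ip (xi \<odot> v) v - th * ip v v"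
    proof -
      have "AE x in I01. g x - p' x / 2 \<le> C0 * xi x - th"
      proof (rule AE_I2)
        fix x assume "x \<in> space I01"
        then have "k * Xi 1 - C0 * xi x \<le> p' x" by (intro p'_lower) auto
        then show "g x - p' x / 2 \<le> C0 * xi x - th" by (simp add: g_def th_def)
      qed
      then have "ip (\<lambda>x. (g x - p' x / 2) *\<^sub>R v x) v \<le> ip (\<lambda>x. (C0 * xi x - th) *\<^sub>R v x) v"
        by (intro ip_weight_mono L Lc)
      also have "\<dots> = ip (\<lambda>x. C0 *\<^sub>R (xi x *\<^sub>R v x) - th *\<^sub>R v x) v"
        by (simp add: scaleR_diff_left)
      also have "\<dots> = C0 * ip (xi \<odot> v) v - th * ip v v"
        by (subst ip_diff_left) (intro L2_scaleR weight_L2 Linf_coeffs L | simp only: ip_scaleR_left)+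
      finally show ?thesis .
    qed
    \<comment> \<open>Potential part: the share \<open>C0 xi / 2\<close> of \<open>g\<close> offsets
      half of the loss in \<open>pa_lower\<close>, the half that enters here.\<close>
    have Q2: "th * ip (a \<odot> y) y \<le> ip (\<lambda>x. ((p' x * a x - p x * a' x) / 2 + g x * a x) *\<^sub>R y x) y"
    proof -
      have Linf2: "Linf (\<lambda>x. (p' x * a x - p x * a' x) / 2 + g x * a x)"
      proof -
        have "AE x in I01. norm ((p' x * a x - p x * a' x) / 2 + g x * a x)
          \<le> (Lsup (\<lambda>x. p' x * a x) + Lsup (\<lambda>x. p x * a' x)) / 2 + Lsup (\<lambda>x. g x * a x)"
          using Lsup(2)[OF Linf_mult[OF Linf_coeffs(5,1)]] Lsup(2)[OF Linf_mult[OF Linf_coeffs(4,2)]]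
            Lsup(2)[OF Linf_mult[OF Linf_coeffs(6,1)]]
          by eventually_elim (unfold real_norm_def abs_le_iff, elim conjE, intro conjI; argo)
        then show ?thesis using Linf_coeffs unfolding Linf_def
          by (intro conjI borel_measurable_add borel_measurable_divide borel_measurable_diff borel_measurable_times
              borel_measurable_const exI) auto
      qed
      have "AE x in I01. th * a x \<le> (p' x * a x - p x * a' x) / 2 + g x * a x"
        using pa_lower AE_space
      proof eventually_elim
        case (elim x)
        then have "0 < a x" using alo(2)[of x] alo(1) by auto
        define X where "X = th * a x"
        define Y where "Y = C0 * xi x * a x"
        define W where "W = p' x * a x - p x * a' x"
        have "0 \<le> X" using \<open>0 < a x\<close> th_pos by (simp add: X_def)
        moreover have "g x * a x = X + Y / 2" by (simp add: X_def Y_def g_def algebra_simps)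
        moreover have "4 * X - Y \<le> W" using elim(1) by (simp add: X_def Y_def W_def th_def)
        ultimately show ?case unfolding X_def[symmetric] W_def[symmetric] by linarith
      qed
      then have "ip (\<lambda>x. (th * a x) *\<^sub>R y x) y \<le> ip (\<lambda>x. ((p' x * a x - p x * a' x) / 2 + g x * a x) *\<^sub>R y x) y"
        by (intro ip_weight_mono L Lc Linf2)
      then show ?thesis using ip_scaleR_left[of th "\<lambda>x. a x *\<^sub>R y x" y] by simp
    qed
    have Ee: "E = ip (a \<odot> y) y + ip v v + c1 * (norm (v 1))\<^sup>2 + c1 * \<alpha>2 * (norm e2)\<^sup>2 + c0 * (norm (v 0))\<^sup>2"
      by (simp add: E_def power2_norm_eq_inner)
    have thE: "th * E = th * ip (a \<odot> y) y + th * ip v v + c1 * th * (norm (v 1))\<^sup>2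
        + c1 * th * \<alpha>2 * (norm e2)\<^sup>2 + c0 * th * (norm (v 0))\<^sup>2"
      by (simp add: Ee algebra_simps)
    have G0: "prim (g' \<odot> v) 1 - prim (g' \<odot> v) 0 = G 0" by (simp add: G_def)
    note FG = fform_red_gen[OF y v, of e2, folded G_def, unfolded G0]
    have F: "fform (y, v, v 1, e2, v 0) (red_gen y y' v v' e2) + fform (red_gen y y' v v' e2) (y, v, v 1, e2, v 0)
      \<le> - (th * E) + Ca * (s * t) + Cb * D"
      unfolding FG Ca_def Cb_def distrib_right[of _ _ "s * t"] distrib_right[of _ _ D]
      using abs_le_D2[OF r1] abs_le_D2[OF r2] abs_le_D1[OF r3] abs_le_D2[OF r4] abs_le_D2[OF r5]
        abs_le_D1[OF r6] r7 r8 r9 Q1 Q2 thE by linarith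
    have "Ca * (s * t) \<le> (Ca + Cb) * (s * t)" "Cb * D \<le> (Ca + Cb) * D"
      using nn st D0 by (intro mult_right_mono; simp)+
    with F show "fform (y, v, v 1, e2, v 0) (red_gen y y' v v' e2) + fform (red_gen y y' v v' e2) (y, v, v 1, e2, v 0)
      \<le> - th * esq (y, v, v 1, e2, v 0) + (Ca + Cb) * diss (y, v, v 1, e2, v 0)
        + (Ca + Cb) * (sqrt (esq (y, v, v 1, e2, v 0)) * sqrt (diss (y, v, v 1, e2, v 0)))"
      by (simp only: E_def[symmetric] D_def[symmetric] s_def[symmetric] t_def[symmetric])
  qed
qed

text \<open>\<open>fform\<close> is not symmetric, so both orders are added. On the diagonal the
  perturbation is \<open>2 r\<close> times \<open>fform\<close>.\<close>

definition bform :: "real \<Rightarrow> state \<Rightarrow> state \<Rightarrow> real" where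
  "bform r X Y = eform X Y + r * (fform X Y + fform Y X)"

text \<open>Young's inequality splits the mixed term into half of the gain in energy and a multiple
  of the dissipation. For small \<open>r\<close> the latter is paid for by the exact dissipation of
  \<open>eform\<close>.\<close>

lemma lyapunov:
  obtains r \<nu> where "0 < r" "0 < \<nu>"
    "\<And>y v e1 e2 z. L2 y \<Longrightarrow> L2 v \<Longrightarrow> esq (y, v, e1, e2, z) \<le> 2 * bform r (y, v, e1, e2, z) (y, v, e1, e2, z)"
    "\<And>y v e1 e2 z. L2 y \<Longrightarrow> L2 v \<Longrightarrow> bform r (y, v, e1, e2, z) (y, v, e1, e2, z) \<le> 2 * esq (y, v, e1, e2, z)"
    "\<And>y y' v v' e2. ac y y' \<Longrightarrow> ac v v' \<Longrightarrow> bform r (y, v, v 1, e2, v 0) (red_gen y y' v v' e2)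
      \<le> - \<nu> * bform r (y, v, v 1, e2, v 0) (y, v, v 1, e2, v 0)"
proof -
  obtain C where C: "0 \<le> C" "\<And>y y' v v' e2. ac y y' \<Longrightarrow> ac v v' \<Longrightarrow>
    fform (y, v, v 1, e2, v 0) (red_gen y y' v v' e2) + fform (red_gen y y' v v' e2) (y, v, v 1, e2, v 0)
      \<le> - th * esq (y, v, v 1, e2, v 0) + C * diss (y, v, v 1, e2, v 0)
        + C * (sqrt (esq (y, v, v 1, e2, v 0)) * sqrt (diss (y, v, v 1, e2, v 0)))"
    using fform_red_gen_le by blast
  define K where "K = C + C\<^sup>2 / (2 * th)"
  \<comment> \<open>Small enough for two purposes: \<open>4 r Cf \<le> 1\<close> keeps the
    perturbation below half the energy, and \<open>r K \<le> 1\<close> keeps the extra dissipation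
    below the one available.\<close>
  define r where "r = 1 / (4 * Cf + K + 1)"
  have K: "0 \<le> K" using C th_pos by (simp add: K_def)
  have r: "0 < r" "r * K \<le> 1" "r * (4 * Cf) \<le> 1"
    using K Cf_nonneg by (auto simp: r_def field_simps)
  have comp: "\<bar>r * (fform (y, v, e1, e2, z) (y, v, e1, e2, z) + fform (y, v, e1, e2, z) (y, v, e1, e2, z))\<bar>
      \<le> 1 / 2 * esq (y, v, e1, e2, z)" if "L2 y" "L2 v" for y v e1 e2 z
  proof -
    have E0: "0 \<le> esq (y, v, e1, e2, z)" by (rule eform_bounds(6)[OF that])
    have "\<bar>fform (y, v, e1, e2, z) (y, v, e1, e2, z)\<bar> \<le> Cf * esq (y, v, e1, e2, z)"
      using fform_bound[OF that that, of e1 e2 z e1 e2 z] E0 by (simp del: fform.simps eform.simps)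
    then have "(2 * r) * \<bar>fform (y, v, e1, e2, z) (y, v, e1, e2, z)\<bar> \<le> (2 * r) * (Cf * esq (y, v, e1, e2, z))"
      using r(1) by (intro mult_left_mono) auto
    also have "\<dots> = (r * (4 * Cf)) * (1/2 * esq (y, v, e1, e2, z))" by (simp del: eform.simps)
    also have "\<dots> \<le> 1 * (1/2 * esq (y, v, e1, e2, z))"
      using r(3) E0 by (intro mult_right_mono) auto
    finally show ?thesis using r(1) by (simp add: abs_mult del: fform.simps eform.simps)
  qed
  show thesis
  \<comment> \<open>The decrease is at least \<open>r th / 2\<close> times the energy, and the form
    is at most twice the energy.\<close>
  proof (rule that[of r "r * th / 4"])
    show "0 < r" "0 < r * th / 4" using r th_pos by auto
    fix y v :: "real \<Rightarrow> complex" and e1 e2 z assume L: "L2 y" "L2 v"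
    note c = comp[OF L, of e1 e2 z, unfolded abs_le_iff]
      eform_bounds(6)[OF L, where ?e1.0=e1 and ?e2.0=e2 and ?z=z]
    show "esq (y, v, e1, e2, z) \<le> 2 * bform r (y, v, e1, e2, z) (y, v, e1, e2, z)"
      unfolding bform_def using conjunct2[OF c(1)] c(2) by argo
    show "bform r (y, v, e1, e2, z) (y, v, e1, e2, z) \<le> 2 * esq (y, v, e1, e2, z)"
      unfolding bform_def using conjunct1[OF c(1)] c(2) by argo
  next
    fix y y' v v' :: "real \<Rightarrow> complex" and e2 assume y: "ac y y'" and v: "ac v v'"
    note L = ac_L2_self[OF y] ac_L2_self[OF v]
    define E where "E = esq (y, v, v 1, e2, v 0)"
    define D where "D = diss (y, v, v 1, e2, v 0)"
    have E0: "0 \<le> E" unfolding E_def by (rule eform_bounds(6)[OF L])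
    have D0: "0 \<le> D" using q_weight[OF L(2)] c_pos pos by (simp add: D_def)
    have b2: "bform r (y, v, v 1, e2, v 0) (y, v, v 1, e2, v 0) \<le> 2 * E"
      unfolding bform_def E_def using comp[OF L, of "v 1" e2 "v 0"] eform_bounds(6)[OF L, where ?e1.0="v 1" and ?e2.0=e2 and ?z="v 0"]
      unfolding abs_le_iff by argo
    have young: "C * (sqrt E * sqrt D) \<le> th / 2 * E + C\<^sup>2 / (2 * th) * D"
    proof -
      have "0 \<le> (th * sqrt E - C * sqrt D)\<^sup>2" by simp
      then have "2 * th * (C * (sqrt E * sqrt D)) \<le> th\<^sup>2 * E + C\<^sup>2 * D"
        using E0 D0 by (simp add: power2_diff power_mult_distrib algebra_simps)
      then show ?thesis using th_pos by (simp add: field_simps power2_eq_square)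
    qed
    have "fform (y, v, v 1, e2, v 0) (red_gen y y' v v' e2) + fform (red_gen y y' v v' e2) (y, v, v 1, e2, v 0)
      \<le> - (th / 2) * E + K * D"
      using C(2)[OF y v, of e2] young unfolding E_def[symmetric] D_def[symmetric] K_def by (simp add: algebra_simps)
    then have "r * (fform (y, v, v 1, e2, v 0) (red_gen y y' v v' e2) + fform (red_gen y y' v v' e2) (y, v, v 1, e2, v 0))
      \<le> r * (- (th / 2) * E + K * D)"
      using r(1) by (intro mult_left_mono) auto
    also have "\<dots> = - (r * th / 2) * E + (r * K) * D" by (simp add: algebra_simps)
    also have "\<dots> \<le> - (r * th / 2) * E + 1 * D" using r(2) D0 by (intro add_left_mono mult_right_mono)
    finally have "bform r (y, v, v 1, e2, v 0) (red_gen y y' v v' e2) \<le> - (r * th / 2) * E"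
      unfolding bform_def eform_red_gen[OF y v] D_def[symmetric] by linarith
    also have "\<dots> = - (r * th / 4) * (2 * E)" by simp
    also have "\<dots> \<le> - (r * th / 4) * bform r (y, v, v 1, e2, v 0) (y, v, v 1, e2, v 0)"
      using b2 r(1) th_pos by (intro mult_left_mono_neg) auto
    finally show "bform r (y, v, v 1, e2, v 0) (red_gen y y' v v' e2)
      \<le> - (r * th / 4) * bform r (y, v, v 1, e2, v 0) (y, v, v 1, e2, v 0)" .
  qed
qed

end

section \<open>Reduced states\<close>

definition L2_states :: "state set" where
  "L2_states = {(y, v, e1, e2, z). L2 y \<and> L2 v}"

text \<open>\<open>wderiv\<close> is a choice, so \<open>red\<close> respects sums and multiples
  only up to null sets.\<close>

fun AE_eq :: "state \<Rightarrow> state \<Rightarrow> bool" where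
  "AE_eq (y, v, e1, e2, z) (y', v', e1', e2', z') \<longleftrightarrow>
     (AE x in I01. y x = y' x) \<and> (AE x in I01. v x = v' x) \<and> e1 = e1' \<and> e2 = e2' \<and> z = z'"

text \<open>Since \<open>u\<close> is determined by \<open>u\<^sub>x\<close> and \<open>u(1)\<close>, the forms are evaluated on \<open>(u\<^sub>x, u\<^sub>t, \<eta>\<^sub>1, \<eta>\<^sub>2, \<zeta>\<^sub>1)\<close>.\<close>

fun red :: "state \<Rightarrow> state" where
  "red (u, v, e1, e2, z) = (wderiv u, v, e1, e2, z)"

lemma red_L2: "X \<in> state_space \<Longrightarrow> red X \<in> L2_states"
  by (auto simp: state_space_def L2_states_def H1_wderiv)

lemma plus_state:
  "(u, v, e1, e2, z) + (u', v', e1', e2', z') =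
    ((\<lambda>x. u x + u' x), (\<lambda>x. v x + v' x), e1 + e1', e2 + e2', z + (z' :: complex))"
  by (simp add: plus_fun_def)

lemma minus_state:
  "(u, v, e1, e2, z) - (u', v', e1', e2', z') =
    ((\<lambda>x. u x - u' x), (\<lambda>x. v x - v' x), e1 - e1', e2 - e2', z - (z' :: complex))"
  by (simp add: fun_diff_def)

lemma L2_states_plus: "X \<in> L2_states \<Longrightarrow> Y \<in> L2_states \<Longrightarrow> X + Y \<in> L2_states"
  by (auto simp: L2_states_def plus_fun_def L2_add)

lemma L2_states_scale: "X \<in> L2_states \<Longrightarrow> state_scale c X \<in> L2_states"
  by (auto simp: L2_states_def L2_mult)

lemma L2_states_minus: "X \<in> L2_states \<Longrightarrow> Y \<in> L2_states \<Longrightarrow> X - Y \<in> L2_states"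
  by (auto simp: L2_states_def fun_diff_def L2_diff)

lemma H1_mult:
  fixes u :: "real \<Rightarrow> complex"
  assumes "H1 u"
  shows "H1 (\<lambda>x. c * u x)" "AE x in I01. wderiv (\<lambda>x. c * u x) x = c * wderiv u x"
    "x \<in> {0..1} \<Longrightarrow> cont_rep (\<lambda>x. c * u x) x = c * cont_rep u x"
  using H1_bounded_linear[OF bounded_linear_mult_right assms] by auto

lemma H1_diff:
  fixes f g :: "real \<Rightarrow> complex"
  assumes f: "H1 f" and g: "H1 g"
  shows "H1 (\<lambda>x. f x - g x)" "AE x in I01. wderiv (\<lambda>x. f x - g x) x = wderiv f x - wderiv g x"
    "x \<in> {0..1} \<Longrightarrow> cont_rep (\<lambda>x. f x - g x) x = cont_rep f x - cont_rep g x"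
proof -
  note m = H1_mult[OF g, where c="-1"] and a = H1_add[OF f H1_mult(1)[OF g, of "-1"]]
  show "H1 (\<lambda>x. f x - g x)" using a(1) by simp
  show "AE x in I01. wderiv (\<lambda>x. f x - g x) x = wderiv f x - wderiv g x"
    using a(2) m(2) by eventually_elim simp
  show "cont_rep (\<lambda>x. f x - g x) x = cont_rep f x - cont_rep g x" if "x \<in> {0..1}"
    using a(3)[OF that] m(3)[OF that] by simp
qed

lemma state_space_plus:
  assumes "X \<in> state_space" "Y \<in> state_space"
  shows "X + Y \<in> state_space" "AE_eq (red (X + Y)) (red X + red Y)"
  using assms by (auto simp: state_space_def plus_fun_def L2_add H1_add)

lemma state_space_minus:
  assumes "X \<in> state_space" "Y \<in> state_space"
  shows "X - Y \<in> state_space" "AE_eq (red (X - Y)) (red X - red Y)"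
  using assms by (auto simp: state_space_def fun_diff_def L2_diff H1_diff)

lemma state_space_scale:
  assumes "X \<in> state_space"
  shows "state_scale c X \<in> state_space" "AE_eq (red (state_scale c X)) (state_scale c (red X))"
  using assms by (auto simp: state_space_def L2_mult H1_mult)

lemma H1_const: "H1 (\<lambda>x. c :: 'a::euclidean_space)" "AE x in I01. wderiv (\<lambda>x. c) x = 0"
  "x \<in> {0..1} \<Longrightarrow> cont_rep (\<lambda>x. c) x = c"
  using ac_H1[OF ac_const[of c], of "\<lambda>x. c"] by auto

lemma state_space_zero: "0 \<in> state_space"
  using H1_const(1)[of "0 :: complex"] H1_const(3)[of 1 "0 :: complex"] by (simp add: state_space_def zero_prod_def zero_fun_def)

text \<open>Undoes the reduction: the function with derivative \<open>y\<close> and value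
  \<open>e\<close> at 1.\<close>

definition antideriv :: "(real \<Rightarrow> complex) \<Rightarrow> complex \<Rightarrow> real \<Rightarrow> complex" where
  "antideriv y e x = e - prim y 1 + prim y x"

lemma antideriv:
  assumes "L2 y"
  shows "H1 (antideriv y e)" "AE x in I01. wderiv (antideriv y e) x = y x" "cont_rep (antideriv y e) 1 = e"
proof -
  have a: "ac (antideriv y e) y"
    using ac_prim[OF assms, of "e - prim y 1"] by (simp add: antideriv_def[abs_def])
  note * = ac_H1[OF a, of "antideriv y e"]
  show "H1 (antideriv y e)" "AE x in I01. wderiv (antideriv y e) x = y x" "cont_rep (antideriv y e) 1 = e"
    using *(1,2) *(3)[of 1] L2_measurable[OF ac_L2_self[OF a]] by (auto simp: antideriv_def)
qed

lemma convergent_if_geometric: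
  fixes f :: "nat \<Rightarrow> 'a::banach"
  assumes "\<And>k. norm (f (Suc k) - f k) \<le> C * (1/3) ^ k"
  obtains l where "f \<longlonglongrightarrow> l"
proof -
  have "summable (\<lambda>k. C * (1/3::real) ^ k)" by (intro summable_mult summable_geometric) simp
  then have "summable (\<lambda>k. f (Suc k) - f k)"
    by (rule summable_comparison_test'[of _ 0]) (use assms in auto)
  then have "(\<lambda>m. f m - f 0) \<longlonglongrightarrow> (\<Sum>k. f (Suc k) - f k)"
    using summable_LIMSEQ[of "\<lambda>k. f (Suc k) - f k"] by (simp add: sum_lessThan_telescope)
  from tendsto_add[OF this tendsto_const[of "f 0"]] show thesis by (intro that) simp
qed

section \<open>The forms on reduced states: linearity, norm equivalence, completeness and
  density\<close>

context damped_wave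
begin

lemma multiplier_add:
  assumes "L2 y" "L2 y'"
  shows "multiplier (\<lambda>x. y x + y' x) (e + e') x = multiplier y e x + multiplier y' e' x"
proof -
  have "integrable I01 (g \<odot> y)" "integrable I01 (g \<odot> y')"
    using assms by (auto intro!: L2_integrable weight_L2 Linf_coeffs)
  then show ?thesis by (simp add: multiplier_def scaleR_add_right prim_add)
qed

lemma multiplier_scale:
  assumes "L2 y"
  shows "multiplier (\<lambda>x. complex_of_real s * y x) (complex_of_real s * e) x = complex_of_real s * multiplier y e x"
proof -
  have "integrable I01 (g \<odot> y)"
    using assms by (auto intro!: L2_integrable weight_L2 Linf_coeffs)
  from prim_bounded_linear[OF bounded_linear_mult_right[of "complex_of_real s"] this]
  show ?thesis by (simp add: multiplier_def algebra_simps)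
qed

lemma multiplier_cong:
  assumes "L2 y" "L2 y'" "AE x in I01. y x = y' x" shows "multiplier y e = multiplier y' e"
proof -
  have "prim (g \<odot> y) x = prim (g \<odot> y') x" for x
    by (rule prim_cong_AE) (use assms in \<open>auto intro!: L2_measurable weight_L2 Linf_coeffs elim: AE_mp\<close>)
  then show ?thesis by (simp add: multiplier_def fun_eq_iff)
qed

lemma multiplier_L2: "L2 y \<Longrightarrow> L2 (multiplier y e)"
  by (rule ac_L2_self[OF multiplier_ac])

lemma eform_sym: "eform X Y = eform Y X"
proof -
  have "ip (a \<odot> y) y' = ip (a \<odot> y') y" for y y' :: "real \<Rightarrow> complex"
    by (simp add: ip_def inner_commute)
  then show ?thesis by (cases X; cases Y) (auto simp: ip_commute inner_commute)
qed

lemma bform_sym: "bform r X Y = bform r Y X"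
  by (simp add: bform_def eform_sym[of X])

lemma ip_of_real: "ip (\<lambda>x. complex_of_real s * f x) h = s * ip f h" "ip h (\<lambda>x. complex_of_real s * f x) = s * ip h f"
  using ip_scaleR_left[of s f h] ip_scaleR_right[of h s f] by (simp_all add: scaleR_conv_of_real)

lemma inner_of_real: "(complex_of_real s * w) \<bullet> w' = s * (w \<bullet> w')" "w' \<bullet> (complex_of_real s * w) = s * (w' \<bullet> w)"
  by (simp_all flip: scaleR_conv_of_real)

lemma bform_add:
  assumes X: "X \<in> L2_states" and Y: "Y \<in> L2_states" and Z: "Z \<in> L2_states"
  shows "bform r (X + Y) Z = bform r X Z + bform r Y Z"
proof -
  obtain y v e1 e2 z where X': "X = (y, v, e1, e2, z)" by (cases X)
  obtain y' v' e1' e2' z' where Y': "Y = (y', v', e1', e2', z')" by (cases Y)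
  obtain y'' v'' e1'' e2'' z'' where Z': "Z = (y'', v'', e1'', e2'', z'')" by (cases Z)
  have L: "L2 y" "L2 v" "L2 y'" "L2 v'" "L2 y''" "L2 v''"
    using X Y Z by (auto simp: X' Y' Z' L2_states_def)
  have [simp]: "multiplier (\<lambda>x. y x + y' x) (e2 + e2') = (\<lambda>x. multiplier y e2 x + multiplier y' e2' x)"
    by (rule ext) (rule multiplier_add[OF L(1,3)])
  show ?thesis
    unfolding bform_def X' Y' Z' plus_state eform.simps fform.simps
    using L by (simp add: ip_add_left ip_add_right scaleR_add_right multiplier_L2 weight_L2 Linf_coeffs inner_simps)
      (simp add: algebra_simps)
qed

lemma bform_scale:
  assumes X: "X \<in> L2_states" and Y: "Y \<in> L2_states"
  shows "bform r (state_scale (complex_of_real s) X) Y = s * bform r X Y"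
proof -
  obtain y v e1 e2 z where X': "X = (y, v, e1, e2, z)" by (cases X)
  obtain y' v' e1' e2' z' where Y': "Y = (y', v', e1', e2', z')" by (cases Y)
  have L: "L2 y" using X by (auto simp: X' L2_states_def)
  have [simp]: "multiplier (\<lambda>x. complex_of_real s * y x) (complex_of_real s * e2) = (\<lambda>x. complex_of_real s * multiplier y e2 x)"
    by (rule ext) (rule multiplier_scale[OF L])
  have [simp]: "k x *\<^sub>R (complex_of_real s * y x) = complex_of_real s * (k x *\<^sub>R y x)" for k :: "real \<Rightarrow> real" and x
    by simp
  show ?thesis
    unfolding bform_def X' Y' state_scale.simps eform.simps fform.simps
    by (simp add: ip_of_real inner_of_real del: mult_scaleR_right) (simp add: algebra_simps)
qed

lemma bform_cong1:
  assumes X: "X \<in> L2_states" and Y: "Y \<in> L2_states" and X': "X' \<in> L2_states" and eq: "AE_eq X X'"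
  shows "bform r X Y = bform r X' Y"
proof -
  obtain y v e1 e2 z where Xe: "X = (y, v, e1, e2, z)" by (cases X)
  obtain y' v' e1' e2' z' where Ye: "Y = (y', v', e1', e2', z')" by (cases Y)
  obtain y'' v'' where Xe': "X' = (y'', v'', e1, e2, z)" using eq by (cases X') (auto simp: Xe)
  have L: "L2 y" "L2 v" "L2 y'" "L2 v'" "L2 y''" "L2 v''" "AE x in I01. y x = y'' x" "AE x in I01. v x = v'' x"
    using X Y X' eq by (auto simp: Xe Ye Xe' L2_states_def)
  have 1: "ip (k \<odot> y) f = ip (k \<odot> y'') f" if "Linf k" "L2 f" for k f
    using L that by (intro ip_cong_AE weight_L2) (auto elim: AE_mp)
  have 2: "ip v f = ip v'' f" "ip f v = ip f v''" if "L2 f" for f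
    using L that by (auto intro!: ip_cong_AE)
  have 3: "multiplier y e2 = multiplier y'' e2" using L by (intro multiplier_cong)
  show ?thesis
    unfolding bform_def Xe Ye Xe' eform.simps fform.simps 3
    using L by (simp add: 1 2 multiplier_L2 weight_L2 Linf_coeffs)
qed

lemma bform_cong:
  assumes "X \<in> L2_states" "Y \<in> L2_states" "X' \<in> L2_states" "Y' \<in> L2_states" "AE_eq X X'" "AE_eq Y Y'"
  shows "bform r X Y = bform r X' Y'"
  using bform_cong1[of X Y X' r] bform_cong1[of Y X' Y' r] assms bform_sym[of r X'] by metis

text \<open>Lets \<open>eform\<close> inherit the congruence rules of \<open>bform\<close>.\<close>

lemma eform_eq_bform: "eform = bform 0"
  by (simp add: bform_def fun_eq_iff)

lemma eform_red_minus:
  assumes "X \<in> state_space" "Y \<in> state_space"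
  shows "esq (red (X - Y)) = esq (red X - red Y)"
  unfolding eform_eq_bform by (intro bform_cong L2_states_minus red_L2 state_space_minus assms)

lemma eform_nonneg: "X \<in> L2_states \<Longrightarrow> 0 \<le> eform X X"
  by (cases X) (simp add: L2_states_def eform_bounds(6) del: eform.simps)

lemma eform_upper:
  obtains K where "0 \<le> K" "\<And>y v e1 e2 z. L2 y \<Longrightarrow> L2 v \<Longrightarrow> esq (y, v, e1, e2, z)
    \<le> K * ((L2_norm y)\<^sup>2 + (L2_norm v)\<^sup>2 + (cmod e1)\<^sup>2 + (cmod e2)\<^sup>2 + (cmod z)\<^sup>2)"
proof -
  obtain B where B: "AE x in I01. \<bar>a x\<bar> \<le> B" using Linf_coeffs(1) by (auto simp: Linf_def)
  define K where "K = max B 0 + 1 + c1 + c1 * \<alpha>2 + c0"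
  have K: "B \<le> K" "1 \<le> K" "c1 \<le> K" "c1 * \<alpha>2 \<le> K" "c0 \<le> K" "0 \<le> K"
    using c_pos mult_pos_pos[OF c_pos(1) pos(2)] max.cobounded1[of B 0] max.cobounded2[of 0 B]
    unfolding K_def by linarith+
  show thesis
  proof (rule that[OF K(6)])
    fix y v :: "real \<Rightarrow> complex" and e1 e2 z :: complex assume L: "L2 y" "L2 v"
    have "AE x in I01. a x \<le> K" using B by eventually_elim (use K in auto)
    then have "ip (a \<odot> y) y \<le> K * (L2_norm y)\<^sup>2"
      using ip_weight_mono[OF L(1) Linf_coeffs(1) Linf_const[of K]] by (simp add: ip_scaleR_left L2_norm_power2)
    moreover have "1 * ip v v \<le> K * (L2_norm v)\<^sup>2" unfolding L2_norm_power2
      using K ip_self_nonneg by (intro mult_right_mono) auto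
    moreover have "c1 * (cmod e1)\<^sup>2 \<le> K * (cmod e1)\<^sup>2" "c1 * \<alpha>2 * (cmod e2)\<^sup>2 \<le> K * (cmod e2)\<^sup>2" "c0 * (cmod z)\<^sup>2 \<le> K * (cmod z)\<^sup>2"
      using K by (intro mult_right_mono; simp)+
    ultimately show "esq (y, v, e1, e2, z)
      \<le> K * ((L2_norm y)\<^sup>2 + (L2_norm v)\<^sup>2 + (cmod e1)\<^sup>2 + (cmod e2)\<^sup>2 + (cmod z)\<^sup>2)"
      unfolding eform.simps distrib_left power2_norm_eq_inner[symmetric] by linarith
  qed
qed

text \<open>\<open>u(x)\<close> differs from \<open>u(1)\<close>, which is part of the energy as
  \<open>e2\<close>, by an integral of \<open>u_x\<close>. Serves the claim on the maximum and also
  the L2 norm of \<open>u\<close>.\<close>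

lemma sup_bound:
  obtains Cu where "0 \<le> Cu" "\<And>u v e1 z x. H1 u \<Longrightarrow> L2 v \<Longrightarrow> x \<in> {0..1} \<Longrightarrow>
    cmod (cont_rep u x) \<le> Cu * sqrt (esq (wderiv u, v, e1, cont_rep u 1, z))"
proof (rule that[of "1 / sqrt (c1 * \<alpha>2) + 2 * (1 / sqrt alo)"])
  show "0 \<le> 1 / sqrt (c1 * \<alpha>2) + 2 * (1 / sqrt alo)" using c_pos pos alo by simp
  fix u v :: "real \<Rightarrow> complex" and e1 z and x :: real assume u: "H1 u" and v: "L2 v" and x: "x \<in> {0..1}"
  let ?s = "sqrt (esq (wderiv u, v, e1, cont_rep u 1, z))"
  note y = H1_wderiv(1)[OF u]
  note b = eform_bounds[OF y v, where ?e1.0=e1 and ?e2.0="cont_rep u 1" and ?z=z]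
  have pr: "norm (prim (wderiv u) x) \<le> 1 / sqrt alo * ?s" for x
    using norm_prim_le[OF L2_integrable[OF y], of x] integral_norm_le_L2_norm[OF y] b(1) by linarith
  note e = ac_eq_prim[OF H1_ac(1)[OF u]]
  have "cont_rep u x = cont_rep u 1 - (prim (wderiv u) 1 - prim (wderiv u) x)"
    using e[OF x] e[of 1] by simp
  then have "cmod (cont_rep u x) \<le> cmod (cont_rep u 1) + cmod (prim (wderiv u) 1 - prim (wderiv u) x)"
    by (metis norm_triangle_ineq4)
  also have "\<dots> \<le> 1 / sqrt (c1 * \<alpha>2) * ?s + (1 / sqrt alo * ?s + 1 / sqrt alo * ?s)"
    by (intro add_mono b(4) order_trans[OF norm_triangle_ineq4] pr)
  finally show "cmod (cont_rep u x) \<le> (1 / sqrt (c1 * \<alpha>2) + 2 * (1 / sqrt alo)) * ?s"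
    by (simp add: algebra_simps)
qed

text \<open>Only the L2 norm of \<open>u\<close> itself is missing from the energy, and
  \<open>sup_bound\<close> supplies it.\<close>

lemma state_norm_equiv:
  obtains C where "0 \<le> C" "\<And>X. X \<in> state_space \<Longrightarrow> state_norm X \<le> C * sqrt (esq (red X))"
    "\<And>X. X \<in> state_space \<Longrightarrow> sqrt (esq (red X)) \<le> C * state_norm X"
proof -
  obtain K where K: "0 \<le> K" "\<And>y v e1 e2 z. L2 y \<Longrightarrow> L2 v \<Longrightarrow> esq (y, v, e1, e2, z)
    \<le> K * ((L2_norm y)\<^sup>2 + (L2_norm v)\<^sup>2 + (cmod e1)\<^sup>2 + (cmod e2)\<^sup>2 + (cmod z)\<^sup>2)"
    using eform_upper by blast
  obtain Cu where Cu: "0 \<le> Cu" "\<And>u v e1 z x. H1 u \<Longrightarrow> L2 v \<Longrightarrow> x \<in> {0..1} \<Longrightarrow>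
    cmod (cont_rep u x) \<le> Cu * sqrt (esq (wderiv u, v, e1, cont_rep u 1, z))"
    using sup_bound by blast
  define C' where "C' = sqrt (Cu\<^sup>2 + (1 / sqrt alo)\<^sup>2 + 1 + (1 / sqrt c1)\<^sup>2 + (1 / sqrt (c1 * \<alpha>2))\<^sup>2 + (1 / sqrt c0)\<^sup>2)"
  define C where "C = max C' (sqrt K)"
  show thesis
  proof (rule that[of C])
    show C0: "0 \<le> C" unfolding C_def by (rule max.coboundedI2) (simp add: K(1))
    fix X :: state assume X: "X \<in> state_space"
    obtain u v e1 e2 z where Xe: "X = (u, v, e1, e2, z)" by (cases X)
    have u: "H1 u" "L2 v" "cont_rep u 1 = e2" using X by (auto simp: Xe state_space_def)
    note y = H1_wderiv(1)[OF u(1)]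
    define s where "s = sqrt (esq (red X))"
    have s: "s = sqrt (esq (wderiv u, v, e1, e2, z))" by (simp add: s_def Xe del: eform.simps)
    note b = eform_bounds[OF y u(2), where ?e1.0=e1 and ?e2.0=e2 and ?z=z, folded s]
    have s0: "0 \<le> s" using b(6) by (simp add: s del: eform.simps)
    have "L2_norm u \<le> Cu * s"
    proof -
      note a = H1_ac[OF u(1)]
      have "L2_norm u \<le> (Cu * s) * L2_norm (\<lambda>x. 1 :: real)"
      proof (rule L2_norm_mono)
        show "AE x in I01. norm (u x) \<le> Cu * s * norm (1::real)"
          using a(2) AE_space
        proof eventually_elim
          case (elim x)
          then show ?case using Cu(2)[OF u(1,2), of x e1 z] by (simp add: u(3) s del: eform.simps)
        qed
      qed (use H1_L2[OF u(1)] Cu(1) s0 in auto)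
      then show ?thesis by (simp add: L2_norm_def measure_restrict_space)
    qed
    then have "(state_norm X)\<^sup>2 \<le> (Cu * s)\<^sup>2 + (1 / sqrt alo * s)\<^sup>2 + s\<^sup>2 + (1 / sqrt c1 * s)\<^sup>2 + (1 / sqrt (c1 * \<alpha>2) * s)\<^sup>2 + (1 / sqrt c0 * s)\<^sup>2"
      unfolding Xe state_norm.simps
      by (subst real_sqrt_pow2) (simp, intro add_mono power_mono b L2_norm_nonneg norm_ge_zero)
    also have "\<dots> = (C' * s)\<^sup>2"
    proof -
      have "C'\<^sup>2 = Cu\<^sup>2 + (1 / sqrt alo)\<^sup>2 + 1 + (1 / sqrt c1)\<^sup>2 + (1 / sqrt (c1 * \<alpha>2))\<^sup>2 + (1 / sqrt c0)\<^sup>2"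
        unfolding C'_def by (rule real_sqrt_pow2) simp
      then show ?thesis by (simp only: power_mult_distrib distrib_right mult_1_left)
    qed
    finally have "state_norm X \<le> C' * s"
      by (rule power2_le_imp_le) (use s0 in \<open>simp add: C'_def\<close>)
    also have "\<dots> \<le> C * s" using s0 by (intro mult_right_mono) (auto simp: C_def)
    finally show "state_norm X \<le> C * sqrt (esq (red X))" by (simp add: s_def)
    have nn: "0 \<le> state_norm X" by (simp add: Xe)
    have "esq (red X) \<le> K * (state_norm X)\<^sup>2"
    proof -
      have "esq (red X) \<le> K * ((L2_norm (wderiv u))\<^sup>2 + (L2_norm v)\<^sup>2 + (cmod e1)\<^sup>2 + (cmod e2)\<^sup>2 + (cmod z)\<^sup>2)"
        unfolding Xe red.simps by (rule K(2)[OF y u(2)])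
      also have "\<dots> \<le> K * (state_norm X)\<^sup>2"
        unfolding Xe state_norm.simps by (subst real_sqrt_pow2) (simp, intro mult_left_mono K(1), simp)
      finally show ?thesis .
    qed
    then have "sqrt (esq (red X)) \<le> sqrt (K * (state_norm X)\<^sup>2)" by (rule real_sqrt_le_mono)
    also have "\<dots> = sqrt K * state_norm X" using nn by (simp add: real_sqrt_mult)
    also have "\<dots> \<le> C * state_norm X" using nn by (intro mult_right_mono) (auto simp: C_def)
    finally show "sqrt (esq (red X)) \<le> C * state_norm X" .
  qed
qed

text \<open>Limits are taken in the reduced components. Rebuilding \<open>u\<close> from the limits
  of \<open>u_x\<close> and of the values at 1 preserves the constraint in
  \<open>state_space\<close>.\<close>

lemma eform_complete:
  assumes X: "\<And>k. X k \<in> state_space"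
    and le: "\<And>k. sqrt (eform (red (X (Suc k) - X k)) (red (X (Suc k) - X k))) \<le> C * (1/3) ^ k"
  obtains Y where "Y \<in> state_space" "(\<lambda>k. esq (red (X k - Y))) \<longlonglongrightarrow> 0"
proof -
  define u where "u k = fst (X k)" for k
  define v where "v k = fst (snd (X k))" for k
  define e1 where "e1 k = fst (snd (snd (X k)))" for k
  define e2 where "e2 k = fst (snd (snd (snd (X k))))" for k
  define z where "z k = snd (snd (snd (snd (X k))))" for k
  have Xe: "X k = (u k, v k, e1 k, e2 k, z k)" for k by (simp add: u_def v_def e1_def e2_def z_def)
  have H: "H1 (u k)" "L2 (v k)" "cont_rep (u k) 1 = e2 k" for k
    using X[of k] by (auto simp: Xe state_space_def)
  note y = H1_wderiv(1)[OF H(1)]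
  have step: "esq (red (X k - Y)) = esq (red (X k) - red Y)" if "Y \<in> state_space" for k Y
    by (rule eform_red_minus[OF X that])
  define s where "s k = sqrt (eform (red (X (Suc k)) - red (X k)) (red (X (Suc k)) - red (X k)))" for k
  have s: "s k \<le> C * (1/3) ^ k" for k
    using le[of k] step[OF X, of "Suc k" k] by (simp add: s_def)
  have sb: "L2_norm (\<lambda>x. wderiv (u (Suc k)) x - wderiv (u k) x) \<le> 1 / sqrt alo * s k"
    "L2_norm (\<lambda>x. v (Suc k) x - v k x) \<le> s k" "cmod (e1 (Suc k) - e1 k) \<le> 1 / sqrt c1 * s k"
    "cmod (e2 (Suc k) - e2 k) \<le> 1 / sqrt (c1 * \<alpha>2) * s k" "cmod (z (Suc k) - z k) \<le> 1 / sqrt c0 * s k" for k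
    unfolding s_def Xe red.simps minus_state
    by (intro eform_bounds L2_diff y H)+
  have geo: "c * s k \<le> (c * C) * (1/3) ^ k" if "0 \<le> c" for c k
    using mult_left_mono[OF s[of k] that] by (simp add: mult.assoc)
  obtain l1 where l1: "e1 \<longlonglongrightarrow> l1"
    by (rule convergent_if_geometric[OF order_trans[OF sb(3) geo]]) (use c_pos in auto)
  obtain l2 where l2: "e2 \<longlonglongrightarrow> l2"
    by (rule convergent_if_geometric[OF order_trans[OF sb(4) geo]]) (use c_pos pos in auto)
  obtain l3 where l3: "z \<longlonglongrightarrow> l3"
    by (rule convergent_if_geometric[OF order_trans[OF sb(5) geo]]) (use c_pos in auto)
  have sq: "(\<integral>x. (norm (f x))\<^sup>2 \<partial>I01) \<le> c\<^sup>2 * (1/9) ^ k" if "L2_norm f \<le> c * (1/3) ^ k" for f :: "real \<Rightarrow> complex" and c k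
  proof -
    have "(L2_norm f)\<^sup>2 \<le> (c * (1/3) ^ k)\<^sup>2" using that by (intro power_mono L2_norm_nonneg)
    also have "\<dots> = c\<^sup>2 * (1/9) ^ k"
      by (simp add: power_mult_distrib power_mult[symmetric] mult.commute[of k]) (simp add: power_mult power2_eq_square)
    finally show ?thesis by (simp add: L2_norm_def)
  qed
  obtain w where w: "L2 w" "(\<lambda>k. \<integral>x. (norm (w x - wderiv (u k) x))\<^sup>2 \<partial>I01) \<longlonglongrightarrow> 0"
    by (rule L2_complete[of "\<lambda>k. wderiv (u k)"], rule y, rule sq, rule order_trans[OF sb(1) geo]) (use alo in auto)
  obtain v' where v': "L2 v'" "(\<lambda>k. \<integral>x. (norm (v' x - v k x))\<^sup>2 \<partial>I01) \<longlonglongrightarrow> 0"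
    by (rule L2_complete[of v], rule H, rule sq, rule order_trans[OF sb(2) s]) auto
  note U = antideriv[OF w(1), of l2]
  define Y where "Y = (antideriv w l2, v', l1, l2, l3)"
  have Y: "Y \<in> state_space" using U v' by (simp add: Y_def state_space_def)
  obtain K where K: "0 \<le> K" "\<And>y v e1 e2 z. L2 y \<Longrightarrow> L2 v \<Longrightarrow> esq (y, v, e1, e2, z)
    \<le> K * ((L2_norm y)\<^sup>2 + (L2_norm v)\<^sup>2 + (cmod e1)\<^sup>2 + (cmod e2)\<^sup>2 + (cmod z)\<^sup>2)"
    using eform_upper by blast
  have YL: "(w, v', l1, l2, l3) \<in> L2_states" using w v' by (simp add: L2_states_def)
  have conv: "esq (red (X k - Y)) \<le> K * ((\<integral>x. (norm (w x - wderiv (u k) x))\<^sup>2 \<partial>I01)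
      + (\<integral>x. (norm (v' x - v k x))\<^sup>2 \<partial>I01) + (cmod (e1 k - l1))\<^sup>2 + (cmod (e2 k - l2))\<^sup>2 + (cmod (z k - l3))\<^sup>2)" for k
  proof -
    have "AE_eq (red (X k) - red Y) (red (X k) - (w, v', l1, l2, l3))"
      unfolding Xe Y_def red.simps minus_state AE_eq.simps using U(2) by (auto elim: AE_mp)
    then have "esq (red (X k - Y)) = eform (red (X k) - (w, v', l1, l2, l3)) (red (X k) - (w, v', l1, l2, l3))"
      unfolding step[OF Y] unfolding eform_eq_bform
      by (intro bform_cong L2_states_minus red_L2 X Y YL)
    also have "\<dots> \<le> K * ((L2_norm (\<lambda>x. wderiv (u k) x - w x))\<^sup>2 + (L2_norm (\<lambda>x. v k x - v' x))\<^sup>2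
        + (cmod (e1 k - l1))\<^sup>2 + (cmod (e2 k - l2))\<^sup>2 + (cmod (z k - l3))\<^sup>2)"
      unfolding Xe red.simps minus_state by (intro K(2) L2_diff y H w v')
    finally show ?thesis
      by (simp only: L2_norm_def norm_minus_commute[of "wderiv _ _"] norm_minus_commute[of "v _ _"]) simp
  qed
  have lim: "(\<lambda>k. K * ((\<integral>x. (norm (w x - wderiv (u k) x))\<^sup>2 \<partial>I01)
      + (\<integral>x. (norm (v' x - v k x))\<^sup>2 \<partial>I01) + (cmod (e1 k - l1))\<^sup>2 + (cmod (e2 k - l2))\<^sup>2 + (cmod (z k - l3))\<^sup>2))
      \<longlonglongrightarrow> K * (0 + 0 + (cmod (l1 - l1))\<^sup>2 + (cmod (l2 - l2))\<^sup>2 + (cmod (l3 - l3))\<^sup>2)"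
    by (intro tendsto_intros w v' l1 l2 l3)
  show thesis
  proof (rule that[OF Y])
    show "(\<lambda>k. esq (red (X k - Y))) \<longlonglongrightarrow> 0"
    proof (rule tendsto_sandwich[OF _ _ tendsto_const])
      show "(\<lambda>k. K * ((\<integral>x. (norm (w x - wderiv (u k) x))\<^sup>2 \<partial>I01)
        + (\<integral>x. (norm (v' x - v k x))\<^sup>2 \<partial>I01) + (cmod (e1 k - l1))\<^sup>2 + (cmod (e2 k - l2))\<^sup>2 + (cmod (z k - l3))\<^sup>2)) \<longlonglongrightarrow> 0"
        using lim by simp
    qed (auto intro!: always_eventually conv eform_nonneg red_L2 state_space_minus X Y)
  qed
qed

text \<open>The scalars are kept exactly; only \<open>u_x\<close> and \<open>u_t\<close> are
  approximated, the latter with end values prescribed by the trace conditions.\<close>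

lemma dom_A_dense:
  assumes X: "X \<in> state_space" and e: "0 < e"
  obtains Y where "Y \<in> dom_A" "Y \<in> state_space" "esq (red (X - Y)) < e"
proof -
  obtain u v e1 e2 z where Xe: "X = (u, v, e1, e2, z)" by (cases X)
  have H: "H1 u" "L2 v" "cont_rep u 1 = e2" using X by (auto simp: Xe state_space_def)
  note y = H1_wderiv(1)[OF H(1)]
  obtain K where K: "0 \<le> K" "\<And>y v e1 e2 z. L2 y \<Longrightarrow> L2 v \<Longrightarrow> esq (y, v, e1, e2, z)
    \<le> K * ((L2_norm y)\<^sup>2 + (L2_norm v)\<^sup>2 + (cmod e1)\<^sup>2 + (cmod e2)\<^sup>2 + (cmod z)\<^sup>2)"
    using eform_upper by blast
  \<comment> \<open>Both squared L2 errors are below \<open>d\<close>, and \<open>2 K d < e\<close>;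
    the summand 1 covers \<open>K = 0\<close>.\<close>
  define d where "d = e / (2 * K + 1)"
  have d: "0 < d" using K e by (simp add: d_def)
  obtain h h' where h: "ac h h'" "(\<integral>x. (norm (wderiv u x - h x))\<^sup>2 \<partial>I01) < d"
    using L2_dense_ac[OF y d] by metis
  obtain w w' where w: "ac w w'" "w 0 = z" "w 1 = e1" "(\<integral>x. (norm (v x - w x))\<^sup>2 \<partial>I01) < d"
    by (rule L2_dense_ac[OF H(2) d, of z e1])
  note hL = ac_L2_self[OF h(1)] and wL = ac_L2_self[OF w(1)]
  note U = antideriv[OF hL, of e2]
  have wd: "AE x in I01. h x = wderiv (antideriv h e2) x" using U(2) by (auto elim: AE_mp)
  have H2: "H2 (antideriv h e2)"
    unfolding H2_def using U(1) ac_H1(1)[OF h(1) wd] L2_measurable[OF H1_wderiv(1)[OF U(1)]] by simp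
  have wH: "H1 w" "cont_rep w 1 = e1" "cont_rep w 0 = z"
    using ac_H1(1)[OF w(1), of w] ac_H1(3)[OF w(1), of w 1] ac_H1(3)[OF w(1), of w 0] w(2,3) L2_measurable[OF wL] by auto
  define Y where "Y = (antideriv h e2, w, e1, e2, z)"
  have Y: "Y \<in> state_space" using U wL by (simp add: Y_def state_space_def)
  then have YD: "Y \<in> dom_A" using H2 wH by (simp add: Y_def dom_A_def)
  have YL: "(h, w, e1, e2, z) \<in> L2_states" using hL wL by (simp add: L2_states_def)
  have "esq (red (X - Y)) = esq (red X - red Y)"
    by (rule eform_red_minus[OF X Y])
  also have "\<dots> = esq (red X - (h, w, e1, e2, z))"
  proof -
    have "AE_eq (red X - red Y) (red X - (h, w, e1, e2, z))"
      unfolding Xe Y_def red.simps minus_state AE_eq.simps using U(2) by (auto elim: AE_mp)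
    then show ?thesis unfolding eform_eq_bform
      by (intro bform_cong L2_states_minus red_L2 X Y YL)
  qed
  also have "\<dots> \<le> K * ((L2_norm (\<lambda>x. wderiv u x - h x))\<^sup>2 + (L2_norm (\<lambda>x. v x - w x))\<^sup>2
      + (cmod (e1 - e1))\<^sup>2 + (cmod (e2 - e2))\<^sup>2 + (cmod (z - z))\<^sup>2)"
    unfolding Xe red.simps minus_state by (intro K(2) L2_diff y H hL wL)
  also have "\<dots> \<le> K * (d + d)"
    using h(2) w(4) by (intro mult_left_mono K(1)) (simp add: L2_norm_def)
  also have "\<dots> < e"
  proof -
    have "(2 * K + 1) * d = e" using K(1) by (simp add: d_def)
    then show ?thesis using d by (simp add: algebra_simps)
  qed
  finally show thesis by (intro that[OF YD Y])
qed

text \<open>\<open>a0\<close> is the coefficient as given and \<open>a\<close> its continuous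
  representative. The weak derivative in the operator does not see the difference, so the operator
  agrees almost everywhere with \<open>red_gen\<close>.\<close>

lemma op_A_dissipative:
  assumes dis: "\<And>y y' v v' e2. ac y y' \<Longrightarrow> ac v v' \<Longrightarrow> bform r (y, v, v 1, e2, v 0) (red_gen y y' v v' e2)
      \<le> - \<nu> * bform r (y, v, v 1, e2, v 0) (y, v, v 1, e2, v 0)"
    and a0: "AE x in I01. a x = a0 x" "a0 \<in> borel_measurable I01"
    and X: "X \<in> dom_A"
  shows "bform r (red X) (red (op_A a0 q \<alpha>1 \<alpha>2 \<beta>1 \<gamma>1 \<mu>1 X)) \<le> - \<nu> * bform r (red X) (red X)"
proof -
  obtain u v e1 e2 z where Xe: "X = (u, v, e1, e2, z)" by (cases X)
  have H: "H1 u" "H1 (wderiv u)" "H1 v" "cont_rep v 1 = e1" "cont_rep v 0 = z" and XS: "X \<in> state_space"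
    using X by (auto simp: Xe dom_A_def H2_def)
  define y where "y = cont_rep (wderiv u)"
  define y' where "y' = wderiv (wderiv u)"
  define w where "w = cont_rep v"
  define w' where "w' = wderiv v"
  have y: "ac y y'" "AE x in I01. y x = wderiv u x" using H1_ac[OF H(2)] by (auto simp: y_def y'_def)
  have w: "ac w w'" "AE x in I01. w x = v x" using H1_ac[OF H(3)] by (auto simp: w_def w'_def)
  have w01: "w 1 = e1" "w 0 = z" using H by (auto simp: w_def)
  note L = H1_wderiv(1)[OF H(1)] H1_L2[OF H(3)] ac_L2_self[OF y(1)] ac_L2_self[OF w(1)] ac_L2[OF y(1)] ac_L2[OF w(1)]
  have ay: "ac (a \<odot> y) (\<lambda>x. a' x *\<^sub>R y x + a x *\<^sub>R y' x)" by (rule ac_scaleR[OF a y(1)])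
  have "AE x in I01. a x *\<^sub>R y x = complex_of_real (a0 x) * wderiv u x"
    using a0(1) y(2) by eventually_elim (simp add: scaleR_conv_of_real)
  moreover have "(\<lambda>x. complex_of_real (a0 x) * wderiv u x) \<in> borel_measurable I01"
    using a0(2) L2_measurable[OF L(1)] by (intro borel_measurable_times) auto
  ultimately have ad: "AE x in I01. wderiv (\<lambda>x. complex_of_real (a0 x) * wderiv u x) x = a' x *\<^sub>R y x + a x *\<^sub>R y' x"
    "H1 (\<lambda>x. complex_of_real (a0 x) * wderiv u x)"
    using ac_H1[OF ay] by auto
  have R: "red X \<in> L2_states" "(y, w, w 1, e2, w 0) \<in> L2_states" "AE_eq (red X) (y, w, w 1, e2, w 0)"
    using L y(2) w(2) by (auto simp: Xe L2_states_def w01 elim: AE_mp)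
  have gL: "red_gen y y' w w' e2 \<in> L2_states"
    using L by (auto simp: red_gen_def L2_states_def intro!: L2_diff L2_add weight_L2 Linf_coeffs)
  have AL: "red (op_A a0 q \<alpha>1 \<alpha>2 \<beta>1 \<gamma>1 \<mu>1 X) \<in> L2_states"
    using L H1_wderiv(1)[OF H(3)] H1_wderiv(1)[OF ad(2)] weight_L2[OF Linf_coeffs(3) L(2)]
    by (auto simp: Xe L2_states_def scaleR_conv_of_real intro!: L2_diff)
  have "AE_eq (red (op_A a0 q \<alpha>1 \<alpha>2 \<beta>1 \<gamma>1 \<mu>1 X)) (red_gen y y' w w' e2)"
  proof -
    have "AE x in I01. wderiv (\<lambda>x. complex_of_real (a0 x) * wderiv u x) x - complex_of_real (q x) * v x
      = a' x *\<^sub>R y x + a x *\<^sub>R y' x - q x *\<^sub>R w x"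
      using ad(1) w(2) by eventually_elim (simp add: scaleR_conv_of_real)
    then show ?thesis
      by (simp add: Xe red_gen_def w01 w'_def scaleR_conv_of_real y_def[symmetric])
  qed
  then have "bform r (red X) (red (op_A a0 q \<alpha>1 \<alpha>2 \<beta>1 \<gamma>1 \<mu>1 X)) = bform r (y, w, w 1, e2, w 0) (red_gen y y' w w' e2)"
    by (intro bform_cong R AL gL)
  also have "\<dots> \<le> - \<nu> * bform r (y, w, w 1, e2, w 0) (y, w, w 1, e2, w 0)"
    by (rule dis[OF y(1) w(1)])
  also have "bform r (y, w, w 1, e2, w 0) (y, w, w 1, e2, w 0) = bform r (red X) (red X)"
    using bform_cong[OF R(1,1,2,2,3,3)] by simp
  finally show ?thesis .
qed

end

section \<open>Exponential decay\<close>

text \<open>The axioms depend only on null vectors, bounds up to constants, and limits. Allows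
  \<open>state_norm\<close> to be replaced by the seminorm of the Lyapunov form.\<close>

lemma c0_semigroup_equiv_norm:
  assumes S: "c0_semigroup scl H N S"
    and H: "\<And>X Y. X \<in> H \<Longrightarrow> Y \<in> H \<Longrightarrow> X + Y \<in> H" "\<And>X Y. X \<in> H \<Longrightarrow> Y \<in> H \<Longrightarrow> X - Y \<in> H"
      "\<And>c X. X \<in> H \<Longrightarrow> scl c X \<in> H"
    and C: "0 \<le> C" "\<And>X. X \<in> H \<Longrightarrow> N X \<le> C * n X" "\<And>X. X \<in> H \<Longrightarrow> n X \<le> C * N X"
    and nn: "\<And>X. X \<in> H \<Longrightarrow> 0 \<le> N X" "\<And>X. X \<in> H \<Longrightarrow> 0 \<le> n X"
  shows "c0_semigroup scl H n S"
proof -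
  have zero: "n X = 0" if "X \<in> H" "N X = 0" for X
    using C(3)[OF that(1)] nn(2)[OF that(1)] that(2) by simp
  have mem: "S t X \<in> H" if "0 \<le> t" "X \<in> H" for t X
    using S that by (simp add: c0_semigroup_def)
  show ?thesis
    unfolding c0_semigroup_def
  proof (intro conjI allI impI ballI)
    fix t :: real assume t: "0 \<le> t"
    show "\<exists>C. \<forall>X\<in>H. n (S t X) \<le> C * n X"
    proof -
      have "\<exists>K. \<forall>X\<in>H. N (S t X) \<le> K * N X" using S t by (simp add: c0_semigroup_def)
      then obtain K where K: "\<And>X. X \<in> H \<Longrightarrow> N (S t X) \<le> K * N X" by blast
      have "n (S t X) \<le> (C * (\<bar>K\<bar> * C)) * n X" if X: "X \<in> H" for X
      proof -
        have "n (S t X) \<le> C * N (S t X)" by (rule C(3)[OF mem[OF t X]])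
        also have "\<dots> \<le> C * (K * N X)" by (intro mult_left_mono K X C(1))
        also have "\<dots> \<le> C * (\<bar>K\<bar> * N X)" by (intro mult_left_mono mult_right_mono nn X C(1)) simp
        also have "\<dots> \<le> C * (\<bar>K\<bar> * (C * n X))" by (intro mult_left_mono C X) simp
        finally show ?thesis by (simp add: mult.assoc)
      qed
      then show ?thesis by blast
    qed
  next
    fix X assume X: "X \<in> H"
    show "((\<lambda>t. n (S t X - X)) \<longlongrightarrow> 0) (at_right 0)"
    proof (rule Lim_null_comparison)
      have "((\<lambda>t. N (S t X - X)) \<longlongrightarrow> 0) (at_right 0)" using S X by (simp add: c0_semigroup_def)
      then show "((\<lambda>t. C * N (S t X - X)) \<longlongrightarrow> 0) (at_right 0)" by (rule tendsto_mult_right_zero)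
      show "eventually (\<lambda>t. norm (n (S t X - X)) \<le> C * N (S t X - X)) (at_right 0)"
        using eventually_at_right_less
      proof eventually_elim
        case (elim t)
        then have "S t X - X \<in> H" using X by (intro H mem) auto
        then show ?case using C(3) nn(2) by simp
      qed
    qed
  qed (use S in \<open>auto simp: c0_semigroup_def intro!: zero H\<close>)
qed

lemma diff_quot_equiv_norm:
  assumes le: "\<And>X. X \<in> H \<Longrightarrow> n X \<le> C * N X" and nn: "\<And>X. X \<in> H \<Longrightarrow> 0 \<le> n X"
    and H: "\<And>h. 0 < h \<Longrightarrow> scl (complex_of_real (1 / h)) (S h X - X) - Y \<in> H"
    and lim: "diff_quot_tendsto scl N S X Y"
  shows "diff_quot_tendsto scl n S X Y"
  unfolding diff_quot_tendsto_def
proof (rule Lim_null_comparison)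
  show "((\<lambda>h. C * N (scl (complex_of_real (1 / h)) (S h X - X) - Y)) \<longlongrightarrow> 0) (at_right 0)"
    using lim unfolding diff_quot_tendsto_def by (rule tendsto_mult_right_zero)
  show "eventually (\<lambda>h. norm (n (scl (complex_of_real (1 / h)) (S h X - X) - Y))
      \<le> C * N (scl (complex_of_real (1 / h)) (S h X - X) - Y)) (at_right 0)"
    using eventually_at_right_less
  proof eventually_elim
    case (elim h)
    from H[OF this] show ?case using le nn by simp
  qed
qed

lemma is_generator_equiv_norm:
  assumes gen: "is_generator scl H N D A S"
    and S: "\<And>t X. 0 \<le> t \<Longrightarrow> X \<in> H \<Longrightarrow> S t X \<in> H"
    and H: "\<And>X Y. X \<in> H \<Longrightarrow> Y \<in> H \<Longrightarrow> X - Y \<in> H" "\<And>c X. X \<in> H \<Longrightarrow> scl c X \<in> H"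
    and C: "\<And>X. X \<in> H \<Longrightarrow> N X \<le> C * n X" "\<And>X. X \<in> H \<Longrightarrow> n X \<le> C * N X"
    and nn: "\<And>X. X \<in> H \<Longrightarrow> 0 \<le> N X" "\<And>X. X \<in> H \<Longrightarrow> 0 \<le> n X"
  shows "is_generator scl H n D A S"
proof -
  have "diff_quot_tendsto scl N S X Y \<longleftrightarrow> diff_quot_tendsto scl n S X Y" if X: "X \<in> H" and Y: "Y \<in> H" for X Y
  proof -
    have m: "scl (complex_of_real (1 / h)) (S h X - X) - Y \<in> H" if "0 < h" for h
      using that by (intro H S X Y) simp
    show ?thesis
      using diff_quot_equiv_norm[where scl=scl and n=n and N=N and H=H and S=S and X=X and Y=Y, OF C(2) nn(2) m]
        diff_quot_equiv_norm[where scl=scl and n=N and N=n and H=H and S=S and X=X and Y=Y, OF C(1) nn(1) m] by blast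
  qed
  then show ?thesis using gen unfolding is_generator_def by auto
qed

section \<open>Decay along the given semigroup\<close>

context damped_wave
begin

lemma semi_inner_bform:
  assumes low: "\<And>y v e1 e2 z. L2 y \<Longrightarrow> L2 v \<Longrightarrow> esq (y, v, e1, e2, z) \<le> 2 * bform r (y, v, e1, e2, z) (y, v, e1, e2, z)"
  shows "semi_inner state_scale state_space (\<lambda>X Y. bform r (red X) (red Y))"
proof
  fix X Y Z :: state and s :: real and c
  assume X: "X \<in> state_space"
  show "state_scale c X \<in> state_space" by (rule state_space_scale[OF X])
  have "esq (red X) \<le> 2 * bform r (red X) (red X)"
    using red_L2[OF X] low by (cases "red X") (auto simp: L2_states_def simp del: eform.simps)
  then show "0 \<le> bform r (red X) (red X)" using eform_nonneg[OF red_L2[OF X]] by simp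
  assume Y: "Y \<in> state_space"
  show "X + Y \<in> state_space" "X - Y \<in> state_space" by (intro state_space_plus state_space_minus X Y)+
  show "bform r (red X) (red Y) = bform r (red Y) (red X)" by (rule bform_sym)
  assume Z: "Z \<in> state_space"
  have "bform r (red (X + Y)) (red Z) = bform r (red X + red Y) (red Z)"
    by (intro bform_cong1 red_L2 L2_states_plus state_space_plus X Y Z)
  then show "bform r (red (X + Y)) (red Z) = bform r (red X) (red Z) + bform r (red Y) (red Z)"
    using bform_add X Y Z by (simp add: red_L2)
next
  fix X Z :: state and s :: real
  assume X: "X \<in> state_space" and Z: "Z \<in> state_space"
  have "bform r (red (state_scale (complex_of_real s) X)) (red Z) = bform r (state_scale (complex_of_real s) (red X)) (red Z)"
    by (intro bform_cong1 red_L2 L2_states_scale state_space_scale X Z)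
  then show "bform r (red (state_scale (complex_of_real s) X)) (red Z) = s * bform r (red X) (red Z)"
    using bform_scale X Z by (simp add: red_L2)
qed (rule state_space_zero)

text \<open>The factor 4 is the product of the two equivalence constants 2 between \<open>b\<close>
  and twice the energy. \<open>X\<close> is any state at distance zero from \<open>S 0 X0\<close>,
  because the energy at time 0 is evaluated on the solution and not on the data.\<close>

lemma semigroup_decay:
  assumes a0: "AE x in I01. a x = a0 x" "a0 \<in> borel_measurable I01"
  obtains \<nu> where "0 < \<nu>"
    "\<And>S X0 X Y t. c0_semigroup state_scale state_space state_norm S \<Longrightarrow>
      is_generator state_scale state_space state_norm dom_A (op_A a0 q \<alpha>1 \<alpha>2 \<beta>1 \<gamma>1 \<mu>1) S \<Longrightarrow>
      X0 \<in> state_space \<Longrightarrow> X \<in> state_space \<Longrightarrow> Y \<in> state_space \<Longrightarrow>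
      state_norm (X - S 0 X0) = 0 \<Longrightarrow> state_norm (Y - S t X0) = 0 \<Longrightarrow> 0 \<le> t \<Longrightarrow>
      esq (red Y) \<le> 4 * esq (red X) * exp (- \<nu> * t)"
proof -
  obtain r \<nu> where r: "0 < r" "0 < \<nu>"
    "\<And>y v e1 e2 z. L2 y \<Longrightarrow> L2 v \<Longrightarrow> esq (y, v, e1, e2, z) \<le> 2 * bform r (y, v, e1, e2, z) (y, v, e1, e2, z)"
    "\<And>y v e1 e2 z. L2 y \<Longrightarrow> L2 v \<Longrightarrow> bform r (y, v, e1, e2, z) (y, v, e1, e2, z) \<le> 2 * esq (y, v, e1, e2, z)"
    "\<And>y y' v v' e2. ac y y' \<Longrightarrow> ac v v' \<Longrightarrow> bform r (y, v, v 1, e2, v 0) (red_gen y y' v v' e2)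
      \<le> - \<nu> * bform r (y, v, v 1, e2, v 0) (y, v, v 1, e2, v 0)"
    using lyapunov by blast
  define b where "b = (\<lambda>X Y. bform r (red X) (red Y))"
  interpret semi_inner state_scale state_space b
    unfolding b_def by (rule semi_inner_bform[OF r(3)])
  have eb: "esq (red X) \<le> 2 * b X X" and be: "b X X \<le> 2 * esq (red X)" if X: "X \<in> state_space" for X
    using red_L2[OF X] r(3,4) unfolding b_def by (cases "red X"; auto simp: L2_states_def simp del: eform.simps)+
  obtain C where C: "0 \<le> C" "\<And>X. X \<in> state_space \<Longrightarrow> state_norm X \<le> C * sqrt (esq (red X))"
    "\<And>X. X \<in> state_space \<Longrightarrow> sqrt (esq (red X)) \<le> C * state_norm X"
    using state_norm_equiv by blast
  define C2 where "C2 = C * sqrt 2"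
  have en: "sqrt (esq (red X)) \<le> sqrt 2 * n X" and ne: "n X \<le> sqrt 2 * sqrt (esq (red X))"
    if X: "X \<in> state_space" for X
    unfolding n_def real_sqrt_mult[symmetric] by (rule real_sqrt_le_mono, rule eb[OF X] be[OF X])+
  have N: "state_norm X \<le> C2 * n X" "n X \<le> C2 * state_norm X" if X: "X \<in> state_space" for X
  proof -
    have "state_norm X \<le> C * (sqrt 2 * n X)"
      using C(2)[OF X] mult_left_mono[OF en[OF X] C(1)] by linarith
    then show "state_norm X \<le> C2 * n X" by (simp add: C2_def mult.assoc)
    have "n X \<le> sqrt 2 * (C * state_norm X)"
      by (rule order_trans[OF ne[OF X] mult_left_mono[OF C(3)[OF X]]]) simp
    then show "n X \<le> C2 * state_norm X" by (simp add: C2_def ac_simps)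
  qed
  have C2: "0 \<le> C2" using C(1) by (simp add: C2_def)
  have Nn: "0 \<le> state_norm X" for X by (cases X) simp
  show thesis
  \<comment> \<open>The rate doubles because the energy is quadratic.\<close>
  proof (rule that[of "2 * \<nu>"])
    show "0 < 2 * \<nu>" using r(2) by simp
    fix S X0 X Y and t :: real
    assume S: "c0_semigroup state_scale state_space state_norm S"
      and G: "is_generator state_scale state_space state_norm dom_A (op_A a0 q \<alpha>1 \<alpha>2 \<beta>1 \<gamma>1 \<mu>1) S"
      and X0: "X0 \<in> state_space" and X: "X \<in> state_space" and Y: "Y \<in> state_space"
      and X_eq: "state_norm (X - S 0 X0) = 0" and Y_eq: "state_norm (Y - S t X0) = 0" and t: "0 \<le> t"
    have Sn: "c0_semigroup state_scale state_space n S"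
      by (rule c0_semigroup_equiv_norm[OF S add_mem diff_mem scl_mem C2 N(1) N(2) Nn n_nonneg])
    have mem: "S t X \<in> state_space" if "0 \<le> t" "X \<in> state_space" for t X
      using S that by (simp add: c0_semigroup_def)
    have Gn: "is_generator state_scale state_space n dom_A (op_A a0 q \<alpha>1 \<alpha>2 \<beta>1 \<gamma>1 \<mu>1) S"
      by (rule is_generator_equiv_norm[OF G mem diff_mem scl_mem N(1) N(2) Nn n_nonneg])
    interpret semi_inner_semigroup state_scale state_space b S
    proof
      show "c0_semigroup state_scale state_space n S" by (rule Sn)
      fix x :: "nat \<Rightarrow> state"
      assume x: "\<And>k. x k \<in> state_space" and le: "\<And>k. n (x (Suc k) - x k) \<le> (1/3) ^ k"
      have sq: "sqrt (eform (red (x (Suc k) - x k)) (red (x (Suc k) - x k))) \<le> sqrt 2 * (1/3) ^ k" for k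
        by (rule order_trans[OF en[OF diff_mem[OF x x]] mult_left_mono[OF le]]) simp
      obtain Z where Z: "Z \<in> state_space" "(\<lambda>k. esq (red (x k - Z))) \<longlonglongrightarrow> 0"
        by (rule eform_complete[of x "sqrt 2", OF x sq]) blast
      have "(\<lambda>k. sqrt 2 * sqrt (esq (red (x k - Z)))) \<longlonglongrightarrow> sqrt 2 * sqrt 0"
        by (intro tendsto_intros Z)
      then have lim: "(\<lambda>k. sqrt 2 * sqrt (esq (red (x k - Z)))) \<longlonglongrightarrow> 0" by simp
      have "(\<lambda>k. n (x k - Z)) \<longlonglongrightarrow> 0"
      proof (rule Lim_null_comparison[OF always_eventually lim], rule allI)
        show "norm (n (x k - Z)) \<le> sqrt 2 * sqrt (esq (red (x k - Z)))" for k
          using ne[OF diff_mem[OF x Z(1)]] n_nonneg[OF diff_mem[OF x Z(1)]] by simp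
      qed
      with Z(1) show "\<exists>Z\<in>state_space. (\<lambda>k. n (x k - Z)) \<longlonglongrightarrow> 0" by blast
    qed
    have decay: "b (S t X0) (S t X0) \<le> exp (- 2 * \<nu> * t) * b X0 X0"
    proof (rule exponential_decay[OF Gn _ _ X0 t])
      fix X e assume X: "X \<in> state_space" and e: "0 < (e :: real)"
      have "0 < e\<^sup>2 / 2" using e by simp
      from dom_A_dense[OF X this] obtain Y where Y: "Y \<in> dom_A" "Y \<in> state_space" "esq (red (X - Y)) < e\<^sup>2 / 2"
        by metis
      have "(n (X - Y))\<^sup>2 < e\<^sup>2"
        using be[OF diff_mem[OF X Y(2)]] Y(3) X Y(2) by (simp add: n_power2)
      then have "n (X - Y) < e" using e by (simp add: power2_less_imp_less)
      with Y(1) show "\<exists>Y\<in>dom_A. n (X - Y) < e" by blast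
    next
      fix X assume XD: "X \<in> dom_A"
      show "b X (op_A a0 q \<alpha>1 \<alpha>2 \<beta>1 \<gamma>1 \<mu>1 X) \<le> - \<nu> * b X X"
        unfolding b_def by (rule op_A_dissipative[OF _ a0 XD], rule r(5))
    qed
    have n0: "n Z = n W" if "Z \<in> state_space" "W \<in> state_space" "state_norm (Z - W) = 0" for Z W
    proof -
      have "n (Z - W) = 0" using N(2)[OF diff_mem[OF that(1,2)]] n_nonneg[OF diff_mem[OF that(1,2)]] that(3) by simp
      then show ?thesis using b_eq_of_n_zero[OF that(1,2)] by (intro n_eqI that)
    qed
    have "b X X = b X0 X0"
      using n0[OF X mem[OF _ X0] X_eq] n_eqI[of "S 0 X0" X0] X X0 mem[of 0 X0] n_power2[of X] n_power2[of X0] by simp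
    moreover have "b Y Y = b (S t X0) (S t X0)"
      using n0[OF Y mem[OF t X0] Y_eq] Y mem[OF t X0] n_power2[of Y] n_power2[of "S t X0"] by simp
    ultimately have "esq (red Y) \<le> 2 * (exp (- 2 * \<nu> * t) * b X X)"
      using eb[OF Y] decay by simp
    also have "\<dots> \<le> 2 * (exp (- 2 * \<nu> * t) * (2 * esq (red X)))"
      using be[OF X] by (intro mult_left_mono) auto
    finally show "esq (red Y) \<le> 4 * esq (red X) * exp (- (2 * \<nu>) * t)"
      by (simp add: ac_simps)
  qed
qed

end

text \<open>The semigroup acts on complex functions shifted by \<open>u_star\<close>, while the
  energy is that of the real \<open>u\<close>. The shift leaves the derivative alone.\<close>

lemma H1_complex_shift:
  fixes f :: "real \<Rightarrow> real"
  assumes f: "H1 f"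
  shows "H1 (\<lambda>x. complex_of_real (f x - s))"
    "AE x in I01. wderiv (\<lambda>x. complex_of_real (f x - s)) x = complex_of_real (wderiv f x)"
    "x \<in> {0..1} \<Longrightarrow> cont_rep (\<lambda>x. complex_of_real (f x - s)) x = complex_of_real (cont_rep f x - s)"
proof -
  note a = H1_add[OF f H1_const(1)[of "-s"]]
  have a1: "H1 (\<lambda>x. f x - s)" using a(1) by simp
  note c = H1_bounded_linear[of complex_of_real, OF bounded_linear_of_real a1]
  show "H1 (\<lambda>x. complex_of_real (f x - s))" by (rule c(1))
  show "AE x in I01. wderiv (\<lambda>x. complex_of_real (f x - s)) x = complex_of_real (wderiv f x)"
    using c(2) a(2) H1_const(2)[of "-s"] by eventually_elim simp
  show "cont_rep (\<lambda>x. complex_of_real (f x - s)) x = complex_of_real (cont_rep f x - s)" if "x \<in> {0..1}"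
    using c(3)[OF that] a(3)[OF that] H1_const(3)[OF that, of "-s"] by simp
qed

lemma H1_complex_shift_imp:
  fixes f :: "real \<Rightarrow> real"
  assumes "H1 (\<lambda>x. complex_of_real (f x - s))" shows "H1 f"
proof -
  have "H1 (\<lambda>x. f x - s)" using H1_bounded_linear(1)[OF bounded_linear_Re assms] by simp
  from H1_add(1)[OF this H1_const(1)[of s]] show ?thesis by simp
qed

theorem theorem2p1:
  fixes a q :: "real \<Rightarrow> real"
    and \<alpha>1 \<alpha>2 \<beta>1 \<gamma>1 \<mu>1 :: real
  assumes "A1 a" and "A2 q" and "A3 \<alpha>1 \<alpha>2 \<beta>1 \<gamma>1 \<mu>1"
  shows "\<exists>M>0. \<exists>\<nu>>0.
    \<forall>(u0 :: real \<Rightarrow> real) (u1 :: real \<Rightarrow> real) (\<eta>10 :: real) (\<eta>20 :: real) (\<zeta>10 :: real)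
      (u :: real \<Rightarrow> real \<Rightarrow> real) (ut :: real \<Rightarrow> real \<Rightarrow> real)
      (\<eta>1 :: real \<Rightarrow> real) (\<eta>2 :: real \<Rightarrow> real) (\<zeta>1 :: real \<Rightarrow> real).
      H1 u0 \<longrightarrow> L2 u1 \<longrightarrow>
      weak_solution a q \<alpha>1 \<alpha>2 \<beta>1 \<gamma>1 \<mu>1 u0 u1 \<eta>10 \<eta>20 \<zeta>10 u ut \<eta>1 \<eta>2 \<zeta>1 \<longrightarrow>
      (\<forall>t\<ge>0.
         energy a \<alpha>2 \<beta>1 \<mu>1 u ut \<eta>1 \<eta>2 \<zeta>1 t
           \<le> M * energy a \<alpha>2 \<beta>1 \<mu>1 u ut \<eta>1 \<eta>2 \<zeta>1 0 * exp (- \<nu> * t) \<and>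
         (SUP x\<in>{0..1}. \<bar>cont_rep (u t) x - u_star u0 \<eta>20\<bar>\<^sup>2)
           \<le> M * energy a \<alpha>2 \<beta>1 \<mu>1 u ut \<eta>1 \<eta>2 \<zeta>1 0 * exp (- \<nu> * t))"
proof -
  obtain alo where alo: "0 < alo" "\<And>x. x \<in> {0..1} \<Longrightarrow> alo \<le> cont_rep a x" and W: "W1inf a"
    using \<open>A1 a\<close> by (auto simp: A1_def)
  obtain a' where a': "Linf a'" "weak_deriv a a'" and aLinf: "Linf a"
    using W by (auto simp: W1inf_def)
  obtain F where F: "ac F a'" "AE x in I01. F x = a x"
    using weak_deriv_imp_ac[OF Linf_imp_L2[OF aLinf] Linf_imp_L2[OF a'(1)] a'(2)] by blast
  have cr: "cont_rep a x = F x" if "x \<in> {0..1}" for x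
    by (rule cont_rep_eq[OF ac_continuous[OF F(1)] F(2) that])
  have ac: "ac (cont_rep a) a'" by (rule ac_cong[OF F(1) cr])
  have ae: "AE x in I01. cont_rep a x = a x"
    using F(2) AE_space by eventually_elim (simp add: cr)
  have am: "a \<in> borel_measurable I01" using aLinf by (simp add: Linf_def)
  obtain Ka where Ka: "AE x in I01. \<bar>a' x\<bar> \<le> Ka" using a'(1) by (auto simp: Linf_def)
  obtain Kq where Kq: "AE x in I01. \<bar>q x\<bar> \<le> Kq" using \<open>A2 q\<close> by (auto simp: A2_def Linf_def)
  obtain c d qlo qhi where cd: "c < d" "{c<..<d} \<subseteq> {0<..<1}" "0 < qlo"
    and q_bounds: "AE x in I01. x \<in> {c<..<d} \<longrightarrow> qlo \<le> q x \<and> q x \<le> qhi"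
    using \<open>A2 q\<close> by (auto simp: A2_def)
  \<comment> \<open>With the continuous representative of \<open>a\<close>, its end values in
    \<open>c1\<close> and \<open>c0\<close> are those in the energy.\<close>
  interpret dw: damped_wave "cont_rep a" a' q \<alpha>1 \<alpha>2 \<beta>1 \<gamma>1 \<mu>1 "max Ka 0" alo Kq qlo c d
  proof
    show "AE x in I01. \<bar>a' x\<bar> \<le> max Ka 0" using Ka by eventually_elim simp
    show "AE x in I01. x \<in> {c<..<d} \<longrightarrow> qlo \<le> q x" using q_bounds by eventually_elim simp
    show "AE x in I01. q x \<le> Kq" using Kq by eventually_elim simp
    show "0 \<le> c" "d \<le> 1" using cd(1,2) by (auto simp: greaterThanLessThan_subseteq_greaterThanLessThan)
    show "0 < \<alpha>1" "0 < \<alpha>2" "0 < \<beta>1" "0 < \<gamma>1" "0 < \<mu>1" using \<open>A3 \<alpha>1 \<alpha>2 \<beta>1 \<gamma>1 \<mu>1\<close> by (auto simp: A3_def)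
    show "q \<in> borel_measurable I01" "AE x in I01. 0 \<le> q x" using \<open>A2 q\<close> by (auto simp: A2_def Linf_def)
    show "a' \<in> borel_measurable I01" using a'(1) by (simp add: Linf_def)
  qed (use ac alo cd in auto)
  obtain \<nu> where \<nu>: "0 < \<nu>" and decay:
    "\<And>S X0 X Y t. c0_semigroup state_scale state_space state_norm S \<Longrightarrow>
      is_generator state_scale state_space state_norm dom_A (op_A a q \<alpha>1 \<alpha>2 \<beta>1 \<gamma>1 \<mu>1) S \<Longrightarrow>
      X0 \<in> state_space \<Longrightarrow> X \<in> state_space \<Longrightarrow> Y \<in> state_space \<Longrightarrow>
      state_norm (X - S 0 X0) = 0 \<Longrightarrow> state_norm (Y - S t X0) = 0 \<Longrightarrow> 0 \<le> t \<Longrightarrow>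
      dw.esq (red Y) \<le> 4 * dw.esq (red X) * exp (- \<nu> * t)"
    using dw.semigroup_decay[OF ae am] by blast
  obtain Cu where Cu: "0 \<le> Cu" "\<And>u v e1 z x. H1 u \<Longrightarrow> L2 v \<Longrightarrow> x \<in> {0..1} \<Longrightarrow>
    cmod (cont_rep u x) \<le> Cu * sqrt (dw.esq (wderiv u, v, e1, cont_rep u 1, z))"
    using dw.sup_bound by blast
  \<comment> \<open>4 is the factor of \<open>semigroup_decay\<close>. The squared maximum is at
    most \<open>Cu\<^sup>2\<close> times \<open>esq\<close>, which is twice the energy, whence the
    8; the sum serves both claims.\<close>
  define M where "M = 4 + 8 * Cu\<^sup>2"
  have M: "0 < M" "4 \<le> M" "8 * Cu\<^sup>2 \<le> M" by (auto simp: M_def intro: add_pos_nonneg)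
  show ?thesis
  proof (rule exI[of _ M], rule conjI[OF M(1)], rule exI[of _ \<nu>], rule conjI[OF \<nu>], intro allI impI conjI)
    fix u0 u1 :: "real \<Rightarrow> real" and \<eta>10 \<eta>20 \<zeta>10 :: real and u ut :: "real \<Rightarrow> real \<Rightarrow> real"
      and \<eta>1 \<eta>2 \<zeta>1 :: "real \<Rightarrow> real" and t :: real
    assume u0: "H1 u0" and u1: "L2 u1" and t: "0 \<le> t"
      and ws: "weak_solution a q \<alpha>1 \<alpha>2 \<beta>1 \<gamma>1 \<mu>1 u0 u1 \<eta>10 \<eta>20 \<zeta>10 u ut \<eta>1 \<eta>2 \<zeta>1"
    define s where "s = u_star u0 \<eta>20"
    define X where "X = (\<lambda>t. real_state (\<lambda>x. u t x - s, ut t, \<eta>1 t, \<eta>2 t, \<zeta>1 t))"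
    define X0 where "X0 = real_state (\<lambda>x. u0 x - s, u1, \<eta>10, \<eta>20, \<zeta>10)"
    define E where "E = energy a \<alpha>2 \<beta>1 \<mu>1 u ut \<eta>1 \<eta>2 \<zeta>1"
    obtain S where S: "c0_semigroup state_scale state_space state_norm S"
      "is_generator state_scale state_space state_norm dom_A (op_A a q \<alpha>1 \<alpha>2 \<beta>1 \<gamma>1 \<mu>1) S"
      and X: "\<And>t. 0 \<le> t \<Longrightarrow> X t \<in> state_space" "\<And>t. 0 \<le> t \<Longrightarrow> state_norm (X t - S t X0) = 0"
      using ws unfolding weak_solution_def X_def X0_def s_def by blast
    \<comment> \<open>Subtracting \<open>s\<close> makes the value of \<open>u0\<close> at 1 equal
      to \<open>\<eta>20\<close>, the constraint in \<open>state_space\<close>.\<close>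
    have X0: "X0 \<in> state_space"
      using H1_complex_shift(1)[OF u0, of s] H1_complex_shift(3)[OF u0, of 1 s] L2_bounded_linear[OF bounded_linear_of_real u1]
      by (simp add: X0_def state_space_def s_def u_star_def)
    have Et: "E t = dw.esq (red (X t)) / 2" if t: "0 \<le> t" for t
    proof -
      have H: "H1 (\<lambda>x. complex_of_real (u t x - s))" and Lc: "L2 (\<lambda>x. complex_of_real (ut t x))"
        using X(1)[OF t] by (auto simp: X_def state_space_def)
      have L: "L2 (ut t)" using L2_bounded_linear[OF bounded_linear_Re Lc] by simp
      have uH: "H1 (u t)" by (rule H1_complex_shift_imp[OF H])
      let ?y = "wderiv (\<lambda>x. complex_of_real (u t x - s))"
      note y = H1_wderiv(1)[OF H] and wd = H1_wderiv(1)[OF uH]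
      have ayL: "L2 (\<lambda>x. cont_rep a x *\<^sub>R ?y x)" by (intro weight_L2 dw.Linf_coeffs y)
      have "(\<integral>x. ((ut t x)\<^sup>2 + a x * (wderiv (u t) x)\<^sup>2) \<partial>I01)
        = (\<integral>x. (cont_rep a x *\<^sub>R ?y x) \<bullet> ?y x + complex_of_real (ut t x) \<bullet> complex_of_real (ut t x) \<partial>I01)"
      proof (rule integral_cong_AE)
        show "(\<lambda>x. (ut t x)\<^sup>2 + a x * (wderiv (u t) x)\<^sup>2) \<in> borel_measurable I01"
          using L2_measurable[OF L] L2_measurable[OF wd] am by measurable
        show "(\<lambda>x. (cont_rep a x *\<^sub>R ?y x) \<bullet> ?y x + complex_of_real (ut t x) \<bullet> complex_of_real (ut t x)) \<in> borel_measurable I01"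
          by (intro borel_measurable_add borel_measurable_integrable ip_integrable ayL y Lc)
        show "AE x in I01. (ut t x)\<^sup>2 + a x * (wderiv (u t) x)\<^sup>2
          = (cont_rep a x *\<^sub>R ?y x) \<bullet> ?y x + complex_of_real (ut t x) \<bullet> complex_of_real (ut t x)"
          using ae H1_complex_shift(2)[OF uH, of s]
          by eventually_elim (simp add: dot_square_norm)
      qed
      also have "\<dots> = ip (\<lambda>x. cont_rep a x *\<^sub>R ?y x) ?y + ip (\<lambda>x. complex_of_real (ut t x)) (\<lambda>x. complex_of_real (ut t x))"
        unfolding ip_def by (rule Bochner_Integration.integral_add) (intro ip_integrable ayL y Lc)+
      finally have "(\<integral>x. ((ut t x)\<^sup>2 + a x * (wderiv (u t) x)\<^sup>2) \<partial>I01)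
        = ip (\<lambda>x. cont_rep a x *\<^sub>R ?y x) ?y + ip (\<lambda>x. complex_of_real (ut t x)) (\<lambda>x. complex_of_real (ut t x))" .
      then show ?thesis
        using dw.pos unfolding E_def energy_def X_def
        by (simp add: dw.c1_def dw.c0_def dot_square_norm field_simps)
    qed
    have dec: "dw.esq (red (X t)) \<le> 4 * dw.esq (red (X 0)) * exp (- \<nu> * t)"
      by (rule decay[OF S X0 X(1) X(1) X(2) X(2) t]) (use t in auto)
    have E0: "0 \<le> E 0" using Et[of 0] dw.eform_nonneg[OF red_L2[OF X(1)[of 0]]] by simp
    have e: "dw.esq (red (X t)) = 2 * E t" "dw.esq (red (X 0)) = 2 * E 0"
      using Et[OF t] Et[of 0] by auto
    have "E t \<le> 4 * (E 0 * exp (- \<nu> * t))" using dec unfolding e by simp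
    also have "\<dots> \<le> M * (E 0 * exp (- \<nu> * t))" using M(2) E0 by (intro mult_right_mono) auto
    finally show "energy a \<alpha>2 \<beta>1 \<mu>1 u ut \<eta>1 \<eta>2 \<zeta>1 t
      \<le> M * energy a \<alpha>2 \<beta>1 \<mu>1 u ut \<eta>1 \<eta>2 \<zeta>1 0 * exp (- \<nu> * t)"
      by (simp add: E_def mult.assoc)
    have "(SUP x\<in>{0..1}. \<bar>cont_rep (u t) x - s\<bar>\<^sup>2) \<le> M * (E 0 * exp (- \<nu> * t))"
    proof (rule cSUP_least)
      fix x :: real assume x: "x \<in> {0..1}"
      have H: "H1 (\<lambda>x. complex_of_real (u t x - s))" and Lc: "L2 (\<lambda>x. complex_of_real (ut t x))"
        and e2: "cont_rep (\<lambda>x. complex_of_real (u t x - s)) 1 = complex_of_real (\<eta>2 t)"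
        using X(1)[OF t] by (auto simp: X_def state_space_def)
      have uH: "H1 (u t)" by (rule H1_complex_shift_imp[OF H])
      have "\<bar>cont_rep (u t) x - s\<bar> = cmod (cont_rep (\<lambda>x. complex_of_real (u t x - s)) x)"
        unfolding H1_complex_shift(3)[OF uH x] norm_of_real ..
      also have "\<dots> \<le> Cu * sqrt (dw.esq (red (X t)))"
        using Cu(2)[OF H Lc x, of "complex_of_real (\<eta>1 t)" "complex_of_real (\<zeta>1 t)"]
        unfolding e2 by (simp add: X_def del: dw.eform.simps of_real_diff)
      finally have "\<bar>cont_rep (u t) x - s\<bar>\<^sup>2 \<le> (Cu * sqrt (dw.esq (red (X t))))\<^sup>2"
        by (intro power_mono) auto
      also have "\<dots> = Cu\<^sup>2 * dw.esq (red (X t))"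
        using dw.eform_nonneg[OF red_L2[OF X(1)[OF t]]] by (simp add: power_mult_distrib)
      also have "\<dots> \<le> Cu\<^sup>2 * (8 * (E 0 * exp (- \<nu> * t)))"
        using dec unfolding e(2) by (intro mult_left_mono) auto
      also have "\<dots> = 8 * Cu\<^sup>2 * (E 0 * exp (- \<nu> * t))" by simp
      also have "\<dots> \<le> M * (E 0 * exp (- \<nu> * t))" using M(3) E0 by (intro mult_right_mono) auto
      finally show "\<bar>cont_rep (u t) x - s\<bar>\<^sup>2 \<le> M * (E 0 * exp (- \<nu> * t))" .
    qed simp
    then show "(SUP x\<in>{0..1}. \<bar>cont_rep (u t) x - u_star u0 \<eta>20\<bar>\<^sup>2)
      \<le> M * energy a \<alpha>2 \<beta>1 \<mu>1 u ut \<eta>1 \<eta>2 \<zeta>1 0 * exp (- \<nu> * t)"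
      by (simp add: E_def s_def mult.assoc)
  qed
qed

end
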